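(* Let $z\sim N(0,I_n)$ and let $f=(f_1,\dots,f_n):\mathbb R^n\to\mathbb R^n$ be such that each $f_i$ is weakly differentiable with $\mathbb E[f_i(z)^2]+\mathbb E[\|\nabla f_i(z)\|^2]<+\infty$. Let $\xi=z^\top f(z)-\operatorname{div} f(z)$. For $\mu\in\mathbb R^n$, $A\in\mathbb R^{n\times n}$ let $\xi_{\mu,A}=z^\top(\mu+Az)-\operatorname{trace}A$. Let $\bar\mu=\mathbb E[f(z)]$ and $\bar A=\mathbb E[\nabla f(z)]$. (1) $\xi_{\bar\mu,\bar A}$ is the $L_2$ orthogonal projection of $\xi$ onto $\mathscr H_{1,2}$, and $$\mathbb E[(\xi-\xi_{\bar\mu,\bar A})^2]=\mathbb E[\|f(z)-\bar\mu\|^2]-\|\bar A\|_F^2+\mathbb E\operatorname{trace}[\{\nabla f(z)-\bar A\}^2]\le 2\,\mathbb E[\|\{\nabla f(z)-\bar A\}^s\|_F^2].$$ Consequently, $\xi_{\bar\mu,0}$ is the projection of both $\xi$ and $\xi_{\bar\mu,\bar A}$ onto $\mathscr H_1$, with $\mathbb E[(\xi_{\bar\mu,\bar A}-\xi_{\bar\mu,0})^2]=2\|\bar A^s\|_F^2$; and $\xi_{0,\bar A}$ is the projection of both $\xi$ and $\xi_{\bar\mu,\bar A}$ onto $\mathscr H_2$, with $\mathbb E[(\xi_{\bar\mu,\bar A}-\xi_{0,\bar A})^2]=\|\bar\mu\|^2$. (2) Suppose $\mathbb E[\xi^2]>0$. Then $\epsilon_{1,2}^2:=1-\mathbb E[\xi_{\bar\mu,\bar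 A}^2]/\mathbb E[\xi^2]$ satisfies $$\epsilon_{1,2}^2\le\bar\epsilon_{1,2}^2:=\frac{2\,\mathbb E[\|\{\nabla f(z)-\bar A\}^s\|_F^2]}{\|\bar\mu\|^2+2\,\mathbb E[\|\{\nabla f(z)\}^s\|_F^2]}.$$ Moreover, along any sequence of such $(n,f)$ for which $\epsilon_{1,2}^2=o(1)$, $$\frac{\|\bar A^s\|_{op}^2}{\|\bar\mu\|^2+\|\bar A^s\|_F^2}\to0\iff \frac{\xi}{\operatorname{Var}[\xi]^{1/2}}\to^d N(0,1).$$ (3) Suppose $\mathbb E[\xi^2]>0$. Then $\epsilon_2^2:=1-\mathbb E[\xi_{0,\bar A}^2]/\mathbb E[\xi^2]$ satisfies $$\epsilon_2^2\le\bar\epsilon_2^2:=\frac{\|\bar\mu\|^2+2\,\mathbb E[\|\{\nabla f(z)-\bar A\}^s\|_F^2]}{\|\bar\mu\|^2+2\,\mathbb E[\|\{\nabla f(z)\}^s\|_F^2]}.$$ Moreover, along any sequence of such $(n,f)$ for which $\epsilon_2^2=o(1)$, $$\frac{\|\bar A^s\|_{op}^2}{\|\bar A^s\|_F^2}\to0\iff\frac{\xi}{\operatorname{Var}[\xi]^{1/2}}\to^dN(0,1).$$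
   Context: $\|\cdot\|$ is the Euclidean norm, $\|\cdot\|_F$ Frobenius norm, $\|\cdot\|_{op}$ operator norm. $\nabla f(x)\in\mathbb R^{n\times n}$ is the matrix whose columns are the weak gradients $\nabla f_1(x),\dots,\nabla f_n(x)$ (transpose of the Jacobian), and $\operatorname{div} f=\operatorname{trace}[\nabla f]$. For a square matrix $M$, $M^s=(M+M^\top)/2$. Define the $L_2$ subspaces $\mathscr H_1=\{\mu^\top z:\mu\in\mathbb R^n\}$, $\mathscr H_2=\{z^\top Az-\operatorname{trace}A: A\in\mathbb R^{n\times n}\}$ (which are orthogonal in $L_2$), and $\mathscr H_{1,2}=\{\mu^\top z+z^\top Az-\operatorname{trace}A:\mu\in\mathbb R^n,A\in\mathbb R^{n\times n}\}=\mathscr H_1\oplus\mathscr H_2$. *)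

theory Defs
  imports "HOL-Probability.Probability"
begin

(* The dimension varies along the sequences considered, so it cannot be a type. A point of
   R^n is a function nat => real in {..<n} \<rightarrow>\<^sub>E UNIV; only the entries of vectors and
   matrices with indices below n are ever used. *)

type_synonym rvec = "nat \<Rightarrow> real"
type_synonym rmat = "nat \<Rightarrow> nat \<Rightarrow> real"

abbreviation vnorm :: "nat \<Rightarrow> rvec \<Rightarrow> real" where
  "vnorm n v \<equiv> L2_set v {..<n}"

definition mvec :: "nat \<Rightarrow> rmat \<Rightarrow> rvec \<Rightarrow> rvec" where
  "mvec n A v = (\<lambda>i. \<Sum>j<n. A i j * v j)"

definition mmul :: "nat \<Rightarrow> rmat \<Rightarrow> rmat \<Rightarrow> rmat" where
  "mmul n A B = (\<lambda>i k. \<Sum>j<n. A i j * B j k)"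

definition mtrace :: "nat \<Rightarrow> rmat \<Rightarrow> real" where
  "mtrace n A = (\<Sum>i<n. A i i)"

definition fnorm :: "nat \<Rightarrow> rmat \<Rightarrow> real" where
  "fnorm n A = L2_set (\<lambda>(i, j). A i j) ({..<n} \<times> {..<n})"

definition opnorm :: "nat \<Rightarrow> rmat \<Rightarrow> real" where
  "opnorm n A = (SUP v\<in>{v. vnorm n v \<le> 1}. vnorm n (mvec n A v))"

definition sym_part :: "rmat \<Rightarrow> rmat" where
  "sym_part A = (\<lambda>i j. (A i j + A j i) / 2)"

abbreviation Rn :: "nat \<Rightarrow> rvec set" where
  "Rn n \<equiv> {..<n} \<rightarrow>\<^sub>E (UNIV :: real set)"

abbreviation lborel_n :: "nat \<Rightarrow> rvec measure" where
  "lborel_n n \<equiv> (\<Pi>\<^sub>M i\<in>{..<n}. lborel)"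

abbreviation borel_n :: "nat \<Rightarrow> rvec measure" where
  "borel_n n \<equiv> (\<Pi>\<^sub>M i\<in>{..<n}. borel)"

definition partial :: "nat \<Rightarrow> (rvec \<Rightarrow> real) \<Rightarrow> rvec \<Rightarrow> real" where
  "partial i \<phi> x = deriv (\<lambda>t. \<phi> (x(i := t))) (x i)"

(* The topology of the function type is the product topology, and the topology it induces on
   Rn n is that of Euclidean n-space. *)
primrec C_k :: "nat \<Rightarrow> nat \<Rightarrow> (rvec \<Rightarrow> real) \<Rightarrow> bool" where
  "C_k n 0 \<phi> \<longleftrightarrow> continuous_on (Rn n) \<phi>"
| "C_k n (Suc k) \<phi> \<longleftrightarrow> continuous_on (Rn n) \<phi> \<and>
     (\<forall>i<n. (\<forall>x\<in>Rn n. (\<lambda>t. \<phi> (x(i := t))) field_differentiable at (x i)) \<and> C_k n k (partial i \<phi>))"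

definition test_functions :: "nat \<Rightarrow> (rvec \<Rightarrow> real) set" where
  "test_functions n = {\<phi>. (\<forall>k. C_k n k \<phi>) \<and>
     (\<exists>R. \<forall>x\<in>Rn n. (\<exists>i<n. \<bar>x i\<bar> > R) \<longrightarrow> \<phi> x = 0)}"

(* The closed cubes exhaust R^n, so this is integrability over every compact set. *)
definition loc_integrable :: "nat \<Rightarrow> (rvec \<Rightarrow> real) \<Rightarrow> bool" where
  "loc_integrable n u \<longleftrightarrow> u \<in> borel_measurable (lborel_n n) \<and>
     (\<forall>R. set_integrable (lborel_n n) ({..<n} \<rightarrow>\<^sub>E {-R..R}) u)"

(* Weak gradients are unique up to null sets; g is one version. *)
definition has_weak_gradient :: "nat \<Rightarrow> (rvec \<Rightarrow> real) \<Rightarrow> (rvec \<Rightarrow> rvec) \<Rightarrow> bool" where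
  "has_weak_gradient n u g \<longleftrightarrow> loc_integrable n u \<and>
     (\<forall>i<n. loc_integrable n (\<lambda>x. g x i) \<and>
        (\<forall>\<phi>\<in>test_functions n.
           (\<integral>x. u x * partial i \<phi> x \<partial>lborel_n n) = - (\<integral>x. g x i * \<phi> x \<partial>lborel_n n)))"

definition std_gaussian_vector :: "nat \<Rightarrow> 'a measure \<Rightarrow> ('a \<Rightarrow> rvec) \<Rightarrow> bool" where
  "std_gaussian_vector n M z \<longleftrightarrow> z \<in> M \<rightarrow>\<^sub>M borel_n n \<and>
     distr M (borel_n n) z = (\<Pi>\<^sub>M i\<in>{..<n}. std_normal_distribution)"

(* G x is the transposed Jacobian: G x i j is the i-th weak partial derivative of f_j at x,
   so that the columns of G x are the gradients. *)
definition stein_model ::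
  "nat \<Rightarrow> 'a measure \<Rightarrow> ('a \<Rightarrow> rvec) \<Rightarrow> (rvec \<Rightarrow> rvec) \<Rightarrow> (rvec \<Rightarrow> rmat) \<Rightarrow> bool" where
  "stein_model n M z f G \<longleftrightarrow> 1 \<le> n \<and> prob_space M \<and> std_gaussian_vector n M z \<and>
     (\<forall>j<n. has_weak_gradient n (\<lambda>x. f x j) (\<lambda>x i. G x i j) \<and>
        integrable M (\<lambda>\<omega>. (f (z \<omega>) j)\<^sup>2) \<and>
        integrable M (\<lambda>\<omega>. (vnorm n (\<lambda>i. G (z \<omega>) i j))\<^sup>2))"

definition xi :: "nat \<Rightarrow> ('a \<Rightarrow> rvec) \<Rightarrow> (rvec \<Rightarrow> rvec) \<Rightarrow> (rvec \<Rightarrow> rmat) \<Rightarrow> 'a \<Rightarrow> real" where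
  "xi n z f G \<omega> = (\<Sum>i<n. z \<omega> i * f (z \<omega>) i) - mtrace n (G (z \<omega>))"

definition xi_lin :: "nat \<Rightarrow> ('a \<Rightarrow> rvec) \<Rightarrow> rvec \<Rightarrow> rmat \<Rightarrow> 'a \<Rightarrow> real" where
  "xi_lin n z \<mu> A \<omega> = (\<Sum>i<n. z \<omega> i * (\<mu> i + mvec n A (z \<omega>) i)) - mtrace n A"

definition mean_f :: "'a measure \<Rightarrow> ('a \<Rightarrow> rvec) \<Rightarrow> (rvec \<Rightarrow> rvec) \<Rightarrow> rvec" where
  "mean_f M z f = (\<lambda>i. \<integral>\<omega>. f (z \<omega>) i \<partial>M)"

definition mean_G :: "'a measure \<Rightarrow> ('a \<Rightarrow> rvec) \<Rightarrow> (rvec \<Rightarrow> rmat) \<Rightarrow> rmat" where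
  "mean_G M z G = (\<lambda>i j. \<integral>\<omega>. G (z \<omega>) i j \<partial>M)"

definition H1 :: "nat \<Rightarrow> ('a \<Rightarrow> rvec) \<Rightarrow> ('a \<Rightarrow> real) set" where
  "H1 n z = {(\<lambda>\<omega>. \<Sum>i<n. \<mu> i * z \<omega> i) | \<mu>. True}"

definition H2 :: "nat \<Rightarrow> ('a \<Rightarrow> rvec) \<Rightarrow> ('a \<Rightarrow> real) set" where
  "H2 n z = {(\<lambda>\<omega>. (\<Sum>i<n. z \<omega> i * mvec n A (z \<omega>) i) - mtrace n A) | A. True}"

definition H12 :: "nat \<Rightarrow> ('a \<Rightarrow> rvec) \<Rightarrow> ('a \<Rightarrow> real) set" where
  "H12 n z = {(\<lambda>\<omega>. (\<Sum>i<n. \<mu> i * z \<omega> i) + (\<Sum>i<n. z \<omega> i * mvec n A (z \<omega>) i) - mtrace n A)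
     | \<mu> A. True}"

definition L2_space :: "'a measure \<Rightarrow> ('a \<Rightarrow> real) set" where
  "L2_space M = {X \<in> borel_measurable M. integrable M (\<lambda>\<omega>. (X \<omega>)\<^sup>2)}"

definition is_L2_projection ::
  "'a measure \<Rightarrow> ('a \<Rightarrow> real) set \<Rightarrow> ('a \<Rightarrow> real) \<Rightarrow> ('a \<Rightarrow> real) \<Rightarrow> bool" where
  "is_L2_projection M V X Y \<longleftrightarrow> X \<in> L2_space M \<and> V \<subseteq> L2_space M \<and> Y \<in> V \<and>
     (\<forall>h\<in>V. (\<integral>\<omega>. (X \<omega> - Y \<omega>) * h \<omega> \<partial>M) = 0)"

definition eps12_sq ::
  "nat \<Rightarrow> 'a measure \<Rightarrow> ('a \<Rightarrow> rvec) \<Rightarrow> (rvec \<Rightarrow> rvec) \<Rightarrow> (rvec \<Rightarrow> rmat) \<Rightarrow> real" where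
  "eps12_sq n M z f G =
     1 - (\<integral>\<omega>. (xi_lin n z (mean_f M z f) (mean_G M z G) \<omega>)\<^sup>2 \<partial>M) / (\<integral>\<omega>. (xi n z f G \<omega>)\<^sup>2 \<partial>M)"

definition eps2_sq ::
  "nat \<Rightarrow> 'a measure \<Rightarrow> ('a \<Rightarrow> rvec) \<Rightarrow> (rvec \<Rightarrow> rvec) \<Rightarrow> (rvec \<Rightarrow> rmat) \<Rightarrow> real" where
  "eps2_sq n M z f G =
     1 - (\<integral>\<omega>. (xi_lin n z (\<lambda>i. 0) (mean_G M z G) \<omega>)\<^sup>2 \<partial>M) / (\<integral>\<omega>. (xi n z f G \<omega>)\<^sup>2 \<partial>M)"

definition standardized_law :: "'a measure \<Rightarrow> ('a \<Rightarrow> real) \<Rightarrow> real measure" where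
  "standardized_law M X = distr M borel (\<lambda>\<omega>. X \<omega> / sqrt (prob_space.variance M X))"

end

theory Submission
  imports Defs "HOL-Real_Asymp.Real_Asymp"
begin

text \<open>
  Everything is transported to the Gaussian measure on \<open>\<real>\<^sup>n\<close>, where functions are expanded in products of
  Hermite polynomials. Testing a weak gradient against Hermite products times a Gaussian, cut off by
  a smooth bump, shows that the expansion commutes with weak differentiation. The second order Stein formula
  for polynomials therefore extends, by density, to all weakly differentiable functions of finite Gaussian
  Sobolev norm, and the Poincare inequality follows from Bessel's inequality. Polarizing the Stein formula
  against affine fields gives all projections and variances.

  For the limit theorems, \<open>\<xi>\<close> is replaced by its projection \<open>Y = \<mu>\<^sup>T z + z\<^sup>T A z - trace A\<close>
  with symmetric \<open>A\<close>. Gaussian integration by parts yields \<open>E Y e\<^sup>i\<^sup>s\<^sup>Y = i s E \<Gamma> e\<^sup>i\<^sup>s\<^sup>Y\<close> where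
  \<open>\<Gamma>\<close> has mean \<open>Var Y\<close> and standard deviation at most \<open>3 \<parallel>A\<parallel>\<^sub>o\<^sub>p (Var Y)\<^sup>1\<^sup>/\<^sup>2\<close>; solving this differential
  equation approximately shows that a small operator norm forces a normal limit. Conversely, translating
  \<open>z\<close> by \<open>r\<close> along a direction \<open>q\<close> with \<open>\<bar>q\<^sup>T A q\<bar> \<ge> \<parallel>A\<parallel>\<^sub>o\<^sub>p / 2\<close> moves \<open>Y\<close> by about \<open>r\<^sup>2 q\<^sup>T A q\<close> but costs, by
  the Cameron-Martin formula, only a factor \<open>exp (r\<^sup>2)\<close> in probability, so that the tails of \<open>Y\<close> are heavier than
  Gaussian ones unless the operator norm is negligible.
\<close>

section \<open>Square-integrable functions and their closures\<close>


text \<open>Two obstacles shape the proof. The field and its weak gradient are only square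
  integrable under the Gaussian, so no pointwise growth bound is available. In Hermite coordinates
  differentiation is an index shift, so one truncation approximates \<open>u\<close> and all its
  derivatives at once. That x_i u - g_i is square integrable is itself a consequence: a commutation
  identity makes its approximants Cauchy. The inequality in (1) is Poincare for f_j minus its affine
  part, whose gradient is column j of G - A; the rest of (1) is algebra with the Stein formula. In
  the converse limit theorem, weak convergence gives no convergence of moments, so a fourth moment
  argument would need uniform integrability. One event |x| >= y with null boundary is enough
  instead. Its choice rests on orders of growth: a shift of length r costs exp (r^2), while it
  reaches a threshold of order r^2, where a Gaussian tail is of order exp (- c r^4). The criterion
  in (3) reduces to that in (2), since vanishing of the second chaos error makes the linear part
  negligible.\<close>

lemma L2_measurable [measurable_dest]: "u \<in> L2_space M \<Longrightarrow> u \<in> borel_measurable M"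
  by (simp add: L2_space_def)

lemma L2_square_integrable: "u \<in> L2_space M \<Longrightarrow> integrable M (\<lambda>x. (u x)\<^sup>2)"
  by (simp add: L2_space_def)

lemma L2_dominated:
  assumes "v \<in> L2_space M" "u \<in> borel_measurable M" "\<And>x. x \<in> space M \<Longrightarrow> \<bar>u x\<bar> \<le> \<bar>v x\<bar>"
  shows "u \<in> L2_space M"
proof -
  have "integrable M (\<lambda>x. (u x)\<^sup>2)"
    by (rule Bochner_Integration.integrable_bound[OF L2_square_integrable[OF assms(1)]])
       (use assms in \<open>auto intro!: AE_I2 simp: abs_le_square_iff\<close>)
  then show ?thesis using assms by (simp add: L2_space_def)
qed

lemma L2_mult_integrable:
  assumes "u \<in> L2_space M" "v \<in> L2_space M"
  shows "integrable M (\<lambda>x. u x * v x)"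
proof (rule Bochner_Integration.integrable_bound)
  show "integrable M (\<lambda>x. (u x)\<^sup>2 + (v x)\<^sup>2)"
    using assms by (simp add: L2_square_integrable)
  show "(\<lambda>x. u x * v x) \<in> borel_measurable M"
    using assms by (auto simp: L2_space_def)
  have "\<bar>a * b\<bar> \<le> a\<^sup>2 + b\<^sup>2" for a b :: real
    using sum_squares_bound[of "\<bar>a\<bar>" "\<bar>b\<bar>"] mult_nonneg_nonneg[of "\<bar>a\<bar>" "\<bar>b\<bar>"]
    unfolding abs_mult power2_abs by linarith
  then show "AE x in M. norm (u x * v x) \<le> norm ((u x)\<^sup>2 + (v x)\<^sup>2)"
    by (intro AE_I2) simp
qed

lemma L2_scale: "u \<in> L2_space M \<Longrightarrow> (\<lambda>x. c * u x) \<in> L2_space M"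
  by (auto simp: L2_space_def power_mult_distrib)

lemma L2_zero: "(\<lambda>x. 0) \<in> L2_space M"
  by (simp add: L2_space_def)

lemma L2_add:
  assumes "u \<in> L2_space M" "v \<in> L2_space M"
  shows "(\<lambda>x. u x + v x) \<in> L2_space M"
  using assms L2_mult_integrable[OF assms] 
  by (auto simp: L2_space_def power2_sum mult.assoc)

lemma L2_diff:
  assumes "u \<in> L2_space M" "v \<in> L2_space M"
  shows "(\<lambda>x. u x - v x) \<in> L2_space M"
  using L2_add[OF assms(1) L2_scale[OF assms(2), of "-1"]] by simp

lemma L2_sum: "(\<And>i. i \<in> I \<Longrightarrow> u i \<in> L2_space M) \<Longrightarrow> (\<lambda>x. \<Sum>i\<in>I. u i x) \<in> L2_space M"
  by (induction I rule: infinite_finite_induct) (auto simp: L2_zero L2_add)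

lemma (in finite_measure) L2_const: "(\<lambda>x. c) \<in> L2_space M"
  by (simp add: L2_space_def)

lemma (in finite_measure) L2_integrable: "u \<in> L2_space M \<Longrightarrow> integrable M u"
  using L2_mult_integrable[OF _ L2_const[of 1]] by simp

text \<open>Discriminant argument: the integral of (s u - t v)^2 is a nonnegative quadratic form in
  (s, t) with coefficients \<open>a\<close>, \<open>b\<close>, \<open>c\<close>.\<close>

lemma L2_Cauchy_Schwarz:
  assumes u: "u \<in> L2_space M" and v: "v \<in> L2_space M"
  shows "(\<integral>x. u x * v x \<partial>M)\<^sup>2 \<le> (\<integral>x. (u x)\<^sup>2 \<partial>M) * (\<integral>x. (v x)\<^sup>2 \<partial>M)"
proof -
  define a b c where "a = (\<integral>x. (u x)\<^sup>2 \<partial>M)" "b = (\<integral>x. u x * v x \<partial>M)" "c = (\<integral>x. (v x)\<^sup>2 \<partial>M)"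
  note [simp] = L2_mult_integrable[OF u v] L2_square_integrable[OF u] L2_square_integrable[OF v]
  have *: "0 \<le> a * s\<^sup>2 - 2 * b * s * t + c * t\<^sup>2" for s t
  proof -
    have "0 \<le> (\<integral>x. (s * u x - t * v x)\<^sup>2 \<partial>M)" by simp
    also have "(\<lambda>x. (s * u x - t * v x)\<^sup>2) = (\<lambda>x. s\<^sup>2 * (u x)\<^sup>2 - 2 * s * t * (u x * v x) + t\<^sup>2 * (v x)\<^sup>2)"
      by (auto simp: power2_eq_square algebra_simps)
    finally have "0 \<le> s\<^sup>2 * a - 2 * s * t * b + t\<^sup>2 * c" by (simp add: a_b_c_def)
    then show ?thesis by (simp add: algebra_simps)
  qed
  have "a \<ge> 0" "c \<ge> 0" by (simp_all add: a_b_c_def)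
  show ?thesis unfolding a_b_c_def[symmetric]
  proof (cases "c = 0")
    case True
    have "b = 0"
    proof (rule ccontr)
      assume "b \<noteq> 0"
      \<comment> \<open>With \<open>c\<close> = 0 the form is affine in t at s = 1, and this t makes
        it equal to -a - 2.\<close>
      have "0 \<le> a * 1\<^sup>2 - 2 * b * 1 * ((a + 1) / b)" using *[of 1 "(a+1)/b"] True by simp
      also have "\<dots> = - a - 2" using \<open>b \<noteq> 0\<close> by simp
      finally show False using \<open>a \<ge> 0\<close> by simp
    qed
    then show "b\<^sup>2 \<le> a * c" using True by simp
  next
    case False
    \<comment> \<open>At s = c, t = b the form factors as c (a c - b^2).\<close>
    have "0 \<le> c * (a * c - b\<^sup>2)" using *[of c b] by (simp add: power2_eq_square algebra_simps)
    then show "b\<^sup>2 \<le> a * c" using False \<open>c \<ge> 0\<close> by (simp add: zero_le_mult_iff)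
  qed
qed

lemma L2_Cauchy_Schwarz_abs:
  assumes u: "u \<in> L2_space M" and v: "v \<in> L2_space M"
  shows "\<bar>\<integral>x. u x * v x \<partial>M\<bar> \<le> sqrt (\<integral>x. (u x)\<^sup>2 \<partial>M) * sqrt (\<integral>x. (v x)\<^sup>2 \<partial>M)"
  using real_sqrt_le_mono[OF L2_Cauchy_Schwarz[OF assms]] by (simp add: real_sqrt_mult)

lemma (in prob_space) L2_abs_integral_le:
  assumes u: "u \<in> L2_space M"
  shows "(\<integral>x. \<bar>u x\<bar> \<partial>M) \<le> sqrt (\<integral>x. (u x)\<^sup>2 \<partial>M)"
proof -
  have "(\<lambda>x. \<bar>u x\<bar>) \<in> L2_space M" using u by (intro L2_dominated[OF u]) auto
  from L2_Cauchy_Schwarz_abs[OF this L2_const[of 1]] show ?thesis by (simp add: prob_space)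
qed

lemma L2_sum_square_le:
  assumes "u \<in> L2_space M" "v \<in> L2_space M"
  shows "(\<integral>x. (u x + v x)\<^sup>2 \<partial>M) \<le> 2 * (\<integral>x. (u x)\<^sup>2 \<partial>M) + 2 * (\<integral>x. (v x)\<^sup>2 \<partial>M)"
proof -
  have "(\<integral>x. (u x + v x)\<^sup>2 \<partial>M) \<le> (\<integral>x. 2 * (u x)\<^sup>2 + 2 * (v x)\<^sup>2 \<partial>M)"
  proof (rule integral_mono)
    show "(u x + v x)\<^sup>2 \<le> 2 * (u x)\<^sup>2 + 2 * (v x)\<^sup>2" for x
      using zero_le_power2[of "u x - v x"] by (simp add: power2_eq_square algebra_simps)
  qed (use L2_square_integrable[OF L2_add[OF assms]] assms in \<open>auto simp: L2_square_integrable\<close>)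
  also have "\<dots> = 2 * (\<integral>x. (u x)\<^sup>2 \<partial>M) + 2 * (\<integral>x. (v x)\<^sup>2 \<partial>M)"
    using assms by (simp add: L2_square_integrable)
  finally show ?thesis .
qed

lemma L2_triangle_le:
  assumes "u \<in> L2_space M" "v \<in> L2_space M" "w \<in> L2_space M"
  shows "(\<integral>x. (u x - w x)\<^sup>2 \<partial>M) \<le> 2 * (\<integral>x. (u x - v x)\<^sup>2 \<partial>M) + 2 * (\<integral>x. (v x - w x)\<^sup>2 \<partial>M)"
  using L2_sum_square_le[OF L2_diff[OF assms(1,2)] L2_diff[OF assms(2,3)]] by simp

text \<open>The difference of inner products splits into one term with two errors and two terms with
  one error each; Cauchy-Schwarz bounds every term by square roots of the two distances.\<close>

lemma L2_tendsto_inner: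
  assumes "\<And>k. us k \<in> L2_space M" "u \<in> L2_space M" "\<And>k. vs k \<in> L2_space M" "v \<in> L2_space M"
    and cu: "(\<lambda>k::nat. \<integral>x. (us k x - u x)\<^sup>2 \<partial>M) \<longlonglongrightarrow> 0"
    and cv: "(\<lambda>k. \<integral>x. (vs k x - v x)\<^sup>2 \<partial>M) \<longlonglongrightarrow> 0"
  shows "(\<lambda>k. \<integral>x. us k x * vs k x \<partial>M) \<longlonglongrightarrow> (\<integral>x. u x * v x \<partial>M)"
proof -
  define A where "A = (\<lambda>k. \<integral>x. (us k x - u x)\<^sup>2 \<partial>M)"
  define B where "B = (\<lambda>k. \<integral>x. (vs k x - v x)\<^sup>2 \<partial>M)"
  note L = assms(1-4) L2_diff[OF assms(1,2)] L2_diff[OF assms(3,4)]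
  have "(\<lambda>k. (\<integral>x. us k x * vs k x \<partial>M) - (\<integral>x. u x * v x \<partial>M)) \<longlonglongrightarrow> 0"
  proof (rule Lim_null_comparison[OF always_eventually])
    show "\<forall>k. norm ((\<integral>x. us k x * vs k x \<partial>M) - (\<integral>x. u x * v x \<partial>M)) \<le>
       sqrt (A k) * sqrt (B k) + sqrt (A k) * sqrt (\<integral>x. (v x)\<^sup>2 \<partial>M) + sqrt (\<integral>x. (u x)\<^sup>2 \<partial>M) * sqrt (B k)"
    proof
      fix k
      have eq: "us k x * vs k x = (us k x - u x) * (vs k x - v x) + (us k x - u x) * v x
          + u x * (vs k x - v x) + u x * v x" for x
        by (simp add: algebra_simps)
      have diff: "(\<integral>x. us k x * vs k x \<partial>M) - (\<integral>x. u x * v x \<partial>M) = (\<integral>x. (us k x - u x) * (vs k x - v x) \<partial>M)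
         + (\<integral>x. (us k x - u x) * v x \<partial>M) + (\<integral>x. u x * (vs k x - v x) \<partial>M)"
        unfolding eq by (simp add: L2_mult_integrable L)
      show "norm ((\<integral>x. us k x * vs k x \<partial>M) - (\<integral>x. u x * v x \<partial>M)) \<le>
       sqrt (A k) * sqrt (B k) + sqrt (A k) * sqrt (\<integral>x. (v x)\<^sup>2 \<partial>M) + sqrt (\<integral>x. (u x)\<^sup>2 \<partial>M) * sqrt (B k)"
        using L2_Cauchy_Schwarz_abs[OF L2_diff[OF assms(1,2)] L2_diff[OF assms(3,4)], of k k]
          L2_Cauchy_Schwarz_abs[OF L2_diff[OF assms(1,2)] assms(4), of k]
          L2_Cauchy_Schwarz_abs[OF assms(2) L2_diff[OF assms(3,4)], of k]
        unfolding A_def B_def diff real_norm_def by linarith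
    qed
    have "A \<longlonglongrightarrow> 0" "B \<longlonglongrightarrow> 0" using cu cv by (simp_all add: A_def B_def)
    note * = tendsto_real_sqrt[OF this(1)] tendsto_real_sqrt[OF this(2)]
    show "(\<lambda>k. sqrt (A k) * sqrt (B k) + sqrt (A k) * sqrt (\<integral>x. (v x)\<^sup>2 \<partial>M)
        + sqrt (\<integral>x. (u x)\<^sup>2 \<partial>M) * sqrt (B k)) \<longlonglongrightarrow> 0"
      by (rule tendsto_eq_intros * refl)+ simp
  qed
  then show ?thesis by (simp add: LIM_zero_iff)
qed

text \<open>For a limit candidate that is only known to be integrable: convergence in L1 identifies
  it with the L2 limit, so its square integrability is a conclusion.\<close>

lemma L2_limit_of_Cauchy:
  assumes us: "\<And>k. us k \<in> L2_space M" "\<And>k. integrable M (us k)"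
    and u: "integrable M u"
    and cauchy: "\<And>e. e > 0 \<Longrightarrow> \<exists>N. \<forall>k\<ge>N. \<forall>l\<ge>N. (\<integral>x. (us k x - us l x)\<^sup>2 \<partial>M) \<le> e"
    and L1: "(\<lambda>k. \<integral>x. \<bar>us k x - u x\<bar> \<partial>M) \<longlonglongrightarrow> 0"
  shows "u \<in> L2_space M" "(\<lambda>k. \<integral>x. (us k x - u x)\<^sup>2 \<partial>M) \<longlonglongrightarrow> 0"
proof -
  have [measurable]: "u \<in> borel_measurable M" "\<And>k. us k \<in> borel_measurable M"
    using us u by auto
  obtain r :: "nat \<Rightarrow> nat" where r: "strict_mono r" and ae: "AE x in M. (\<lambda>k. us (r k) x - u x) \<longlonglongrightarrow> 0"
    using tendsto_L1_AE_subseq[of M "\<lambda>k x. us k x - u x"] us u L1 by auto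
  \<comment> \<open>Fatou along the almost everywhere convergent subsequence turns the Cauchy bound
    on \<open>us k - us (r l)\<close> into a bound on \<open>us k - u\<close>.\<close>
  have key: "integrable M (\<lambda>x. (us k x - u x)\<^sup>2) \<and> (\<integral>x. (us k x - u x)\<^sup>2 \<partial>M) \<le> e"
    if N: "\<forall>k\<ge>N. \<forall>l\<ge>N. (\<integral>x. (us k x - us l x)\<^sup>2 \<partial>M) \<le> e" and k: "k \<ge> N" and e: "e > 0" for e k N
  proof -
    have "(\<integral>\<^sup>+x. ennreal ((us k x - u x)\<^sup>2) \<partial>M) = (\<integral>\<^sup>+x. liminf (\<lambda>l. ennreal ((us k x - us (r l) x)\<^sup>2)) \<partial>M)"
    proof (rule nn_integral_cong_AE, use ae in eventually_elim)
      case (elim x)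
      then have "(\<lambda>l. us (r l) x) \<longlonglongrightarrow> u x" by (simp add: LIM_zero_iff)
      then have "(\<lambda>l. ennreal ((us k x - us (r l) x)\<^sup>2)) \<longlonglongrightarrow> ennreal ((us k x - u x)\<^sup>2)"
        by (intro tendsto_ennrealI tendsto_intros)
      then show ?case using lim_imp_Liminf[OF sequentially_bot] by metis
    qed
    also have "\<dots> \<le> liminf (\<lambda>l. \<integral>\<^sup>+x. ennreal ((us k x - us (r l) x)\<^sup>2) \<partial>M)"
      by (rule nn_integral_liminf) simp
    also have "\<dots> \<le> liminf (\<lambda>l::nat. ennreal e)"
    proof (rule Liminf_mono)
      show "\<forall>\<^sub>F l in sequentially. (\<integral>\<^sup>+x. ennreal ((us k x - us (r l) x)\<^sup>2) \<partial>M) \<le> ennreal e"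
      proof (rule eventually_sequentiallyI[of N])
        fix l assume "N \<le> l"
        then have "N \<le> r l" using seq_suble[OF r, of l] by linarith
        have "(\<integral>\<^sup>+x. ennreal ((us k x - us (r l) x)\<^sup>2) \<partial>M) = ennreal (\<integral>x. (us k x - us (r l) x)\<^sup>2 \<partial>M)"
          by (intro nn_integral_eq_integral L2_square_integrable L2_diff us) auto
        also have "\<dots> \<le> ennreal e" using N k \<open>N \<le> r l\<close> by (intro ennreal_leI) auto
        finally show "(\<integral>\<^sup>+x. ennreal ((us k x - us (r l) x)\<^sup>2) \<partial>M) \<le> ennreal e" .
      qed
    qed
    also have "\<dots> = ennreal e" by (intro lim_imp_Liminf) auto
    finally have le: "(\<integral>\<^sup>+x. ennreal ((us k x - u x)\<^sup>2) \<partial>M) \<le> ennreal e" .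
    have int: "integrable M (\<lambda>x. (us k x - u x)\<^sup>2)"
      using le by (intro integrableI_bounded) (auto simp: top.extremum_strict intro: le_less_trans)
    have "ennreal (\<integral>x. (us k x - u x)\<^sup>2 \<partial>M) \<le> ennreal e"
      using le nn_integral_eq_integral[OF int] by simp
    then show ?thesis using int e by (simp add: ennreal_le_iff)
  qed
  obtain N where N: "\<forall>k\<ge>N. \<forall>l\<ge>N. (\<integral>x. (us k x - us l x)\<^sup>2 \<partial>M) \<le> 1"
    using cauchy[of 1] by auto
  have "(\<lambda>x. us N x - u x) \<in> L2_space M"
    using key[OF N, of N] by (auto simp: L2_space_def)
  from L2_diff[OF us(1)[of N] this] show "u \<in> L2_space M" by simp
  show "(\<lambda>k. \<integral>x. (us k x - u x)\<^sup>2 \<partial>M) \<longlonglongrightarrow> 0"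
  proof (rule LIMSEQ_I)
    fix e :: real assume "e > 0"
    then obtain N where N: "\<forall>k\<ge>N. \<forall>l\<ge>N. (\<integral>x. (us k x - us l x)\<^sup>2 \<partial>M) \<le> e/2"
      using cauchy[of "e/2"] by auto
    have "norm ((\<integral>x. (us k x - u x)\<^sup>2 \<partial>M) - 0) < e" if "k \<ge> N" for k
      using key[OF N that] \<open>e > 0\<close> by auto
    then show "\<exists>no. \<forall>k\<ge>no. norm ((\<integral>x. (us k x - u x)\<^sup>2 \<partial>M) - 0) < e" by blast
  qed
qed

section \<open>L2 closures of function spaces, and density reduced to indicator functions\<close>

locale L2_subspace = finite_measure M for M :: "'a measure" +
  fixes V :: "('a \<Rightarrow> real) set"
  assumes V_L2: "V \<subseteq> L2_space M"
    and V_add: "u \<in> V \<Longrightarrow> v \<in> V \<Longrightarrow> (\<lambda>x. u x + v x) \<in> V"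
    and V_scale: "u \<in> V \<Longrightarrow> (\<lambda>x. c * u x) \<in> V"
begin

definition L2_closure :: "('a \<Rightarrow> real) set" where
  "L2_closure = {u \<in> L2_space M. \<forall>e>0. \<exists>v\<in>V. (\<integral>x. (u x - v x)\<^sup>2 \<partial>M) < e}"

lemma closure_L2: "u \<in> L2_closure \<Longrightarrow> u \<in> L2_space M"
  by (simp add: L2_closure_def)

lemma V_L2D: "u \<in> V \<Longrightarrow> u \<in> L2_space M"
  using V_L2 by blast

lemma closure_approx:
  assumes "u \<in> L2_closure" "e > 0"
  obtains v where "v \<in> V" "(\<integral>x. (u x - v x)\<^sup>2 \<partial>M) < e"
  using assms by (auto simp: L2_closure_def)

lemma closure_superset:
  assumes "u \<in> V"
  shows "u \<in> L2_closure"
proof -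
  have "\<exists>v\<in>V. (\<integral>x. (u x - v x)\<^sup>2 \<partial>M) < e" if "e > 0" for e
    using assms that by (intro bexI[of _ u]) auto
  then show ?thesis using assms V_L2 by (auto simp: L2_closure_def)
qed

lemma closure_closed:
  assumes u: "u \<in> L2_space M" and ex: "\<And>e. e > 0 \<Longrightarrow> \<exists>v\<in>L2_closure. (\<integral>x. (u x - v x)\<^sup>2 \<partial>M) < e"
  shows "u \<in> L2_closure"
proof -
  have "\<exists>v\<in>V. (\<integral>x. (u x - v x)\<^sup>2 \<partial>M) < e" if "e > 0" for e
  proof -
    obtain v where v: "v \<in> L2_closure" "(\<integral>x. (u x - v x)\<^sup>2 \<partial>M) < e/4" using ex[of "e/4"] \<open>e > 0\<close> by auto
    then obtain w where w: "w \<in> V" "(\<integral>x. (v x - w x)\<^sup>2 \<partial>M) < e/4"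
      using closure_approx[of v "e/4"] \<open>e > 0\<close> by auto
    have "(\<integral>x. (u x - w x)\<^sup>2 \<partial>M) < e"
      using L2_triangle_le[OF u closure_L2[OF v(1)] V_L2D[OF w(1)]] w(2) v(2) by linarith
    then show ?thesis using w by blast
  qed
  then show ?thesis using u by (simp add: L2_closure_def)
qed

lemma closure_add:
  assumes u: "u \<in> L2_closure" and v: "v \<in> L2_closure"
  shows "(\<lambda>x. u x + v x) \<in> L2_closure"
proof -
  have "\<exists>w\<in>V. (\<integral>x. ((u x + v x) - w x)\<^sup>2 \<partial>M) < e" if "e > 0" for e
  proof -
    obtain u' where u': "u' \<in> V" "(\<integral>x. (u x - u' x)\<^sup>2 \<partial>M) < e/4"
      using closure_approx[OF u, of "e/4"] \<open>e > 0\<close> by auto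
    obtain v' where v': "v' \<in> V" "(\<integral>x. (v x - v' x)\<^sup>2 \<partial>M) < e/4"
      using closure_approx[OF v, of "e/4"] \<open>e > 0\<close> by auto
    have "(\<integral>x. ((u x - u' x) + (v x - v' x))\<^sup>2 \<partial>M) < e"
      using L2_sum_square_le[OF L2_diff[OF closure_L2[OF u], of u'] L2_diff[OF closure_L2[OF v], of v']]
        V_L2D[OF u'(1)] V_L2D[OF v'(1)] u'(2) v'(2) by linarith
    then have "(\<integral>x. ((u x + v x) - (u' x + v' x))\<^sup>2 \<partial>M) < e" by (simp add: algebra_simps)
    then show ?thesis using V_add[OF u'(1) v'(1)] by (intro bexI[of _ "\<lambda>x. u' x + v' x"])
  qed
  then show ?thesis using closure_L2[OF u] closure_L2[OF v] by (simp add: L2_closure_def L2_add)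
qed

lemma closure_scale:
  assumes u: "u \<in> L2_closure"
  shows "(\<lambda>x. c * u x) \<in> L2_closure"
proof -
  have "\<exists>w\<in>V. (\<integral>x. (c * u x - w x)\<^sup>2 \<partial>M) < e" if "e > 0" for e
  proof -
    have pos: "e / (c\<^sup>2 + 1) > 0" using \<open>e > 0\<close> by (simp add: add_nonneg_pos)
    obtain u' where u': "u' \<in> V" "(\<integral>x. (u x - u' x)\<^sup>2 \<partial>M) < e/(c\<^sup>2 + 1)"
      by (rule closure_approx[OF u pos])
    have "(\<integral>x. (c * u x - c * u' x)\<^sup>2 \<partial>M) = c\<^sup>2 * (\<integral>x. (u x - u' x)\<^sup>2 \<partial>M)"
      unfolding right_diff_distrib[symmetric] power_mult_distrib by simp
    also have "\<dots> \<le> c\<^sup>2 * (e/(c\<^sup>2+1))" using u' by (intro mult_left_mono) auto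
    also have "\<dots> < e" using \<open>e > 0\<close> by (simp add: divide_simps add_nonneg_pos)
    finally show ?thesis using V_scale[OF u'(1)] by (intro bexI[of _ "\<lambda>x. c * u' x"])
  qed
  then show ?thesis using closure_L2[OF u] by (simp add: L2_closure_def L2_scale)
qed

lemma closure_diff: "u \<in> L2_closure \<Longrightarrow> v \<in> L2_closure \<Longrightarrow> (\<lambda>x. u x - v x) \<in> L2_closure"
  using closure_add[OF _ closure_scale[of v "-1"], of u] by simp

text \<open>The locale does not state that \<open>V\<close> contains the zero function, so the empty
  sum is excluded.\<close>

lemma closure_sum:
  "finite I \<Longrightarrow> I \<noteq> {} \<Longrightarrow> (\<And>i. i \<in> I \<Longrightarrow> u i \<in> L2_closure) \<Longrightarrow> (\<lambda>x. \<Sum>i\<in>I. u i x) \<in> L2_closure"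
  by (induction I rule: finite_ne_induct) (auto simp: closure_add)

text \<open>Dominated convergence with majorant 4 w^2 for the squared distances. This is how every
  pointwise limit enters a density argument below.\<close>

lemma closure_dominated:
  assumes us: "\<And>k::nat. us k \<in> L2_closure" and w: "w \<in> L2_space M"
    and bd: "\<And>k x. x \<in> space M \<Longrightarrow> \<bar>us k x\<bar> \<le> w x"
    and lim: "\<And>x. x \<in> space M \<Longrightarrow> (\<lambda>k. us k x) \<longlonglongrightarrow> u x"
  shows "u \<in> L2_closure"
proof (rule closure_closed)
  have [measurable]: "us k \<in> borel_measurable M" for k
    using us closure_L2 by auto
  have um [measurable]: "u \<in> borel_measurable M"
    by (rule borel_measurable_LIMSEQ_real[OF lim]) auto
  have ub: "\<bar>u x\<bar> \<le> w x" if "x \<in> space M" for x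
    by (rule LIMSEQ_le_const2[OF tendsto_rabs[OF lim[OF that]]]) (use bd that in auto)
  show u: "u \<in> L2_space M"
    by (rule L2_dominated[OF w um]) (use ub abs_ge_self order_trans in blast)
  have "(\<lambda>k. \<integral>x. (u x - us k x)\<^sup>2 \<partial>M) \<longlonglongrightarrow> (\<integral>x. 0 \<partial>M)"
  proof (rule integral_dominated_convergence)
    show "integrable M (\<lambda>x. 4 * (w x)\<^sup>2)" using L2_square_integrable[OF w] by simp
    show "AE x in M. (\<lambda>k. (u x - us k x)\<^sup>2) \<longlonglongrightarrow> 0"
      by (rule AE_I2) (use lim in \<open>auto intro!: tendsto_eq_intros\<close>)
    show "AE x in M. norm ((u x - us k x)\<^sup>2) \<le> 4 * (w x)\<^sup>2" for k
    proof (rule AE_I2)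
      fix x assume x: "x \<in> space M"
      have "\<bar>u x - us k x\<bar> \<le> \<bar>2 * w x\<bar>" using ub[OF x] bd[OF x, of k] by linarith
      then show "norm ((u x - us k x)\<^sup>2) \<le> 4 * (w x)\<^sup>2"
        unfolding abs_le_square_iff by (simp add: power_mult_distrib)
    qed
  qed auto
  then have "(\<lambda>k. \<integral>x. (u x - us k x)\<^sup>2 \<partial>M) \<longlonglongrightarrow> 0" by simp
  then show "\<exists>v\<in>L2_closure. (\<integral>x. (u x - v x)\<^sup>2 \<partial>M) < e" if "e > 0" for e
    using us order_tendstoD(2)[OF _ that] eventually_happens'[OF sequentially_bot] by blast
qed

text \<open>A Dynkin system argument: sets with indicator in the closure are stable under
  complements, by subtraction from 1, and under disjoint countable unions, by domination of the
  partial sums.\<close>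

lemma closure_indicator:
  assumes G: "Int_stable G" "G \<subseteq> Pow (space M)" "sets M = sigma_sets (space M) G"
    and ind: "\<And>A. A \<in> G \<Longrightarrow> indicat_real A \<in> L2_closure" and one: "(\<lambda>x. 1) \<in> L2_closure"
    and A: "A \<in> sets M"
  shows "indicat_real A \<in> L2_closure"
proof -
  have "A \<in> sigma_sets (space M) G" using A G by simp
  then show ?thesis
  proof (induction rule: sigma_sets_induct_disjoint[OF G(1,2), consumes 1, case_names basic empty compl union])
    case (basic A) then show ?case by (rule ind)
  next
    case empty
    show ?case using closure_scale[OF one, of 0] by simp
  next
    case (compl A)
    then have "A \<in> sets M" using G by simp
    have "(\<lambda>x. 1 - indicat_real A x) \<in> L2_closure" by (rule closure_diff[OF one compl(2)])
    \<comment> \<open>The indicator of the complement equals 1 - \<open>indicat_real A\<close> only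
      on the space of \<open>M\<close>, so a constant sequence passes from one function to the
      other.\<close>
    then show ?case
      by (rule closure_dominated[where us = "\<lambda>_ x. 1 - indicat_real A x", OF _ L2_const[of 1]])
         (auto simp: indicator_def)
  next
    case (union A)
    show ?case
    proof (rule closure_dominated[where us = "\<lambda>k x. \<Sum>i\<in>{..k}. indicat_real (A i) x" and w = "\<lambda>_. 1"])
      show "(\<lambda>x. \<Sum>i\<le>k. indicat_real (A i) x) \<in> L2_closure" for k
        by (rule closure_sum) (use union in auto)
      have eq: "(\<Sum>i\<le>k. indicat_real (A i) x) = indicat_real (\<Union>i\<le>k. A i) x" for k x
        using union(1) by (subst indicator_UN_disjoint) (auto simp: disjoint_family_on_def)
      show "\<bar>\<Sum>i\<le>k. indicat_real (A i) x\<bar> \<le> 1" for k x unfolding eq by (auto simp: indicator_def)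
      show "(\<lambda>k. \<Sum>i\<le>k. indicat_real (A i) x) \<longlonglongrightarrow> indicat_real (\<Union> (range A)) x" for x
        unfolding eq using LIMSEQ_Suc[OF LIMSEQ_indicator_UN[of A x]]
        by (simp add: lessThan_Suc_atMost)
    qed (rule L2_const)
  qed
qed

text \<open>Every L2 function is a pointwise limit of simple functions bounded by twice its modulus,
  and each of them is a finite combination of indicators.\<close>

lemma closure_eq_L2:
  assumes ind: "\<And>A. A \<in> sets M \<Longrightarrow> indicat_real A \<in> L2_closure"
    and u: "u \<in> L2_space M"
  shows "u \<in> L2_closure"
proof -
  obtain s where s: "\<And>i. simple_function M (s i)" "\<And>x. x \<in> space M \<Longrightarrow> (\<lambda>i. s i x) \<longlonglongrightarrow> u x"
    "\<And>i x. x \<in> space M \<Longrightarrow> norm (s i x) \<le> 2 * norm (u x)"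
    using borel_measurable_implies_sequence_metric[OF L2_measurable[OF u], of 0]
    unfolding dist_norm diff_0_right by blast
  show ?thesis
  proof (cases "space M = {}")
    \<comment> \<open>Here the simple functions have empty range, so their expansion would be an
      empty sum; every function is a vacuous pointwise limit instead.\<close>
    case True
    then have "indicat_real {} \<in> L2_closure \<and> u \<in> L2_closure"
      using ind[of "{}"] closure_dominated[of "\<lambda>_. indicat_real {}" "\<lambda>_. 1" u] L2_const by auto
    then show ?thesis by simp
  next
    case False
    show ?thesis
    proof (rule closure_dominated[where us = "\<lambda>i x. \<Sum>y\<in>s i ` space M. y * indicat_real (s i -` {y} \<inter> space M) x"])
      fix i
      have fin: "finite (s i ` space M)" using s(1) by (simp add: simple_function_def)
      show "(\<lambda>x. \<Sum>y\<in>s i ` space M. y * indicat_real (s i -` {y} \<inter> space M) x) \<in> L2_closure"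
        using False fin s(1) by (intro closure_sum closure_scale ind) (auto simp: simple_function_def)
    next
      have eq: "(\<Sum>y\<in>s i ` space M. y * indicat_real (s i -` {y} \<inter> space M) x) = s i x" if "x \<in> space M" for i x
      proof -
        have fin: "finite (s i ` space M)" using s(1) by (simp add: simple_function_def)
        have "(\<Sum>y\<in>s i ` space M. y * indicat_real (s i -` {y} \<inter> space M) x) =
          (\<Sum>y\<in>s i ` space M. if y = s i x then s i x else 0)"
          by (rule sum.cong) (use that in \<open>auto simp: indicator_def\<close>)
        then show ?thesis using fin that by (simp add: sum.delta')
      qed
      fix x assume x: "x \<in> space M"
      show "\<bar>\<Sum>y\<in>s i ` space M. y * indicat_real (s i -` {y} \<inter> space M) x\<bar> \<le> 2 * \<bar>u x\<bar>" for i
        unfolding eq[OF x] using s(3)[OF x] by simp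
      show "(\<lambda>i. \<Sum>y\<in>s i ` space M. y * indicat_real (s i -` {y} \<inter> space M) x) \<longlonglongrightarrow> u x"
        unfolding eq[OF x] using s(2)[OF x] .
    next
      show "(\<lambda>x. 2 * \<bar>u x\<bar>) \<in> L2_space M"
        by (rule L2_dominated[OF L2_scale[OF u, of 2]]) (use u in auto)
    qed
  qed
qed

end

section \<open>The standard normal distribution and Hermite polynomials\<close>


lemma prob_space_std_normal: "prob_space std_normal_distribution"
  by (simp add: prob_space_normal_density)

lemma integrable_std_normal_iff:
  fixes f :: "real \<Rightarrow> 'b::{banach, second_countable_topology}"
  assumes [measurable]: "f \<in> borel_measurable borel"
  shows "integrable std_normal_distribution f \<longleftrightarrow> integrable lborel (\<lambda>x. std_normal_density x *\<^sub>R f x)"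
  by (subst integrable_density) (auto simp: normal_density_nonneg)

lemma integral_std_normal:
  fixes f :: "real \<Rightarrow> 'b::{banach, second_countable_topology}"
  assumes [measurable]: "f \<in> borel_measurable borel"
  shows "(\<integral>x. f x \<partial>std_normal_distribution) = (\<integral>x. std_normal_density x *\<^sub>R f x \<partial>lborel)"
  by (subst integral_density) (auto simp: normal_density_nonneg)

text \<open>Completing the square in (|x|/2 - a)^2 >= 0 spends half of the Gaussian exponent on the
  exponential; what is left is, up to a constant, the normal density of variance 2.\<close>

lemma exp_abs_std_normal_density_le:
  "std_normal_density x * exp (a * \<bar>x\<bar>) \<le> exp (a\<^sup>2) * exp (- x\<^sup>2 / 4)"
proof -
  have "a * \<bar>x\<bar> - x\<^sup>2 / 2 \<le> a\<^sup>2 - x\<^sup>2/4"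
    using zero_le_power2[of "\<bar>x\<bar>/2 - a"]
    by (simp add: power2_diff power_divide mult.commute[of a]; linarith)
  then have *: "exp (- x\<^sup>2 / 2) * exp (a * \<bar>x\<bar>) \<le> exp (a\<^sup>2) * exp (- x\<^sup>2 / 4)"
    unfolding exp_add[symmetric] by simp
  have "1 \<le> sqrt (2 * pi)" using pi_gt3 by simp
  then have "1 / sqrt (2 * pi) \<le> 1" by simp
  then have "1 / sqrt (2 * pi) * (exp (- x\<^sup>2 / 2) * exp (a * \<bar>x\<bar>)) \<le> 1 * (exp (- x\<^sup>2 / 2) * exp (a * \<bar>x\<bar>))"
    by (intro mult_right_mono) auto
  with * show ?thesis by (simp add: std_normal_density_def mult.assoc)
qed

lemma integrable_exp_abs_std_normal: "integrable std_normal_distribution (\<lambda>x. exp (a * \<bar>x\<bar>))"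
proof -
  have eq: "exp (- x\<^sup>2 / 4) = sqrt (4 * pi) * normal_density 0 (sqrt 2) x" for x
    by (simp add: normal_density_def)
  have "integrable lborel (\<lambda>x. exp (a\<^sup>2) * exp (- x\<^sup>2 / 4))"
    unfolding eq by simp
  then have "integrable lborel (\<lambda>x. std_normal_density x *\<^sub>R exp (a * \<bar>x\<bar>))"
    by (rule Bochner_Integration.integrable_bound)
       (use exp_abs_std_normal_density_le in \<open>auto intro!: AE_I2 simp: normal_density_nonneg abs_mult\<close>)
  then show ?thesis by (simp add: integrable_std_normal_iff)
qed

lemma integrable_std_normal_exp_bounded:
  fixes f :: "real \<Rightarrow> 'b::{banach, second_countable_topology}"
  assumes "f \<in> borel_measurable borel" "\<And>x. norm (f x) \<le> C * exp (a * \<bar>x\<bar>)"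
  shows "integrable std_normal_distribution f"
  by (rule Bochner_Integration.integrable_bound[of _ "\<lambda>x. C * exp (a * \<bar>x\<bar>)"])
     (use assms abs_ge_self order_trans in \<open>auto intro!: AE_I2 integrable_exp_abs_std_normal, blast\<close>)

lemma abs_le_exp_abs: "\<bar>x::real\<bar> \<le> exp \<bar>x\<bar>"
  using exp_ge_add_one_self[of "\<bar>x\<bar>"] by linarith

lemma std_normal_density_has_derivative:
  "(std_normal_density has_real_derivative - x * std_normal_density x) (at x)"
proof -
  have "std_normal_density = (\<lambda>x. (1 / sqrt (2 * pi)) * exp (- x\<^sup>2 / 2))"
    by (simp add: fun_eq_iff std_normal_density_def)
  moreover have "((\<lambda>x. (1 / sqrt (2 * pi)) * exp (- x\<^sup>2 / 2)) has_real_derivative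
      (1 / sqrt (2 * pi)) * (- x * exp (- x\<^sup>2 / 2))) (at x)"
    by (rule DERIV_cmult) (auto intro!: derivative_eq_intros)
  ultimately show ?thesis by (simp add: std_normal_density_def mult_ac)
qed

text \<open>The density times g' - x g is the derivative of the density times \<open>g\<close>,
  which vanishes at both infinities. Values lie in a Euclidean space so that complex exponentials
  are covered, and exponential growth is enough for polynomials and for the factors occurring in the
  characteristic function.\<close>

theorem std_normal_stein:
  fixes g :: "real \<Rightarrow> 'b::euclidean_space"
  assumes deriv: "\<And>x. (g has_vector_derivative g' x) (at x)"
    and cont: "continuous_on UNIV g'"
    and g: "\<And>x. norm (g x) \<le> C * exp (a * \<bar>x\<bar>)"
    and g': "\<And>x. norm (g' x) \<le> D * exp (b * \<bar>x\<bar>)"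
  shows "(\<integral>x. x *\<^sub>R g x \<partial>std_normal_distribution) = (\<integral>x. g' x \<partial>std_normal_distribution)"
    "integrable std_normal_distribution (\<lambda>x. x *\<^sub>R g x)" "integrable std_normal_distribution g'"
    "integrable std_normal_distribution g"
proof -
  have cg: "continuous_on UNIV g"
    using deriv continuous_at_imp_continuous_on has_vector_derivative_continuous by blast
  have [measurable]: "g \<in> borel_measurable borel" "g' \<in> borel_measurable borel"
    using cg cont by (auto intro: borel_measurable_continuous_onI)
  have C: "C \<ge> 0" using order_trans[OF norm_ge_zero g[of 0]] by simp
  show i2: "integrable std_normal_distribution g'" "integrable std_normal_distribution g"
    by (rule integrable_std_normal_exp_bounded[OF _ g'] integrable_std_normal_exp_bounded[OF _ g], simp)+
  show i1: "integrable std_normal_distribution (\<lambda>x. x *\<^sub>R g x)"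
  proof (rule integrable_std_normal_exp_bounded)
    show "norm (x *\<^sub>R g x) \<le> C * exp ((a + 1) * \<bar>x\<bar>)" for x
      using mult_mono[OF abs_le_exp_abs[of x] g[of x]] by (simp add: exp_add algebra_simps)
  qed simp
  define F where "F = (\<lambda>x. std_normal_density x *\<^sub>R g x)"
  define f where "f = (\<lambda>x. std_normal_density x *\<^sub>R (g' x - x *\<^sub>R g x))"
  have F: "(F has_vector_derivative f x) (at x)" for x
    unfolding F_def f_def
    by (rule has_vector_derivative_eq_rhs[OF has_vector_derivative_scaleR[OF std_normal_density_has_derivative deriv]])
       (simp add: algebra_simps)
  have bd: "norm (F x) \<le> C * exp (a\<^sup>2) * exp (- x\<^sup>2 / 4)" for x
  proof -
    have "norm (F x) \<le> std_normal_density x * (C * exp (a * \<bar>x\<bar>))"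
      unfolding F_def by (simp add: normal_density_nonneg g mult_left_mono)
    also have "\<dots> \<le> C * (exp (a\<^sup>2) * exp (- x\<^sup>2 / 4))"
      using mult_left_mono[OF exp_abs_std_normal_density_le[of x a] C] by (simp add: mult_ac)
    finally show ?thesis by simp
  qed
  have i3: "integrable std_normal_distribution (\<lambda>x. g' x - x *\<^sub>R g x)"
    using i1 i2 by simp
  have int: "integrable lborel f"
    using i3 unfolding f_def by (subst (asm) integrable_std_normal_iff) auto
  have "(LBINT x=-\<infinity>..\<infinity>. f x) = 0 - 0"
  proof (rule interval_integral_FTC_integrable[of _ _ F])
    show "isCont f x" for x
      using cg cont unfolding f_def std_normal_density_def
      by (auto intro!: continuous_intros simp: continuous_on_eq_continuous_at)
    show "set_integrable lborel (einterval (- \<infinity>) \<infinity>) f"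
      using int by (simp add: set_integrable_def einterval_def)
    have top: "((\<lambda>x::real. C * exp (a\<^sup>2) * exp (- x\<^sup>2 / 4)) \<longlongrightarrow> 0) at_top"
      and bot: "((\<lambda>x::real. C * exp (a\<^sup>2) * exp (- x\<^sup>2 / 4)) \<longlongrightarrow> 0) at_bot"
      by real_asymp+
    show "((F \<circ> real_of_ereal) \<longlongrightarrow> 0) (at_right (- \<infinity>))"
      unfolding ereal_tendsto_simps by (rule Lim_null_comparison[OF always_eventually bot]) (use bd in auto)
    show "((F \<circ> real_of_ereal) \<longlongrightarrow> 0) (at_left \<infinity>)"
      unfolding ereal_tendsto_simps by (rule Lim_null_comparison[OF always_eventually top]) (use bd in auto)
  qed (use F in auto)
  then have "integral\<^sup>L lborel f = 0"
    by (simp add: interval_lebesgue_integral_def einterval_def set_lebesgue_integral_def)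
  then have "(\<integral>x. g' x - x *\<^sub>R g x \<partial>std_normal_distribution) = 0"
    unfolding f_def by (subst integral_std_normal) auto
  then show "(\<integral>x. x *\<^sub>R g x \<partial>std_normal_distribution) = (\<integral>x. g' x \<partial>std_normal_distribution)"
    using i1 i2 by simp
qed

section \<open>Polynomials under the normal law and the Hermite basis\<close>

lemma poly_exp_bound: "\<exists>C a. \<forall>x::real. \<bar>poly p x\<bar> \<le> C * exp (a * \<bar>x\<bar>)"
proof (induction p)
  case 0
  show ?case by (rule exI[of _ 0]) simp
next
  case (pCons b p)
  then obtain C a where C: "\<And>x. \<bar>poly p x\<bar> \<le> C * exp (a * \<bar>x\<bar>)" by auto
  have "\<bar>poly (pCons b p) x\<bar> \<le> (\<bar>b\<bar> + C) * exp ((\<bar>a\<bar> + 1) * \<bar>x\<bar>)" for x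
  proof -
    have "C \<ge> 0" using C[of 0] by simp
    have "\<bar>x\<bar> * \<bar>poly p x\<bar> \<le> exp \<bar>x\<bar> * (C * exp (a * \<bar>x\<bar>))"
      by (intro mult_mono C abs_le_exp_abs) auto
    also have "\<dots> \<le> exp \<bar>x\<bar> * (C * exp (\<bar>a\<bar> * \<bar>x\<bar>))"
      using \<open>C \<ge> 0\<close> by (intro mult_left_mono) (auto intro: mult_right_mono)
    also have "\<dots> = C * exp ((\<bar>a\<bar> + 1) * \<bar>x\<bar>)" by (simp add: exp_add algebra_simps)
    finally have 1: "\<bar>x\<bar> * \<bar>poly p x\<bar> \<le> C * exp ((\<bar>a\<bar> + 1) * \<bar>x\<bar>)" .
    have 2: "\<bar>b\<bar> * 1 \<le> \<bar>b\<bar> * exp ((\<bar>a\<bar> + 1) * \<bar>x\<bar>)" by (intro mult_left_mono) auto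
    have "\<bar>poly (pCons b p) x\<bar> \<le> \<bar>b\<bar> + \<bar>x\<bar> * \<bar>poly p x\<bar>"
      using abs_triangle_ineq[of b "x * poly p x"] by (simp add: abs_mult)
    with 1 2 show ?thesis by (simp add: algebra_simps)
  qed
  then show ?case by blast
qed

lemma borel_measurable_poly [measurable]: "poly (p :: real poly) \<in> borel_measurable borel"
  by (intro borel_measurable_continuous_onI continuous_intros)

lemma integrable_std_normal_poly: "integrable std_normal_distribution (\<lambda>x. poly p x)"
  using poly_exp_bound[of p] by (auto intro!: integrable_std_normal_exp_bounded)

lemma L2_std_normal_poly: "(\<lambda>x. poly p x) \<in> L2_space std_normal_distribution"
  using integrable_std_normal_poly[of "p * p"] by (auto simp: L2_space_def power2_eq_square)

lemma std_normal_stein_poly: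
  "(\<integral>x. poly ([:0, 1:] * p) x \<partial>std_normal_distribution) = (\<integral>x. poly (pderiv p) x \<partial>std_normal_distribution)"
proof -
  obtain C a where C: "\<And>x. \<bar>poly p x\<bar> \<le> C * exp (a * \<bar>x\<bar>)" using poly_exp_bound by blast
  obtain D b where D: "\<And>x. \<bar>poly (pderiv p) x\<bar> \<le> D * exp (b * \<bar>x\<bar>)" using poly_exp_bound by blast
  have "(\<integral>x. x *\<^sub>R poly p x \<partial>std_normal_distribution) = (\<integral>x. poly (pderiv p) x \<partial>std_normal_distribution)"
  proof (rule std_normal_stein(1))
    show "(poly p has_vector_derivative poly (pderiv p) x) (at x)" for x
      by (simp add: has_real_derivative_iff_has_vector_derivative[symmetric] poly_DERIV)
    show "norm (poly p x) \<le> C * exp (a * \<bar>x\<bar>)" for x using C[of x] by simp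
    show "norm (poly (pderiv p) x) \<le> D * exp (b * \<bar>x\<bar>)" for x using D[of x] by simp
  qed (auto intro: continuous_intros)
  then show ?thesis by simp
qed

text \<open>The probabilists' Hermite polynomials, generated by x - d/dx. This operator is the
  adjoint of d/dx in L2 of the standard normal law, which makes orthogonality an induction.\<close>

primrec hermite :: "nat \<Rightarrow> real poly" where
  "hermite 0 = 1"
| "hermite (Suc k) = [:0, 1:] * hermite k - pderiv (hermite k)"

lemma pderiv_hermite_Suc: "pderiv (hermite (Suc k)) = smult (of_nat (Suc k)) (hermite k)"
proof (induction k)
  case 0
  show ?case by (simp add: pderiv_pCons pderiv_diff)
next
  case (Suc k)
  have "pderiv (hermite (Suc (Suc k))) = hermite (Suc k) + [:0,1:] * pderiv (hermite (Suc k)) - pderiv (pderiv (hermite (Suc k)))"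
    by (simp only: hermite.simps(2)[of "Suc k"] pderiv_diff pderiv_mult) (simp add: pderiv_pCons)
  also have "\<dots> = hermite (Suc k) + smult (of_nat (Suc k)) (hermite (Suc k))"
    unfolding Suc.IH pderiv_smult mult_smult_right add_diff_eq[symmetric] smult_diff_right[symmetric]
    by (simp only: hermite.simps(2))
  also have "\<dots> = smult (of_nat (Suc (Suc k))) (hermite (Suc k))"
    by (simp only: of_nat_Suc[of "Suc k"] smult_add_left smult_1_left)
  finally show ?case .
qed

lemma pderiv_hermite: "pderiv (hermite k) = smult (of_nat k) (hermite (k - 1))"
  by (cases k) (simp_all only: pderiv_hermite_Suc diff_Suc_1, simp_all)

text \<open>Adjointness of the raising operator and differentiation: Stein's identity for the
  product \<open>hermite k * p\<close>, with the product rule separating the two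
  derivatives.\<close>

lemma hermite_stein:
  "(\<integral>x. poly (hermite (Suc k)) x * poly p x \<partial>std_normal_distribution)
   = (\<integral>x. poly (hermite k) x * poly (pderiv p) x \<partial>std_normal_distribution)"
proof -
  have eq: "poly (hermite (Suc k)) x * poly p x
     = poly ([:0,1:] * (hermite k * p)) x - poly (pderiv (hermite k * p)) x + poly (hermite k * pderiv p) x" for x
    by (simp add: pderiv_mult algebra_simps)
  show ?thesis unfolding eq
    by (simp add: integrable_std_normal_poly std_normal_stein_poly del: poly_mult mult_pCons_left)
       (simp flip: poly_mult)
qed

text \<open>Each use of adjointness lowers both indices by one and produces the factor
  \<open>l\<close>. When one index reaches 0 first, differentiating the constant 1 gives
  zero.\<close>

lemma hermite_orthogonal:
  "(\<integral>x. poly (hermite k) x * poly (hermite l) x \<partial>std_normal_distribution) = (if k = l then fact k else 0)"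
proof (induction k arbitrary: l)
  case 0
  interpret prob_space std_normal_distribution by (rule prob_space_std_normal)
  show ?case
  proof (cases l)
    case 0 then show ?thesis using prob_space by simp
  next
    case (Suc m) then show ?thesis using hermite_stein[of m 1] by simp
  qed
next
  case (Suc k)
  have "(\<integral>x. poly (hermite (Suc k)) x * poly (hermite l) x \<partial>std_normal_distribution)
    = l * (\<integral>x. poly (hermite k) x * poly (hermite (l - 1)) x \<partial>std_normal_distribution)"
    unfolding hermite_stein pderiv_hermite[of l]
    by (simp add: mult.left_commute[of _ "real l"])
  also have "\<dots> = (if Suc k = l then fact (Suc k) else 0)"
    unfolding Suc.IH by (cases l) auto
  finally show ?case .
qed

text \<open>Multiplication by x preserves the span, because x He_k = He_(k+1) + k He_(k-1).\<close>

lemma poly_hermite_expansion: "\<exists>c N. p = (\<Sum>k<N. smult (c k) (hermite k))"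
proof (induction p)
  case 0
  have "0 = (\<Sum>k<(0::nat). smult (0::real) (hermite k))" by simp
  then show ?case by (intro exI[of _ "\<lambda>_. 0"] exI[of _ "0::nat"])
next
  case (pCons b p)
  then obtain c N where p: "p = (\<Sum>k<N. smult (c k) (hermite k))" by auto
  have x: "[:0,1:] * hermite k = hermite (Suc k) + smult (of_nat k) (hermite (k - 1))" for k
    by (simp add: pderiv_hermite)
  \<comment> \<open>The coefficient of He_k in b + x p: c (k - 1) comes up from below, (k + 1) c (k
    + 1) comes down from above, and b takes the free slot at k = 0. The range grows by one.\<close>
  define d where "d = (\<lambda>k. (if k = 0 then b else c (k - 1)) + (if k + 1 < N then of_nat (k + 1) * c (k + 1) else 0))"
  have "pCons b p = [:b:] + [:0,1:] * p" by simp
  also have "[:0,1:] * p = (\<Sum>k<N. smult (c k) (hermite (Suc k))) + (\<Sum>k<N. smult (c k * of_nat k) (hermite (k - 1)))"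
    unfolding p sum_distrib_left mult_smult_right x smult_add_right by (simp add: sum.distrib)
  also have "(\<Sum>k<N. smult (c k) (hermite (Suc k))) = (\<Sum>k<Suc N. smult (if k = 0 then 0 else c (k - 1)) (hermite k))"
    by (subst sum.lessThan_Suc_shift) simp
  also have "(\<Sum>k<N. smult (c k * of_nat k) (hermite (k - 1)))
     = (\<Sum>k<Suc N. smult (if k + 1 < N then of_nat (k + 1) * c (k + 1) else 0) (hermite k))"
  proof (cases N)
    case (Suc m)
    show ?thesis unfolding Suc by (subst sum.lessThan_Suc_shift) (simp add: mult.commute)
  qed simp
  also have "[:b:] = (\<Sum>k<Suc N. smult (if k = 0 then b else 0) (hermite k))"
    by (subst sum.lessThan_Suc_shift) simp
  finally have "pCons b p = (\<Sum>k<Suc N. smult (d k) (hermite k))"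
    unfolding sum.distrib[symmetric] smult_add_left[symmetric]
    by (simp add: d_def del: sum.lessThan_Suc cong: if_cong) (intro sum.cong, auto)
  then show ?case by blast
qed


section \<open>Density of polynomials in one variable\<close>

interpretation std_poly: L2_subspace std_normal_distribution "range (poly :: real poly \<Rightarrow> _)"
proof -
  interpret prob_space std_normal_distribution by (rule prob_space_std_normal)
  show "L2_subspace std_normal_distribution (range (poly :: real poly \<Rightarrow> _))"
  proof
    show "range (poly :: real poly \<Rightarrow> _) \<subseteq> L2_space std_normal_distribution"
      using L2_std_normal_poly by auto
    show "(\<lambda>x. u x + v x) \<in> range poly" if "u \<in> range poly" "v \<in> range poly" for u v :: "real \<Rightarrow> real"
    proof -
      obtain p q where "u = poly p" "v = poly q" using \<open>u \<in> range poly\<close> \<open>v \<in> range poly\<close> by auto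
      then have "(\<lambda>x. u x + v x) = poly (p + q)" by auto
      then show ?thesis by blast
    qed
    show "(\<lambda>x. c * u x) \<in> range poly" if "u \<in> range poly" for c and u :: "real \<Rightarrow> real"
    proof -
      obtain p where "u = poly p" using \<open>u \<in> range poly\<close> by auto
      then have "(\<lambda>x. c * u x) = poly (smult c p)" by auto
      then show ?thesis by blast
    qed
  qed
qed

definition sin_poly :: "real \<Rightarrow> nat \<Rightarrow> real poly" where
  "sin_poly c N = (\<Sum>k<N. monom (sin_coeff k * c ^ k) k)"

lemma poly_sin_poly: "poly (sin_poly c N) x = (\<Sum>k<N. sin_coeff k * (c * x) ^ k)"
  by (simp add: sin_poly_def poly_sum poly_monom power_mult_distrib mult.assoc)

text \<open>Termwise comparison with the exponential series. The bound is uniform in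
  \<open>N\<close>, hence a square integrable majorant for all Taylor polynomials together.\<close>

lemma abs_sin_poly_le: "\<bar>poly (sin_poly c N) x\<bar> \<le> exp (\<bar>c\<bar> * \<bar>x\<bar>)"
proof -
  have "\<bar>poly (sin_poly c N) x\<bar> \<le> (\<Sum>k<N. \<bar>sin_coeff k * (c * x) ^ k\<bar>)"
    unfolding poly_sin_poly by (rule sum_abs)
  also have "\<dots> \<le> (\<Sum>k<N. (\<bar>c\<bar> * \<bar>x\<bar>) ^ k /\<^sub>R fact k)"
  proof (rule sum_mono)
    fix k
    have "\<bar>sin_coeff k\<bar> \<le> inverse (fact k)"
      by (auto simp: sin_coeff_def abs_mult power_abs divide_simps)
    then show "\<bar>sin_coeff k * (c * x) ^ k\<bar> \<le> (\<bar>c\<bar> * \<bar>x\<bar>) ^ k /\<^sub>R fact k"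
      by (simp add: abs_mult power_abs power_mult_distrib mult_right_mono)
  qed
  also have "\<dots> \<le> exp (\<bar>c\<bar> * \<bar>x\<bar>)"
    unfolding exp_def by (rule sum_le_suminf[OF summable_exp_generic]) auto
  finally show ?thesis .
qed

lemma L2_exp_abs_std_normal: "(\<lambda>x. C * exp (a * \<bar>x\<bar>)) \<in> L2_space std_normal_distribution"
proof (rule L2_scale)
  have "(\<lambda>x::real. (exp (a * \<bar>x\<bar>))\<^sup>2) = (\<lambda>x. exp ((2 * a) * \<bar>x\<bar>))"
    by (simp add: power2_eq_square exp_add[symmetric] mult.assoc)
  then show "(\<lambda>x. exp (a * \<bar>x\<bar>)) \<in> L2_space std_normal_distribution"
    using integrable_exp_abs_std_normal[of "2 * a"] by (simp add: L2_space_def)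
qed

text \<open>For a polynomial \<open>v\<close>, Taylor polynomials of sin times \<open>v\<close> are
  polynomials with a common exponential majorant. Multiplication by sin does not increase the L2
  norm, so the property passes to the closure.\<close>

lemma sin_mult_closure:
  assumes u: "u \<in> std_poly.L2_closure"
  shows "(\<lambda>x. sin (c * x) * u x) \<in> std_poly.L2_closure"
proof (rule std_poly.closure_closed)
  have [measurable]: "u \<in> borel_measurable borel" using std_poly.closure_L2[OF u] by (auto simp: L2_space_def)
  have le: "\<bar>sin (c * x) * a\<bar> \<le> \<bar>a\<bar>" for x a :: real
    by (simp add: abs_mult mult_left_le_one_le)
  show "(\<lambda>x. sin (c * x) * u x) \<in> L2_space std_normal_distribution"
    by (rule L2_dominated[OF std_poly.closure_L2[OF u]]) (use le in auto)
  fix e :: real assume "e > 0"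
  then obtain v where v: "v \<in> range poly" "(\<integral>x. (u x - v x)\<^sup>2 \<partial>std_normal_distribution) < e"
    using std_poly.closure_approx[OF u] by blast
  then obtain p where p: "v = poly p" by auto
  obtain C a where C: "\<And>x. \<bar>poly p x\<bar> \<le> C * exp (a * \<bar>x\<bar>)" using poly_exp_bound by blast
  have "(\<lambda>x. sin (c * x) * v x) \<in> std_poly.L2_closure"
  proof (rule std_poly.closure_dominated[where us = "\<lambda>N. poly (sin_poly c N * p)"])
    show "poly (sin_poly c N * p) \<in> std_poly.L2_closure" for N
      by (rule std_poly.closure_superset) auto
    show "\<bar>poly (sin_poly c N * p) x\<bar> \<le> C * exp ((\<bar>c\<bar> + a) * \<bar>x\<bar>)" for N x
      using mult_mono[OF abs_sin_poly_le[of c N x] C[of x]] by (simp add: abs_mult exp_add algebra_simps)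
    show "(\<lambda>N. poly (sin_poly c N * p) x) \<longlonglongrightarrow> sin (c * x) * v x" for x
    proof -
      have "(\<lambda>N. poly (sin_poly c N) x) \<longlonglongrightarrow> sin (c * x)"
        unfolding poly_sin_poly using sin_converges[of "c * x"] by (simp add: sums_def)
      then show ?thesis unfolding p poly_mult by (intro tendsto_intros)
    qed
  qed (rule L2_exp_abs_std_normal)
  moreover have "(\<integral>x. (sin (c * x) * u x - sin (c * x) * v x)\<^sup>2 \<partial>std_normal_distribution)
      \<le> (\<integral>x. (u x - v x)\<^sup>2 \<partial>std_normal_distribution)"
  proof (rule integral_mono)
    have L: "(\<lambda>x. u x - v x) \<in> L2_space std_normal_distribution"
      using std_poly.closure_L2[OF u] std_poly.V_L2D[OF v(1)] by (rule L2_diff)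
    then show i: "integrable std_normal_distribution (\<lambda>x. (u x - v x)\<^sup>2)" by (rule L2_square_integrable)
    have "(\<lambda>x. sin (c * x) * (u x - v x)) \<in> L2_space std_normal_distribution"
      by (rule L2_dominated[OF L]) (use le p in auto)
    from L2_square_integrable[OF this]
    show "integrable std_normal_distribution (\<lambda>x. (sin (c * x) * u x - sin (c * x) * v x)\<^sup>2)"
      by (simp add: right_diff_distrib)
    show "(sin (c * x) * u x - sin (c * x) * v x)\<^sup>2 \<le> (u x - v x)\<^sup>2" for x
      using le[of x "u x - v x"] by (simp add: abs_le_square_iff[symmetric] right_diff_distrib)
  qed
  ultimately show "\<exists>w\<in>std_poly.L2_closure. (\<integral>x. (sin (c * x) * u x - w x)\<^sup>2 \<partial>std_normal_distribution) < e"
    using v(2) by (intro bexI[of _ "\<lambda>x. sin (c * x) * v x"]) auto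
qed

text \<open>Horner's scheme in s = sin (c x): each step is one multiplication by sin and one
  addition of a constant.\<close>

lemma poly_sin_closure: "(\<lambda>x. poly p (sin (c * x))) \<in> std_poly.L2_closure"
proof (induction p)
  case 0
  have "(\<lambda>x. poly 0 x) \<in> std_poly.L2_closure" by (rule std_poly.closure_superset) blast
  then show ?case unfolding poly_0 .
next
  case (pCons a p)
  have "poly [:a:] \<in> std_poly.L2_closure" by (rule std_poly.closure_superset) blast
  from std_poly.closure_add[OF this sin_mult_closure[OF pCons(2)]] show ?case by simp
qed

text \<open>Composing with \<open>arcsin\<close> turns polynomial approximation on \<open>[-1, 1]\<close> into approximation by polynomials
  in \<open>sin (c * x)\<close>, which stay bounded on the whole line.\<close>

lemma bounded_continuous_closure:
  fixes g :: "real \<Rightarrow> real"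
  assumes g: "continuous_on UNIV g" and B: "\<And>x. \<bar>g x\<bar> \<le> B"
  shows "g \<in> std_poly.L2_closure"
proof -
  \<comment> \<open>With this frequency x \<mapsto> c m x maps [-(m + 1), m + 1] onto [-pi/2, pi/2],
    where arcsin inverts sin; the interval exhausts the line as m grows.\<close>
  define c where "c = (\<lambda>m::nat. pi / (2 * real (Suc m)))"
  have "\<exists>q. \<forall>s\<in>{-1..1}. \<bar>g (arcsin s / c m) - poly q s\<bar> < 1 / real (Suc m)" for m
  proof -
    have "continuous_on {-1..1} (\<lambda>s. g (arcsin s / c m))"
      by (rule continuous_on_compose2[OF g])
         (auto intro!: continuous_intros simp: c_def)
    then obtain h where h: "real_polynomial_function h" "\<And>s. s \<in> {-1..1} \<Longrightarrow> \<bar>g (arcsin s / c m) - h s\<bar> < 1 / real (Suc m)"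
      using Stone_Weierstrass_real_polynomial_function[of "{-1..1::real}" "\<lambda>s. g (arcsin s / c m)" "1 / real (Suc m)"]
      by auto
    obtain a n where "h = (\<lambda>x. \<Sum>i\<le>n. a i * x ^ i)"
      using h(1) by (auto simp: real_polynomial_function_iff_sum)
    then have "h = poly (\<Sum>i\<le>n. monom (a i) i)" by (auto simp: poly_sum poly_monom)
    then show ?thesis using h(2) by blast
  qed
  then obtain q where q: "\<And>m s. s \<in> {-1..1} \<Longrightarrow> \<bar>g (arcsin s / c m) - poly (q m) s\<bar> < 1 / real (Suc m)"
    by metis
  show ?thesis
  proof (rule std_poly.closure_dominated[where us = "\<lambda>m x. poly (q m) (sin (c m * x))"])
    show "(\<lambda>x. poly (q m) (sin (c m * x))) \<in> std_poly.L2_closure" for m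
      by (rule poly_sin_closure)
    show "(\<lambda>_. B + 1) \<in> L2_space std_normal_distribution" by (rule std_poly.L2_const)
    \<comment> \<open>Valid also where arcsin does not invert sin: the approximated value is still a
      value of \<open>g\<close>, hence at most B, and the error is at most 1.\<close>
    show "\<bar>poly (q m) (sin (c m * x))\<bar> \<le> B + 1" for m x
    proof -
      have "1 / real (Suc m) \<le> 1" by simp
      then show ?thesis
        using q[of "sin (c m * x)" m] B[of "arcsin (sin (c m * x)) / c m"]
        unfolding atLeastAtMost_iff by (smt (verit) sin_ge_minus_one sin_le_one)
    qed
    show "(\<lambda>m. poly (q m) (sin (c m * x))) \<longlonglongrightarrow> g x" for x
    proof (rule LIM_zero_cancel, rule Lim_null_comparison)
      show "(\<lambda>m. 1 / real (Suc m)) \<longlonglongrightarrow> 0" by (rule lim_1_over_n[THEN LIMSEQ_Suc])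
      show "\<forall>\<^sub>F m in sequentially. norm (poly (q m) (sin (c m * x)) - g x) \<le> 1 / real (Suc m)"
      proof (rule eventually_sequentiallyI[of "nat \<lceil>\<bar>x\<bar>\<rceil>"])
        fix m assume "nat \<lceil>\<bar>x\<bar>\<rceil> \<le> m"
        then have x: "\<bar>x\<bar> \<le> real (Suc m)" by linarith
        have "\<bar>c m * x\<bar> \<le> c m * real (Suc m)"
          using x unfolding abs_mult by (intro mult_mono) (auto simp: c_def)
        also have "\<dots> = pi / 2" by (simp add: c_def field_simps)
        finally have "arcsin (sin (c m * x)) = c m * x" by (intro arcsin_sin) auto
        then have "arcsin (sin (c m * x)) / c m = x" by (simp add: c_def)
        then show "norm (poly (q m) (sin (c m * x)) - g x) \<le> 1 / real (Suc m)"
          using q[of "sin (c m * x)" m] by (simp add: abs_minus_commute)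
      qed
    qed
  qed
qed

text \<open>The indicator is the limit of continuous ramps that fall from 1 at \<open>a\<close> to 0
  at a + 1/m.\<close>

lemma atMost_indicator_closure: "indicat_real {..a} \<in> std_poly.L2_closure"
proof (rule std_poly.closure_dominated[where us = "\<lambda>m x. max 0 (min 1 (1 - real m * (x - a)))" and w = "\<lambda>_. 1"])
  show "(\<lambda>x. max 0 (min 1 (1 - real m * (x - a)))) \<in> std_poly.L2_closure" for m
    by (rule bounded_continuous_closure[of _ 1]) (auto intro!: continuous_intros)
  show "(\<lambda>m. max 0 (min 1 (1 - real m * (x - a)))) \<longlonglongrightarrow> indicat_real {..a} x" for x
  proof (cases "x \<le> a")
    case True
    then have "max 0 (min 1 (1 - real m * (x - a))) = 1" for m
      by (simp add: mult_nonneg_nonpos min_absorb1)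
    then show ?thesis using True by simp
  next
    case False
    obtain N where N: "1 / (x - a) < real N" using reals_Archimedean2 by blast
    have "max 0 (min 1 (1 - real m * (x - a))) = 0" if "m \<ge> N" for m
    proof -
      have "1 < real N * (x - a)" using N False by (simp add: field_simps)
      also have "\<dots> \<le> real m * (x - a)" using that False by (intro mult_right_mono) auto
      finally show ?thesis by simp
    qed
    then have "\<forall>\<^sub>F m in sequentially. max 0 (min 1 (1 - real m * (x - a))) = indicat_real {..a} x"
      using False by (intro eventually_sequentiallyI[of N]) auto
    then show ?thesis by (rule tendsto_eventually)
  qed
qed (auto intro: std_poly.L2_const)

text \<open>Half-lines form an intersection-stable generator of the Borel sets, so their indicators
  suffice.\<close>

theorem polynomials_dense_L2_std_normal:
  assumes "u \<in> L2_space std_normal_distribution" "e > 0"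
  obtains p where "(\<integral>x. (u x - poly p x)\<^sup>2 \<partial>std_normal_distribution) < e"
proof -
  have ind: "indicat_real A \<in> std_poly.L2_closure" if "A \<in> sets std_normal_distribution" for A
  proof (rule std_poly.closure_indicator[OF _ _ _ _ _ that])
    show "Int_stable (range (\<lambda>a::real. {..a}))"
      by (auto simp: Int_stable_def) 
    show "sets std_normal_distribution = sigma_sets (space std_normal_distribution) (range (\<lambda>a::real. {..a}))"
      by (simp add: borel_eq_atMost)
    show "(\<lambda>x. 1) \<in> std_poly.L2_closure" by (rule bounded_continuous_closure[of _ 1]) auto
  qed (auto intro: atMost_indicator_closure)
  have "u \<in> std_poly.L2_closure" by (rule std_poly.closure_eq_L2[OF ind assms(1)])
  then obtain v where "v \<in> range poly" "(\<integral>x. (u x - v x)\<^sup>2 \<partial>std_normal_distribution) < e"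
    by (rule std_poly.closure_approx[OF _ assms(2)])
  then show ?thesis by (auto intro: that)
qed

section \<open>Hermite expansions in Gaussian space\<close>


abbreviation gauss :: "nat \<Rightarrow> rvec measure" where
  "gauss n \<equiv> (\<Pi>\<^sub>M i\<in>{..<n}. std_normal_distribution)"

interpretation std_normal: prob_space std_normal_distribution
  by (rule prob_space_std_normal)

interpretation std_normals: product_sigma_finite "\<lambda>_::nat. std_normal_distribution"
  by standard

interpretation gauss: prob_space "gauss n" for n
  by (rule prob_space_PiM) (rule prob_space_std_normal)

lemma measurable_gauss_component [measurable]: "i < n \<Longrightarrow> (\<lambda>x. x i) \<in> gauss n \<rightarrow>\<^sub>M borel"
  using measurable_component_singleton[of i "{..<n}" "\<lambda>_. std_normal_distribution"] by simp

lemma L2_gauss_prod: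
  assumes "\<And>i. i < n \<Longrightarrow> f i \<in> L2_space std_normal_distribution"
  shows "(\<lambda>x. \<Prod>i<n. f i (x i)) \<in> L2_space (gauss n)"
proof -
  have [measurable]: "i < n \<Longrightarrow> f i \<in> borel_measurable borel" for i
    using L2_measurable[OF assms] by simp
  have "(\<lambda>x. \<Prod>i<n. f i (x i)) \<in> borel_measurable (gauss n)"
    by (rule borel_measurable_prod) auto
  moreover have "integrable (gauss n) (\<lambda>x. \<Prod>i<n. (f i (x i))\<^sup>2)"
    by (rule std_normals.product_integrable_prod) (use assms in \<open>auto simp: L2_square_integrable\<close>)
  ultimately show ?thesis by (simp add: L2_space_def prod_power_distrib)
qed

lemma gauss_integral_prod_mult:
  assumes "\<And>i. i < n \<Longrightarrow> f i \<in> L2_space std_normal_distribution"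
    and "\<And>i. i < n \<Longrightarrow> g i \<in> L2_space std_normal_distribution"
  shows "(\<integral>x. (\<Prod>i<n. f i (x i)) * (\<Prod>i<n. g i (x i)) \<partial>gauss n)
    = (\<Prod>i<n. \<integral>t. f i t * g i t \<partial>std_normal_distribution)"
  unfolding prod.distrib[symmetric]
  by (rule std_normals.product_integral_prod) (use assms in \<open>auto intro: L2_mult_integrable\<close>)

section \<open>Products of Hermite polynomials, indexed by multi-indices\<close>

abbreviation idx :: "nat \<Rightarrow> (nat \<Rightarrow> nat) set" where
  "idx n \<equiv> {..<n} \<rightarrow>\<^sub>E UNIV"

definition hermite_prod :: "nat \<Rightarrow> (nat \<Rightarrow> nat) \<Rightarrow> rvec \<Rightarrow> real" where
  "hermite_prod n \<alpha> x = (\<Prod>i<n. poly (hermite (\<alpha> i)) (x i))"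

text \<open>The multi-index factorial \<alpha>!, which is the squared norm of
  \<open>hermite_prod n \<alpha>\<close>. The products stay unnormalized, so index shifts carry
  integer factors only.\<close>

definition idx_fact :: "nat \<Rightarrow> (nat \<Rightarrow> nat) \<Rightarrow> real" where
  "idx_fact n \<alpha> = (\<Prod>i<n. fact (\<alpha> i))"

lemma idx_fact_pos: "idx_fact n \<alpha> > 0"
  by (simp add: idx_fact_def prod_pos)

lemma idx_upd: "i < n \<Longrightarrow> \<alpha> \<in> idx n \<Longrightarrow> \<alpha>(i := k) \<in> idx n"
  by (auto simp: PiE_iff extensional_def)

lemma idx_fact_upd: "i < n \<Longrightarrow> idx_fact n (\<alpha>(i := Suc (\<alpha> i))) = Suc (\<alpha> i) * idx_fact n \<alpha>"
  unfolding idx_fact_def by (subst (1 2) prod.remove[of _ i]) (auto simp: algebra_simps)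

lemma L2_hermite_prod: "hermite_prod n \<alpha> \<in> L2_space (gauss n)"
  using L2_gauss_prod[of n "\<lambda>i. poly (hermite (\<alpha> i))"] L2_std_normal_poly
  by (simp add: hermite_prod_def[abs_def])

text \<open>Multi-indices are extensional, so two different ones disagree at a coordinate below
  \<open>n\<close>, and the factor of that coordinate vanishes.\<close>

lemma hermite_prod_orthogonal:
  assumes "\<alpha> \<in> idx n" "\<beta> \<in> idx n"
  shows "(\<integral>x. hermite_prod n \<alpha> x * hermite_prod n \<beta> x \<partial>gauss n) = (if \<alpha> = \<beta> then idx_fact n \<alpha> else 0)"
proof -
  have "(\<integral>x. hermite_prod n \<alpha> x * hermite_prod n \<beta> x \<partial>gauss n) = (\<Prod>i<n. if \<alpha> i = \<beta> i then fact (\<alpha> i) else 0)"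
    unfolding hermite_prod_def
    by (subst gauss_integral_prod_mult) (auto simp: L2_std_normal_poly hermite_orthogonal)
  also have "\<dots> = (if \<alpha> = \<beta> then idx_fact n \<alpha> else 0)"
  proof (cases "\<alpha> = \<beta>")
    case False
    then obtain i where "i < n" "\<alpha> i \<noteq> \<beta> i" using assms by (metis PiE_ext lessThan_iff)
    then show ?thesis using False by (auto intro!: prod_zero)
  qed (simp add: idx_fact_def)
  finally show ?thesis .
qed

text \<open>Adjointness of raising and differentiating in coordinate \<open>j\<close>, read off from
  orthogonality. If \<alpha> j = 0 the truncated index on the right is harmless because the factor
  in front is zero.\<close>

lemma hermite_prod_lower:
  assumes "\<alpha> \<in> idx n" "\<beta> \<in> idx n" "j < n"
  shows "(\<integral>x. hermite_prod n (\<beta>(j := Suc (\<beta> j))) x * hermite_prod n \<alpha> x \<partial>gauss n)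
    = \<alpha> j * (\<integral>x. hermite_prod n \<beta> x * hermite_prod n (\<alpha>(j := \<alpha> j - 1)) x \<partial>gauss n)"
proof (cases "\<alpha> j")
  case 0
  then have "\<beta>(j := Suc (\<beta> j)) \<noteq> \<alpha>" by (metis fun_upd_same nat.distinct(1))
  then show ?thesis using 0 assms by (simp add: hermite_prod_orthogonal idx_upd)
next
  case (Suc k)
  have "\<beta>(j := Suc (\<beta> j)) = \<alpha> \<longleftrightarrow> \<beta> = \<alpha>(j := k)"
    using Suc by (auto simp: fun_eq_iff)
  moreover have "idx_fact n (\<beta>(j := Suc (\<beta> j))) = \<alpha> j * idx_fact n \<beta>" if "\<beta> = \<alpha>(j := k)"
    using idx_fact_upd[OF assms(3), of \<beta>] Suc that by simp
  ultimately show ?thesis using assms Suc by (simp add: hermite_prod_orthogonal idx_upd)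
qed

definition hermite_comb :: "nat \<Rightarrow> (nat \<Rightarrow> nat) set \<Rightarrow> ((nat \<Rightarrow> nat) \<Rightarrow> real) \<Rightarrow> rvec \<Rightarrow> real" where
  "hermite_comb n B c x = (\<Sum>\<alpha>\<in>B. c \<alpha> * hermite_prod n \<alpha> x)"

definition hermite_span :: "nat \<Rightarrow> (rvec \<Rightarrow> real) set" where
  "hermite_span n = {hermite_comb n B c | B c. finite B \<and> B \<subseteq> idx n}"

lemma hermite_spanE:
  assumes "u \<in> hermite_span n"
  obtains B c where "finite B" "B \<subseteq> idx n" "u = hermite_comb n B c"
  using assms by (auto simp: hermite_span_def)

lemma L2_hermite_comb: "hermite_comb n B c \<in> L2_space (gauss n)"
  unfolding hermite_comb_def[abs_def] by (intro L2_sum L2_scale L2_hermite_prod)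

text \<open>Padding with zero coefficients puts two combinations on a common index set, where they
  can be added.\<close>

lemma hermite_comb_mono:
  assumes "B \<subseteq> B'" "finite B'"
  shows "hermite_comb n B c = hermite_comb n B' (\<lambda>\<alpha>. if \<alpha> \<in> B then c \<alpha> else 0)"
proof
  fix x
  have "hermite_comb n B' (\<lambda>\<alpha>. if \<alpha> \<in> B then c \<alpha> else 0) x
      = (\<Sum>\<alpha>\<in>B'. if \<alpha> \<in> B then c \<alpha> * hermite_prod n \<alpha> x else 0)"
    unfolding hermite_comb_def by (rule sum.cong) auto
  also have "\<dots> = hermite_comb n B c x"
    unfolding hermite_comb_def using assms by (simp add: sum.inter_restrict[symmetric] inf_absorb2)
  finally show "hermite_comb n B c x = hermite_comb n B' (\<lambda>\<alpha>. if \<alpha> \<in> B then c \<alpha> else 0) x" ..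
qed

interpretation hermite_span: L2_subspace "gauss n" "hermite_span n" for n
proof
  show "hermite_span n \<subseteq> L2_space (gauss n)"
    by (auto simp: hermite_span_def L2_hermite_comb)
  show "(\<lambda>x. u x + v x) \<in> hermite_span n" if "u \<in> hermite_span n" "v \<in> hermite_span n" for u v
  proof -
    obtain B c where B: "finite B" "B \<subseteq> idx n" and u: "u = hermite_comb n B c"
      by (rule hermite_spanE[OF \<open>u \<in> hermite_span n\<close>])
    obtain B' c' where B': "finite B'" "B' \<subseteq> idx n" and v: "v = hermite_comb n B' c'"
      by (rule hermite_spanE[OF \<open>v \<in> hermite_span n\<close>])
    have "(\<lambda>x. u x + v x) = hermite_comb n (B \<union> B')
        (\<lambda>\<alpha>. (if \<alpha> \<in> B then c \<alpha> else 0) + (if \<alpha> \<in> B' then c' \<alpha> else 0))"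
      unfolding u v using B B' hermite_comb_mono[of B "B \<union> B'" n c] hermite_comb_mono[of B' "B \<union> B'" n c']
      by (simp add: hermite_comb_def[abs_def] distrib_right sum.distrib)
    then show ?thesis using B B' unfolding hermite_span_def by blast
  qed
  show "(\<lambda>x. a * u x) \<in> hermite_span n" if "u \<in> hermite_span n" for a u
  proof -
    obtain B c where B: "finite B" "B \<subseteq> idx n" and u: "u = hermite_comb n B c"
      by (rule hermite_spanE[OF \<open>u \<in> hermite_span n\<close>])
    have "(\<lambda>x. a * u x) = hermite_comb n B (\<lambda>\<alpha>. a * c \<alpha>)"
      unfolding u hermite_comb_def by (auto simp: sum_distrib_left mult.assoc)
    then show ?thesis using B unfolding hermite_span_def by blast
  qed
qed

text \<open>Expanding each factor in Hermite polynomials and distributing the product over the sums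
  gives one term for each choice of an index per coordinate.\<close>

lemma prod_poly_hermite_span: "(\<lambda>x. \<Prod>i<n. poly (p i) (x i)) \<in> hermite_span n"
proof -
  have "\<forall>i. \<exists>c N. p i = (\<Sum>k<N. smult (c k) (hermite k))" using poly_hermite_expansion by blast
  then obtain c N where p: "\<And>i. p i = (\<Sum>k<N i. smult (c i k) (hermite k))" by metis
  have "(\<lambda>x. \<Prod>i<n. poly (p i) (x i))
      = hermite_comb n (PiE {..<n} (\<lambda>i. {..<N i})) (\<lambda>\<alpha>. \<Prod>i<n. c i (\<alpha> i))"
    unfolding hermite_comb_def hermite_prod_def p poly_sum poly_smult
    by (auto simp: prod_sum_PiE prod.distrib)
  moreover have "finite (PiE {..<n} (\<lambda>i. {..<N i}))" "PiE {..<n} (\<lambda>i. {..<N i}) \<subseteq> idx n"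
    by (auto intro!: finite_PiE)
  ultimately show ?thesis unfolding hermite_span_def by blast
qed

text \<open>Approximate each one-dimensional indicator by polynomials. The squared distance of the
  products expands into three integrals, each of which factorizes over coordinates, and all three
  limits are the same number.\<close>

lemma box_indicator_closure:
  assumes A: "\<And>i. i < n \<Longrightarrow> A i \<in> sets borel"
  shows "indicat_real (PiE {..<n} A) \<in> hermite_span.L2_closure n"
proof -
  define g where "g = (\<lambda>i. indicat_real (A i))"
  have g: "g i \<in> L2_space std_normal_distribution" if "i < n" for i
    using A[OF that] by (intro L2_dominated[OF std_poly.L2_const[of 1]]) (auto simp: g_def indicator_def)
  have "\<exists>p. (\<integral>x. (poly p x - g i x)\<^sup>2 \<partial>std_normal_distribution) < 1 / real (Suc m)" if "i < n" for i m
    by (rule polynomials_dense_L2_std_normal[OF g[OF that], of "1 / real (Suc m)"]) (auto simp: power2_commute)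
  then have "\<exists>p. i < n \<longrightarrow> (\<integral>x. (poly p x - g i x)\<^sup>2 \<partial>std_normal_distribution) < 1 / real (Suc m)" for i m
    by (cases "i < n") auto
  then obtain p where p: "\<And>i m. i < n \<Longrightarrow>
      (\<integral>x. (poly (p i m) x - g i x)\<^sup>2 \<partial>std_normal_distribution) < 1 / real (Suc m)" by metis
  have lim: "(\<lambda>m. \<integral>x. (poly (p i m) x - g i x)\<^sup>2 \<partial>std_normal_distribution) \<longlonglongrightarrow> 0" if "i < n" for i
    by (rule tendsto_sandwich[OF always_eventually always_eventually tendsto_const
          lim_1_over_n[THEN LIMSEQ_Suc]]) (use p[OF that] in \<open>auto intro: less_imp_le\<close>)
  define P where "P = (\<lambda>m (x :: rvec). \<Prod>i<n. poly (p i m) (x i))"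
  define Gn where "Gn = (\<lambda>x :: rvec. \<Prod>i<n. g i (x i))"
  have GL: "Gn \<in> L2_space (gauss n)" unfolding Gn_def by (rule L2_gauss_prod) (use g in auto)
  have PL: "P m \<in> L2_space (gauss n)" for m
    unfolding P_def by (rule L2_gauss_prod) (auto simp: L2_std_normal_poly)
  have 0: "(\<integral>x. (Gn x - P m x)\<^sup>2 \<partial>gauss n)
     = (\<Prod>i<n. \<integral>t. g i t * g i t \<partial>std_normal_distribution)
       - 2 * (\<Prod>i<n. \<integral>t. poly (p i m) t * g i t \<partial>std_normal_distribution)
       + (\<Prod>i<n. \<integral>t. poly (p i m) t * poly (p i m) t \<partial>std_normal_distribution)" for m
  proof -
    have "(\<integral>x. (Gn x - P m x)\<^sup>2 \<partial>gauss n) = (\<integral>x. Gn x * Gn x - 2 * (P m x * Gn x) + P m x * P m x \<partial>gauss n)"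
      by (rule Bochner_Integration.integral_cong) (auto simp: power2_eq_square algebra_simps)
    also have "\<dots> = (\<integral>x. Gn x * Gn x \<partial>gauss n) - 2 * (\<integral>x. P m x * Gn x \<partial>gauss n) + (\<integral>x. P m x * P m x \<partial>gauss n)"
      using GL PL[of m] by (simp add: L2_mult_integrable)
    also have "\<dots> = (\<Prod>i<n. \<integral>t. g i t * g i t \<partial>std_normal_distribution)
       - 2 * (\<Prod>i<n. \<integral>t. poly (p i m) t * g i t \<partial>std_normal_distribution)
       + (\<Prod>i<n. \<integral>t. poly (p i m) t * poly (p i m) t \<partial>std_normal_distribution)"
      unfolding P_def Gn_def using g
      by (subst (1 2 3) gauss_integral_prod_mult) (auto simp: L2_std_normal_poly)
    finally show ?thesis .
  qed
  have 1: "(\<lambda>m. \<integral>x. (Gn x - P m x)\<^sup>2 \<partial>gauss n) \<longlonglongrightarrow>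
      (\<Prod>i<n. \<integral>t. g i t * g i t \<partial>std_normal_distribution)
       - 2 * (\<Prod>i<n. \<integral>t. g i t * g i t \<partial>std_normal_distribution)
       + (\<Prod>i<n. \<integral>t. g i t * g i t \<partial>std_normal_distribution)"
    unfolding 0
  proof (intro tendsto_intros tendsto_prod)
    fix i assume "i \<in> {..<n}"
    then have i: "i < n" by simp
    show "(\<lambda>m. \<integral>t. poly (p i m) t * g i t \<partial>std_normal_distribution) \<longlonglongrightarrow> (\<integral>t. g i t * g i t \<partial>std_normal_distribution)"
      by (rule L2_tendsto_inner) (use lim[OF i] g[OF i] in \<open>auto simp: L2_std_normal_poly\<close>)
    show "(\<lambda>m. \<integral>t. poly (p i m) t * poly (p i m) t \<partial>std_normal_distribution) \<longlonglongrightarrow> (\<integral>t. g i t * g i t \<partial>std_normal_distribution)"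
      by (rule L2_tendsto_inner) (use lim[OF i] g[OF i] in \<open>auto simp: L2_std_normal_poly\<close>)
  qed
  have "Gn \<in> hermite_span.L2_closure n"
  proof (rule hermite_span.closure_closed[OF GL])
    fix e :: real assume "e > 0"
    have "(\<lambda>m. \<integral>x. (Gn x - P m x)\<^sup>2 \<partial>gauss n) \<longlonglongrightarrow> 0" using 1 by simp
    then obtain m where "(\<integral>x. (Gn x - P m x)\<^sup>2 \<partial>gauss n) < e"
      using eventually_happens'[OF sequentially_bot] order_tendstoD(2)[OF _ \<open>e > 0\<close>] by blast
    moreover have "P m \<in> hermite_span.L2_closure n"
      unfolding P_def by (rule hermite_span.closure_superset[OF prod_poly_hermite_span])
    ultimately show "\<exists>v\<in>hermite_span.L2_closure n. (\<integral>x. (Gn x - v x)\<^sup>2 \<partial>gauss n) < e" by blast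
  qed
  \<comment> \<open>\<open>Gn\<close> and the box indicator agree on the space of the product
    measure only, whose points are extensional; the constant sequence replaces one by the
    other.\<close>
  then show ?thesis
  proof (rule hermite_span.closure_dominated[where us = "\<lambda>_. Gn" and w = "\<lambda>_. 1"])
    have eq: "Gn x = indicat_real (PiE {..<n} A) x" if sp: "x \<in> space (gauss n)" for x
    proof (cases "x \<in> PiE {..<n} A")
      case True
      then show ?thesis by (auto simp: Gn_def g_def indicator_def PiE_iff)
    next
      case False
      then obtain i where "i < n" "x i \<notin> A i" using sp by (auto simp: space_PiM PiE_iff)
      then have "Gn x = 0"
        unfolding Gn_def g_def by (intro prod_zero) (auto intro!: bexI[of _ i])
      then show ?thesis using False by simp
    qed
    show "\<bar>Gn x\<bar> \<le> 1" if "x \<in> space (gauss n)" for k x using eq[OF that] by (simp add: indicator_def)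
    show "(\<lambda>_. Gn x) \<longlonglongrightarrow> indicat_real (PiE {..<n} A) x" if "x \<in> space (gauss n)" for x
      using eq[OF that] by simp
  qed (rule gauss.L2_const)
qed

theorem hermite_span_dense:
  assumes u: "u \<in> L2_space (gauss n)"
  shows "u \<in> hermite_span.L2_closure n"
proof -
  let ?G = "{Pi\<^sub>E {..<n} A |A. \<forall>i\<in>{..<n}. A i \<in> sets (std_normal_distribution)}"
  have ind: "indicat_real A \<in> hermite_span.L2_closure n" if "A \<in> sets (gauss n)" for A
  proof (rule hermite_span.closure_indicator[OF _ _ _ _ _ that])
    show "Int_stable ?G"
    proof (rule Int_stableI)
      fix a b assume "a \<in> ?G" "b \<in> ?G"
      then obtain A B where "a = Pi\<^sub>E {..<n} A" "b = Pi\<^sub>E {..<n} B"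
        "\<forall>i\<in>{..<n}. A i \<in> sets borel" "\<forall>i\<in>{..<n}. B i \<in> sets borel" by auto
      then show "a \<inter> b \<in> ?G"
        by (auto simp: PiE_Int intro!: exI[of _ "\<lambda>i. A i \<inter> B i"])
    qed
    show "?G \<subseteq> Pow (space (gauss n))" by (auto simp: space_PiM)
    have "sets (gauss n) = sigma_sets (\<Pi>\<^sub>E i\<in>{..<n}. space std_normal_distribution)
       {Pi\<^sub>E {..<n} A |A. A \<in> Pi {..<n} (\<lambda>i. sets std_normal_distribution)}"
      by (simp add: sets_PiM prod_algebra_eq_finite)
    then show "sets (gauss n) = sigma_sets (space (gauss n)) ?G"
      by (simp add: space_PiM Pi_iff)
    show "indicat_real A \<in> hermite_span.L2_closure n" if "A \<in> ?G" for A
      using that by (auto intro!: box_indicator_closure)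
    have "(\<lambda>x. \<Prod>i<n. poly 1 (x i)) \<in> hermite_span.L2_closure n"
      by (rule hermite_span.closure_superset[OF prod_poly_hermite_span])
    then show "(\<lambda>x. 1) \<in> hermite_span.L2_closure n" by simp
  qed
  show ?thesis by (rule hermite_span.closure_eq_L2[OF ind u])
qed

section \<open>Orthogonal projections onto finite sets of indices and Bessel's inequality\<close>

definition hermite_inner :: "nat \<Rightarrow> (rvec \<Rightarrow> real) \<Rightarrow> (nat \<Rightarrow> nat) \<Rightarrow> real" where
  "hermite_inner n u \<alpha> = (\<integral>x. u x * hermite_prod n \<alpha> x \<partial>gauss n)"

definition hermite_proj :: "nat \<Rightarrow> (nat \<Rightarrow> nat) set \<Rightarrow> (rvec \<Rightarrow> real) \<Rightarrow> rvec \<Rightarrow> real" where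
  "hermite_proj n B u = hermite_comb n B (\<lambda>\<alpha>. hermite_inner n u \<alpha> / idx_fact n \<alpha>)"

lemma hermite_comb_inner:
  assumes "u \<in> L2_space (gauss n)"
  shows "(\<integral>x. u x * hermite_comb n B c x \<partial>gauss n) = (\<Sum>\<alpha>\<in>B. c \<alpha> * hermite_inner n u \<alpha>)"
proof -
  have "(\<integral>x. u x * hermite_comb n B c x \<partial>gauss n) = (\<integral>x. (\<Sum>\<alpha>\<in>B. c \<alpha> * (u x * hermite_prod n \<alpha> x)) \<partial>gauss n)"
    unfolding hermite_comb_def sum_distrib_left by (simp add: mult_ac)
  also have "\<dots> = (\<Sum>\<alpha>\<in>B. c \<alpha> * hermite_inner n u \<alpha>)"
    unfolding hermite_inner_def using assms by (subst Bochner_Integration.integral_sum)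
       (auto intro!: L2_mult_integrable L2_hermite_prod)
  finally show ?thesis .
qed

lemma hermite_inner_prod:
  assumes "\<alpha> \<in> idx n" "\<beta> \<in> idx n"
  shows "hermite_inner n (hermite_prod n \<alpha>) \<beta> = (if \<alpha> = \<beta> then idx_fact n \<alpha> else 0)"
  unfolding hermite_inner_def using hermite_prod_orthogonal[OF assms] .

lemma hermite_inner_comb:
  assumes "finite B" "B \<subseteq> idx n" "\<beta> \<in> idx n"
  shows "hermite_inner n (hermite_comb n B c) \<beta> = (if \<beta> \<in> B then c \<beta> * idx_fact n \<beta> else 0)"
proof -
  have "hermite_inner n (hermite_comb n B c) \<beta> = (\<integral>x. hermite_prod n \<beta> x * hermite_comb n B c x \<partial>gauss n)"
    by (simp add: hermite_inner_def mult.commute)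
  also have "\<dots> = (\<Sum>\<alpha>\<in>B. if \<beta> = \<alpha> then c \<alpha> * idx_fact n \<alpha> else 0)"
    unfolding hermite_comb_inner[OF L2_hermite_prod]
    by (rule sum.cong) (use assms in \<open>auto simp: hermite_inner_prod subset_iff\<close>)
  also have "\<dots> = (if \<beta> \<in> B then c \<beta> * idx_fact n \<beta> else 0)"
    using assms(1) by (simp add: sum.delta)
  finally show ?thesis .
qed

text \<open>Completing the square coefficient by coefficient; the minimum is at
  \<open>hermite_inner n u \<alpha> / idx_fact n \<alpha>\<close>. Bessel's inequality and best
  approximation are both read off from this identity.\<close>

lemma hermite_comb_distance:
  assumes u: "u \<in> L2_space (gauss n)" and B: "finite B" "B \<subseteq> idx n"
  shows "(\<integral>x. (u x - hermite_comb n B c x)\<^sup>2 \<partial>gauss n) = (\<integral>x. (u x)\<^sup>2 \<partial>gauss n)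
     - (\<Sum>\<alpha>\<in>B. (hermite_inner n u \<alpha>)\<^sup>2 / idx_fact n \<alpha>)
     + (\<Sum>\<alpha>\<in>B. idx_fact n \<alpha> * (c \<alpha> - hermite_inner n u \<alpha> / idx_fact n \<alpha>)\<^sup>2)"
proof -
  let ?v = "hermite_comb n B c"
  have "(\<integral>x. (u x - ?v x)\<^sup>2 \<partial>gauss n) = (\<integral>x. (u x)\<^sup>2 - 2 * (u x * ?v x) + ?v x * ?v x \<partial>gauss n)"
    by (rule Bochner_Integration.integral_cong) (auto simp: power2_eq_square algebra_simps)
  also have "\<dots> = (\<integral>x. (u x)\<^sup>2 \<partial>gauss n) - 2 * (\<integral>x. u x * ?v x \<partial>gauss n) + (\<integral>x. ?v x * ?v x \<partial>gauss n)"
    using u by (simp add: L2_mult_integrable L2_square_integrable L2_hermite_comb)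
  also have "(\<integral>x. ?v x * ?v x \<partial>gauss n) = (\<Sum>\<alpha>\<in>B. (c \<alpha>)\<^sup>2 * idx_fact n \<alpha>)"
    unfolding hermite_comb_inner[OF L2_hermite_comb]
    by (rule sum.cong) (use B in \<open>auto simp: hermite_inner_comb subset_iff power2_eq_square\<close>)
  also have "(\<integral>x. u x * ?v x \<partial>gauss n) = (\<Sum>\<alpha>\<in>B. c \<alpha> * hermite_inner n u \<alpha>)"
    by (rule hermite_comb_inner[OF u])
  also have "(\<Sum>\<alpha>\<in>B. (c \<alpha>)\<^sup>2 * idx_fact n \<alpha>) = (\<Sum>\<alpha>\<in>B. 2 * (c \<alpha> * hermite_inner n u \<alpha>))
     - (\<Sum>\<alpha>\<in>B. (hermite_inner n u \<alpha>)\<^sup>2 / idx_fact n \<alpha>)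
     + (\<Sum>\<alpha>\<in>B. idx_fact n \<alpha> * (c \<alpha> - hermite_inner n u \<alpha> / idx_fact n \<alpha>)\<^sup>2)"
    unfolding sum.distrib[symmetric] sum_subtractf[symmetric]
  proof (rule sum.cong[OF refl])
    fix \<alpha>
    have "idx_fact n \<alpha> \<noteq> 0" using idx_fact_pos[of n \<alpha>] by simp
    then show "(c \<alpha>)\<^sup>2 * idx_fact n \<alpha> = 2 * (c \<alpha> * hermite_inner n u \<alpha>)
      - (hermite_inner n u \<alpha>)\<^sup>2 / idx_fact n \<alpha>
      + idx_fact n \<alpha> * (c \<alpha> - hermite_inner n u \<alpha> / idx_fact n \<alpha>)\<^sup>2"
      by (simp add: power2_eq_square field_simps)
  qed
  finally show ?thesis by (simp add: sum_distrib_left)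
qed

lemma hermite_proj_distance:
  assumes u: "u \<in> L2_space (gauss n)" and B: "finite B" "B \<subseteq> idx n"
  shows "(\<integral>x. (u x - hermite_proj n B u x)\<^sup>2 \<partial>gauss n) = (\<integral>x. (u x)\<^sup>2 \<partial>gauss n)
     - (\<Sum>\<alpha>\<in>B. (hermite_inner n u \<alpha>)\<^sup>2 / idx_fact n \<alpha>)"
  unfolding hermite_proj_def hermite_comb_distance[OF assms] by simp

lemma hermite_Bessel:
  assumes u: "u \<in> L2_space (gauss n)" and B: "finite B" "B \<subseteq> idx n"
  shows "(\<Sum>\<alpha>\<in>B. (hermite_inner n u \<alpha>)\<^sup>2 / idx_fact n \<alpha>) \<le> (\<integral>x. (u x)\<^sup>2 \<partial>gauss n)"
proof -
  have "0 \<le> (\<integral>x. (u x - hermite_proj n B u x)\<^sup>2 \<partial>gauss n)" by simp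
  then show ?thesis using hermite_proj_distance[OF assms] by linarith
qed

text \<open>The error of the projection can only decrease when \<open>B\<close> grows. Stating the
  bound for all finite \<open>B\<close> above \<open>F\<close> is what later allows a single
  \<open>B\<close> to serve several functions.\<close>

lemma hermite_proj_approx:
  assumes u: "u \<in> L2_space (gauss n)" and e: "e > 0"
  shows "\<exists>F. finite F \<and> F \<subseteq> idx n \<and> (\<forall>B. finite B \<and> F \<subseteq> B \<and> B \<subseteq> idx n \<longrightarrow>
    (\<integral>x. (u x - hermite_proj n B u x)\<^sup>2 \<partial>gauss n) < e)"
proof -
  obtain v where "v \<in> hermite_span n" "(\<integral>x. (u x - v x)\<^sup>2 \<partial>gauss n) < e"
    using hermite_span.closure_approx[OF hermite_span_dense[OF u] e] by blast
  then obtain F c where F: "finite F" "F \<subseteq> idx n" and lt: "(\<integral>x. (u x - hermite_comb n F c x)\<^sup>2 \<partial>gauss n) < e"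
    unfolding hermite_span_def by blast
  show ?thesis
  proof (intro exI[of _ F] conjI F allI impI)
    fix B assume "finite B \<and> F \<subseteq> B \<and> B \<subseteq> idx n"
    then have B: "finite B" "F \<subseteq> B" "B \<subseteq> idx n" by simp_all
    have "(\<Sum>\<alpha>\<in>F. (hermite_inner n u \<alpha>)\<^sup>2 / idx_fact n \<alpha>) \<le> (\<Sum>\<alpha>\<in>B. (hermite_inner n u \<alpha>)\<^sup>2 / idx_fact n \<alpha>)"
      using B by (intro sum_mono2) (auto intro!: divide_nonneg_pos idx_fact_pos)
    moreover have "0 \<le> (\<Sum>\<alpha>\<in>F. idx_fact n \<alpha> * (c \<alpha> - hermite_inner n u \<alpha> / idx_fact n \<alpha>)\<^sup>2)"
      by (intro sum_nonneg mult_nonneg_nonneg) (auto intro!: less_imp_le[OF idx_fact_pos])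
    ultimately show "(\<integral>x. (u x - hermite_proj n B u x)\<^sup>2 \<partial>gauss n) < e"
      using lt hermite_comb_distance[OF u F, of c] hermite_proj_distance[OF u B(1,3)] by linarith
  qed
qed

section \<open>Weak gradients and Hermite coefficients\<close>


text \<open>The derivative is quantified existentially, so membership is shown by exhibiting a
  derivative; a family closed under differentiation up to sums is then smooth by induction.\<close>

primrec C_line :: "nat \<Rightarrow> (real \<Rightarrow> real) \<Rightarrow> bool" where
  "C_line 0 g \<longleftrightarrow> continuous_on UNIV g"
| "C_line (Suc k) g \<longleftrightarrow> (\<exists>g'. (\<forall>x. (g has_real_derivative g' x) (at x)) \<and> C_line k g')"

lemma C_line_continuous: "C_line k g \<Longrightarrow> continuous_on UNIV g"
proof (cases k)
  case (Suc l)
  assume "C_line k g"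
  then obtain g' where "\<And>x. (g has_real_derivative g' x) (at x)" using Suc by auto
  then show ?thesis by (intro continuous_at_imp_continuous_on ballI DERIV_isCont)
qed simp

lemma C_line_SucD: "C_line (Suc k) g \<Longrightarrow> C_line k g"
  by (induction k arbitrary: g) (auto intro: C_line_continuous[of "Suc 0", simplified])

lemma C_line_deriv:
  assumes "C_line (Suc k) g"
  shows "C_line k (deriv g)" "(g has_real_derivative deriv g x) (at x)"
proof -
  obtain g' where g': "\<And>x. (g has_real_derivative g' x) (at x)" "C_line k g'"
    using assms by auto
  have "deriv g = g'" by (rule ext) (rule DERIV_imp_deriv[OF g'(1)])
  then show "C_line k (deriv g)" "(g has_real_derivative deriv g x) (at x)" using g' by simp_all
qed

lemma C_line_add: "C_line k f \<Longrightarrow> C_line k g \<Longrightarrow> C_line k (\<lambda>x. f x + g x)"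
proof (induction k arbitrary: f g)
  case (Suc k)
  then obtain f' g' where "\<forall>x. (f has_real_derivative f' x) (at x)" "C_line k f'"
    "\<forall>x. (g has_real_derivative g' x) (at x)" "C_line k g'" by auto
  then show ?case using Suc.IH[of f' g'] by (auto intro!: exI[of _ "\<lambda>x. f' x + g' x"] derivative_intros)
qed (auto intro: continuous_intros)

section \<open>Smooth cutoffs of polynomials\<close>

lemma power_le_fact_exp: "0 \<le> (x::real) \<Longrightarrow> x ^ k \<le> fact k * exp x"
proof -
  assume x: "0 \<le> x"
  have "(\<Sum>i\<in>{k}. x ^ i /\<^sub>R fact i) \<le> exp x"
    unfolding exp_def by (rule sum_le_suminf[OF summable_exp_generic]) (use x in auto)
  then show ?thesis by (simp add: field_simps)
qed

text \<open>For \<open>m = 0\<close> this is \<open>P\<close> cut off at \<open>R\<close>, normalized so that it tends to \<open>P\<close> as \<open>R\<close> grows. The exponent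
  \<open>m\<close> makes the family closed under differentiation, up to sums.\<close>

definition bump :: "real \<Rightarrow> real poly \<Rightarrow> nat \<Rightarrow> real \<Rightarrow> real" where
  "bump R P m x = (if \<bar>x\<bar> < R then poly P x * (1 / (1 - (x / R)\<^sup>2)) ^ m
     * exp (1 - 1 / (1 - (x / R)\<^sup>2)) else 0)"

lemma one_minus_square_pos:
  fixes x R :: real
  assumes "\<bar>x\<bar> < R"
  shows "0 < 1 - (x / R)\<^sup>2" "1 \<le> 1 / (1 - (x / R)\<^sup>2)"
proof -
  have "R > 0" using assms abs_ge_zero[of x] by linarith
  then have "(x / R)\<^sup>2 < 1" using assms by (simp add: abs_square_less_1)
  then show "0 < 1 - (x / R)\<^sup>2" "1 \<le> 1 / (1 - (x / R)\<^sup>2)" by simp_all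
qed

text \<open>With s = 1 / (1 - (x/R)^2) this says that the exponential of the bump beats every power
  of s; the 3 is e rounded up.\<close>

lemma inverse_power_exp_le:
  assumes "1 \<le> (s::real)"
  shows "s ^ m * exp (1 - s) \<le> 3 * fact m"
proof -
  have "s ^ m * exp (1 - s) \<le> fact m * exp s * exp (1 - s)"
    using assms by (intro mult_right_mono power_le_fact_exp) auto
  also have "\<dots> = fact m * exp 1" by (simp add: mult.assoc exp_add[symmetric])
  also have "\<dots> \<le> fact m * 3" using exp_le by (intro mult_left_mono) auto
  finally show ?thesis by simp
qed

lemma abs_bump_eq:
  assumes "\<bar>x\<bar> < R"
  shows "\<bar>bump R P m x\<bar> = \<bar>poly P x\<bar> * ((1 / (1 - (x / R)\<^sup>2)) ^ m * exp (1 - 1 / (1 - (x / R)\<^sup>2)))"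
proof -
  have "0 \<le> (1 / (1 - (x / R)\<^sup>2)) ^ m * exp (1 - 1 / (1 - (x / R)\<^sup>2))"
    using one_minus_square_pos[OF assms] by (intro mult_nonneg_nonneg zero_le_power) auto
  moreover have "bump R P m x = poly P x * ((1 / (1 - (x / R)\<^sup>2)) ^ m * exp (1 - 1 / (1 - (x / R)\<^sup>2)))"
    using assms by (simp add: bump_def)
  ultimately show ?thesis by (simp only: abs_mult[of "poly P x"] abs_of_nonneg)
qed

lemma bump_zero: "bump R 0 m x = 0"
  by (simp add: bump_def)

lemma bump_minus: "bump R (- P) m x = - bump R P m x"
  by (simp add: bump_def)

text \<open>The bound does not depend on \<open>R\<close>, so it can serve as a majorant when the
  cutoff is removed.\<close>

lemma abs_bump_le: "\<bar>bump R P m x\<bar> \<le> 3 * fact m * \<bar>poly P x\<bar>"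
proof (cases "\<bar>x\<bar> < R")
  case True
  let ?s = "1 / (1 - (x / R)\<^sup>2)"
  have s: "1 \<le> ?s" using one_minus_square_pos[OF True] by simp
  have "\<bar>bump R P m x\<bar> = \<bar>poly P x\<bar> * (?s ^ m * exp (1 - ?s))" by (rule abs_bump_eq[OF True])
  also have "\<dots> \<le> \<bar>poly P x\<bar> * (3 * fact m)"
    by (intro mult_left_mono inverse_power_exp_le s) auto
  finally show ?thesis by (simp add: mult_ac)
qed (simp add: bump_def)

lemma abs_bump_0_le: "\<bar>bump R P 0 x\<bar> \<le> \<bar>poly P x\<bar>"
proof (cases "\<bar>x\<bar> < R")
  case True
  have "exp (1 - 1 / (1 - (x / R)\<^sup>2)) \<le> 1" using one_minus_square_pos[OF True] by simp
  then show ?thesis using True by (simp add: bump_def abs_mult mult_left_le)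
qed (simp add: bump_def)

text \<open>Borrow two more powers of s = 1 / (1 - (y/R)^2): they are still controlled by the
  exponential, and the compensating factor (1 - (y/R)^2)^2 vanishes quadratically at the endpoint x.
  The two endpoints are treated at once through (x + y)(x - y) = R^2 - y^2.\<close>

lemma abs_bump_boundary_le:
  assumes "R > 0"
  shows "\<exists>K. \<forall>y. \<forall>x. \<bar>x\<bar> = R \<longrightarrow> \<bar>bump R P m y\<bar> \<le> K * (y - x)\<^sup>2"
proof -
  have "bounded (poly P ` {-R..R})"
    by (intro compact_imp_bounded compact_continuous_image continuous_intros) auto
  then obtain B where "\<forall>y\<in>{-R..R}. \<bar>poly P y\<bar> \<le> B" unfolding bounded_iff by auto
  then have B: "\<And>y. y \<in> {-R..R} \<Longrightarrow> \<bar>poly P y\<bar> \<le> B" by blast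
  have B0: "B \<ge> 0" using B[of 0] assms by simp
  have "\<bar>bump R P m y\<bar> \<le> (B * (3 * fact (m + 2)) * (4 / R\<^sup>2)) * (y - x)\<^sup>2" if x: "\<bar>x\<bar> = R" for x y
  proof (cases "\<bar>y\<bar> < R")
    case True
    let ?s = "1 / (1 - (y / R)\<^sup>2)"
    have s: "1 \<le> ?s" "0 < 1 - (y / R)\<^sup>2" using one_minus_square_pos[OF True] by auto
    have "?s ^ m * exp (1 - ?s) = (1 - (y / R)\<^sup>2)\<^sup>2 * (?s ^ (m + 2) * exp (1 - ?s))"
    proof -
      have "(1 / a) ^ m * b = a\<^sup>2 * ((1 / a) ^ (m + 2) * b)" if "0 < a" for a b :: real
        using that by (simp add: power_add power_one_over power2_eq_square)
      from this[OF s(2)] show ?thesis .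
    qed
    also have "\<dots> \<le> (1 - (y / R)\<^sup>2)\<^sup>2 * (3 * fact (m + 2))"
      by (intro mult_left_mono inverse_power_exp_le s) auto
    finally have 1: "?s ^ m * exp (1 - ?s) \<le> (1 - (y / R)\<^sup>2)\<^sup>2 * (3 * fact (m + 2))" .
    have Rx: "R\<^sup>2 = x\<^sup>2" using x by (metis power2_abs)
    have "(1 - (y / R)\<^sup>2) = (x + y) * (x - y) / R\<^sup>2"
    proof -
      have "(x + y) * (x - y) = R\<^sup>2 - y\<^sup>2" unfolding Rx by (simp add: power2_eq_square algebra_simps)
      then show ?thesis using assms by (simp add: power_divide diff_divide_distrib)
    qed
    then have "(1 - (y / R)\<^sup>2)\<^sup>2 = (x + y)\<^sup>2 * (y - x)\<^sup>2 / (R\<^sup>2 * R\<^sup>2)"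
      by (simp add: power_mult_distrib power_divide power2_commute power2_eq_square[of "R\<^sup>2"])
    also have "\<dots> \<le> (2 * R)\<^sup>2 * (y - x)\<^sup>2 / (R\<^sup>2 * R\<^sup>2)"
    proof (intro divide_right_mono mult_right_mono)
      have "\<bar>x + y\<bar> \<le> \<bar>2 * R\<bar>" using x True by linarith
      then show "(x + y)\<^sup>2 \<le> (2 * R)\<^sup>2" by (simp only: abs_le_square_iff)
    qed auto
    also have "\<dots> = 4 / R\<^sup>2 * (y - x)\<^sup>2" using assms by (simp add: power_mult_distrib field_simps)
    finally have 2: "(1 - (y / R)\<^sup>2)\<^sup>2 \<le> 4 / R\<^sup>2 * (y - x)\<^sup>2" .
    have "\<bar>bump R P m y\<bar> = \<bar>poly P y\<bar> * (?s ^ m * exp (1 - ?s))" by (rule abs_bump_eq[OF True])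
    also have "\<dots> \<le> B * ((1 - (y / R)\<^sup>2)\<^sup>2 * (3 * fact (m + 2)))"
    proof (rule mult_mono[OF _ 1 B0])
      show "\<bar>poly P y\<bar> \<le> B" using B[of y] True by (simp add: abs_less_iff)
      show "0 \<le> ?s ^ m * exp (1 - ?s)" using s by (intro mult_nonneg_nonneg zero_le_power) auto
    qed
    also have "\<dots> \<le> B * ((4 / R\<^sup>2 * (y - x)\<^sup>2) * (3 * fact (m + 2)))"
      using B0 by (intro mult_left_mono mult_right_mono 2) auto
    finally show ?thesis by (simp only: mult_ac)
  next
    case False
    then show ?thesis using B0 by (simp add: bump_def)
  qed
  then show ?thesis by blast
qed

lemma DERIV_zero_of_quadratic_bound:
  fixes f :: "real \<Rightarrow> real"
  assumes "f x = 0" "\<And>y. \<bar>f y\<bar> \<le> K * (y - x)\<^sup>2"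
  shows "(f has_real_derivative 0) (at x)"
  unfolding has_field_derivative_iff
proof (rule Lim_null_comparison)
  show "\<forall>\<^sub>F y in at x. norm ((f y - f x) / (y - x)) \<le> K * \<bar>y - x\<bar>"
  proof (rule eventually_at_filter[THEN iffD2, OF always_eventually], intro allI impI)
    fix y assume "y \<noteq> x"
    then show "norm ((f y - f x) / (y - x)) \<le> K * \<bar>y - x\<bar>"
      using assms(2)[of y] assms(1) by (simp add: field_simps power2_eq_square abs_mult_self_eq)
  qed
  show "((\<lambda>y. K * \<bar>y - x\<bar>) \<longlongrightarrow> 0) (at x)" by (auto intro!: tendsto_eq_intros)
qed

text \<open>Inside the interval s' = 2 x s^2 / R^2 for s = 1 / (1 - (x/R)^2), so the power s^m
  contributes a term with exponent m + 1 and exp (1 - s) one with exponent m + 2. At the endpoints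
  the quadratic bound forces derivative 0, matching the vanishing formula, and outside everything is
  0.\<close>

lemma bump_has_derivative:
  assumes R: "R > 0"
  shows "(bump R P m has_real_derivative bump R (pderiv P) m x
    + bump R (smult (2 * real m / R\<^sup>2) ([:0,1:] * P)) (m + 1) x
    + bump R (smult (- 2 / R\<^sup>2) ([:0,1:] * P)) (m + 2) x) (at x)"
proof -
  consider "\<bar>x\<bar> < R" | "\<bar>x\<bar> = R" | "\<bar>x\<bar> > R" by linarith
  then show ?thesis
  proof cases
    case 1
    define s where "s = (\<lambda>x. 1 / (1 - (x / R)\<^sup>2))"
    have pos: "1 - (x / R)\<^sup>2 \<noteq> 0" using one_minus_square_pos[OF 1] by simp
    have d0: "((\<lambda>x. 1 - (x / R)\<^sup>2) has_real_derivative - (2 * x / R\<^sup>2)) (at x)"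
      using R by (auto intro!: derivative_eq_intros simp: power2_eq_square)
    have ds: "(s has_real_derivative 2 * x / R\<^sup>2 * (s x)\<^sup>2) (at x)"
      unfolding s_def
      by (rule DERIV_cong[OF DERIV_divide[OF DERIV_const d0 pos]]) (simp add: power2_eq_square)
    have dsm: "((\<lambda>x. s x ^ m) has_real_derivative 2 * real m / R\<^sup>2 * x * s x ^ (m + 1)) (at x)"
    proof (cases m)
      case (Suc k)
      show ?thesis unfolding Suc
        by (rule DERIV_cong[OF DERIV_power[OF ds]]) (simp add: power2_eq_square)
    qed simp
    have de: "((\<lambda>x. exp (1 - s x)) has_real_derivative - (2 * x / R\<^sup>2 * (s x)\<^sup>2) * exp (1 - s x)) (at x)"
      by (rule derivative_eq_intros ds refl)+ simp
    have d: "((\<lambda>x. poly P x * s x ^ m * exp (1 - s x)) has_real_derivative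
       (poly (pderiv P) x * s x ^ m + (2 * real m / R\<^sup>2 * x * s x ^ (m + 1)) * poly P x) * exp (1 - s x)
        + - (2 * x / R\<^sup>2 * (s x)\<^sup>2) * exp (1 - s x) * (poly P x * s x ^ m)) (at x)"
      by (rule DERIV_mult[OF DERIV_mult[OF poly_DERIV dsm] de])
    have b: "bump R p q x = poly p x * s x ^ q * exp (1 - s x)" for p q
      using 1 by (simp add: bump_def s_def)
    show ?thesis
    proof (rule has_field_derivative_transform_within_open)
      show "((\<lambda>x. poly P x * s x ^ m * exp (1 - s x)) has_real_derivative bump R (pderiv P) m x
        + bump R (smult (2 * real m / R\<^sup>2) ([:0,1:] * P)) (m + 1) x
        + bump R (smult (- 2 / R\<^sup>2) ([:0,1:] * P)) (m + 2) x) (at x)"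
        by (rule DERIV_cong[OF d]) (simp add: b power_add power2_eq_square algebra_simps)
      show "x \<in> {-R<..<R}" using 1 by auto
      show "poly P y * s y ^ m * exp (1 - s y) = bump R P m y" if "y \<in> {-R<..<R}" for y
        using that by (auto simp: bump_def s_def)
    qed auto
  next
    case 2
    obtain K where "\<And>y. \<bar>bump R P m y\<bar> \<le> K * (y - x)\<^sup>2"
      using abs_bump_boundary_le[OF R, of P m] 2 by blast
    then have "(bump R P m has_real_derivative 0) (at x)"
      using 2 by (intro DERIV_zero_of_quadratic_bound[where K = K]) (auto simp: bump_def)
    then show ?thesis using 2 by (simp add: bump_def)
  next
    case 3
    have "(bump R P m has_real_derivative 0) (at x)"
    proof (rule has_field_derivative_transform_within_open[of "\<lambda>_. 0" _ _ "{x. R < \<bar>x\<bar>}"])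
      show "open {x. R < \<bar>x\<bar>}" by (intro open_Collect_less continuous_intros)
    qed (use 3 in \<open>auto simp: bump_def\<close>)
    then show ?thesis using 3 by (simp add: bump_def)
  qed
qed

definition gauss_bump :: "real \<Rightarrow> real poly \<Rightarrow> nat \<Rightarrow> real \<Rightarrow> real" where
  "gauss_bump R P m x = std_normal_density x * bump R P m x"

lemma gauss_bump_has_derivative:
  assumes R: "R > 0"
  shows "(gauss_bump R P m has_real_derivative gauss_bump R (pderiv P - [:0,1:] * P) m x
    + gauss_bump R (smult (2 * real m / R\<^sup>2) ([:0,1:] * P)) (m + 1) x
    + gauss_bump R (smult (- 2 / R\<^sup>2) ([:0,1:] * P)) (m + 2) x) (at x)"
  unfolding gauss_bump_def[abs_def]
  by (rule DERIV_cong[OF DERIV_mult[OF std_normal_density_has_derivative bump_has_derivative[OF R]]])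
     (simp add: bump_def algebra_simps)

lemma C_line_gauss_bump:
  assumes R: "R > 0"
  shows "C_line k (gauss_bump R P m)"
proof (induction k arbitrary: P m)
  case 0
  then show ?case
    using gauss_bump_has_derivative[OF R] by (auto intro!: continuous_at_imp_continuous_on DERIV_isCont)
next
  case (Suc k)
  let ?g' = "\<lambda>x. gauss_bump R (pderiv P - [:0,1:] * P) m x
    + gauss_bump R (smult (2 * real m / R\<^sup>2) ([:0,1:] * P)) (m + 1) x
    + gauss_bump R (smult (- 2 / R\<^sup>2) ([:0,1:] * P)) (m + 2) x"
  have "C_line k ?g'" by (intro C_line_add Suc)
  then show ?case unfolding C_line.simps 
    by (intro exI[of _ ?g'] conjI allI gauss_bump_has_derivative[OF R])
qed

text \<open>Differentiating He_k times the normal density gives -He_(k+1) times the density. With m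
  = 0 the term of exponent m + 1 drops out, and the cutoff error is the remaining term, of order 1 /
  R^2.\<close>

lemma deriv_gauss_bump_hermite:
  assumes "R > 0"
  shows "deriv (gauss_bump R (hermite k) 0) x = std_normal_density x *
    (- bump R (hermite (Suc k)) 0 x + bump R (smult (- 2 / R\<^sup>2) ([:0,1:] * hermite k)) 2 x)"
proof -
  have eq: "pderiv (hermite k) - [:0,1:] * hermite k = - hermite (Suc k)" by simp
  show ?thesis
    using DERIV_imp_deriv[OF gauss_bump_has_derivative[OF assms, of "hermite k" 0 x]]
    unfolding gauss_bump_def eq of_nat_0 mult_zero_right div_0 smult_0_left bump_zero bump_minus
    by (simp only: add_0 add_0_right distrib_left mult_zero_right)
qed

section \<open>Test functions of product form\<close>

lemma partial_prod:
  assumes "i < n" "\<And>x. (g i has_real_derivative deriv (g i) x) (at x)"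
  shows "((\<lambda>t. \<Prod>j<n. g j ((x(i := t)) j)) has_real_derivative
      (\<Prod>j\<in>{..<n} - {i}. g j (x j)) * deriv (g i) t) (at t)"
    "partial i (\<lambda>x. \<Prod>j<n. g j (x j)) = (\<lambda>x. \<Prod>j<n. (g(i := deriv (g i))) j (x j))"
proof -
  have eq: "(\<Prod>j<n. g j ((x(i := t)) j)) = (\<Prod>j\<in>{..<n} - {i}. g j (x j)) * g i t" for x t
    using assms(1) by (subst prod.remove[of _ i]) (auto simp: mult.commute intro!: prod.cong)
  show *: "((\<lambda>t. \<Prod>j<n. g j ((x(i := t)) j)) has_real_derivative
      (\<Prod>j\<in>{..<n} - {i}. g j (x j)) * deriv (g i) t) (at t)" for x t
    unfolding eq by (rule DERIV_cmult[OF assms(2)])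
  show "partial i (\<lambda>x. \<Prod>j<n. g j (x j)) = (\<lambda>x. \<Prod>j<n. (g(i := deriv (g i))) j (x j))"
  proof
    fix x
    have "partial i (\<lambda>x. \<Prod>j<n. g j (x j)) x = (\<Prod>j\<in>{..<n} - {i}. g j (x j)) * deriv (g i) (x i)"
      unfolding partial_def by (rule DERIV_imp_deriv[OF *])
    also have "\<dots> = (\<Prod>j<n. (g(i := deriv (g i))) j (x j))"
      using assms(1) by (subst (2) prod.remove[of _ i]) (auto simp: mult.commute intro!: prod.cong)
    finally show "partial i (\<lambda>x. \<Prod>j<n. g j (x j)) x = (\<Prod>j<n. (g(i := deriv (g i))) j (x j))" .
  qed
qed

text \<open>A partial derivative of a product of one-variable functions is again such a product,
  with factor i replaced by its derivative, so the recursion defining \<open>C_k\<close> closes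
  up.\<close>

lemma C_k_prod:
  assumes "\<And>j. j < n \<Longrightarrow> C_line k (g j)"
  shows "C_k n k (\<lambda>x. \<Prod>j<n. g j (x j))"
  using assms
proof (induction k arbitrary: g)
  case 0
  have "continuous_on (Rn n) (\<lambda>x. g j (x j))" if "j < n" for j
    using 0[OF that] by (auto intro!: continuous_on_compose2[OF _ continuous_on_subset[OF continuous_on_product_coordinates]])
  then show ?case by (auto intro!: continuous_on_prod)
next
  case (Suc k)
  have "continuous_on (Rn n) (\<lambda>x. g j (x j))" if "j < n" for j
    using C_line_continuous[OF Suc.prems[OF that]]
    by (auto intro!: continuous_on_compose2[OF _ continuous_on_subset[OF continuous_on_product_coordinates]])
  then have c: "continuous_on (Rn n) (\<lambda>x. \<Prod>j<n. g j (x j))" by (auto intro!: continuous_on_prod)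
  have d: "(g i has_real_derivative deriv (g i) x) (at x)" if "i < n" for i x
    using C_line_deriv(2)[OF Suc.prems[OF that]] .
  show ?case unfolding C_k.simps
  proof (intro conjI c allI impI ballI)
    fix i assume i: "i < n"
    show "(\<lambda>t. \<Prod>j<n. g j ((x(i := t)) j)) field_differentiable at (x i)" for x
      using partial_prod(1)[where g = g, OF i d[OF i]] unfolding field_differentiable_def by blast
    show "C_k n k (partial i (\<lambda>x. \<Prod>j<n. g j (x j)))"
      unfolding partial_prod(2)[where g = g, OF i d[OF i]]
      by (rule Suc.IH) (use Suc.prems C_line_SucD C_line_deriv(1) in auto)
  qed
qed

lemma prod_test_function:
  assumes "\<And>j k. j < n \<Longrightarrow> C_line k (g j)" "\<And>j t. j < n \<Longrightarrow> \<bar>t\<bar> > R \<Longrightarrow> g j t = 0"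
  shows "(\<lambda>x. \<Prod>j<n. g j (x j)) \<in> test_functions n"
proof -
  have "(\<Prod>j<n. g j (x j)) = 0" if "i < n" "\<bar>x i\<bar> > R" for x i
    by (rule prod_zero) (use assms(2)[OF that] that in auto)
  then show ?thesis unfolding test_functions_def using assms(1) by (auto intro!: C_k_prod exI[of _ R])
qed

section \<open>Passage from Lebesgue to Gaussian integrals and removal of the cutoff\<close>

lemma (in product_sigma_finite) density_PiM:
  assumes I: "finite I" and [measurable]: "\<And>i. i \<in> I \<Longrightarrow> f i \<in> borel_measurable (M i)"
    and sf: "\<And>i. sigma_finite_measure (density (M i) (f i))"
  shows "density (PiM I M) (\<lambda>x. \<Prod>i\<in>I. f i (x i)) = (\<Pi>\<^sub>M i\<in>I. density (M i) (f i))"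
proof -
  interpret D: product_sigma_finite "\<lambda>i. density (M i) (f i)"
    by (simp add: product_sigma_finite_def sf)
  show ?thesis
  proof (rule D.PiM_eqI[OF I])
    show "sets (density (PiM I M) (\<lambda>x. \<Prod>i\<in>I. f i (x i))) = sets (\<Pi>\<^sub>M i\<in>I. density (M i) (f i))"
      by (simp add: sets_density cong: sets_PiM_cong)
    fix A assume "\<And>i. i \<in> I \<Longrightarrow> A i \<in> sets (density (M i) (f i))"
    then have A [measurable]: "\<And>i. i \<in> I \<Longrightarrow> A i \<in> sets (M i)" by simp
    have box: "PiE I A \<in> sets (PiM I M)" using I A by (intro sets_PiM_I_finite) auto
    have "emeasure (density (PiM I M) (\<lambda>x. \<Prod>i\<in>I. f i (x i))) (PiE I A)
       = (\<integral>\<^sup>+x. (\<Prod>i\<in>I. f i (x i)) * indicator (PiE I A) x \<partial>PiM I M)"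
      using box by (intro emeasure_density) auto
    also have "\<dots> = (\<integral>\<^sup>+x. (\<Prod>i\<in>I. f i (x i) * indicator (A i) (x i)) \<partial>PiM I M)"
    proof (rule nn_integral_cong)
      fix x assume x: "x \<in> space (PiM I M)"
      have "indicator (PiE I A) x = (\<Prod>i\<in>I. indicator (A i) (x i) :: ennreal)"
      proof (cases "x \<in> PiE I A")
        case False
        then obtain i where "i \<in> I" "x i \<notin> A i" using x by (auto simp: space_PiM PiE_iff)
        then show ?thesis using False I by (auto intro!: prod_zero[symmetric] bexI[of _ i])
      qed (auto simp: PiE_iff)
      then show "(\<Prod>i\<in>I. f i (x i)) * indicator (PiE I A) x = (\<Prod>i\<in>I. f i (x i) * indicator (A i) (x i))"
        by (simp add: prod.distrib)
    qed
    also have "\<dots> = (\<Prod>i\<in>I. \<integral>\<^sup>+t. f i t * indicator (A i) t \<partial>M i)"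
      by (rule product_nn_integral_prod[OF I]) auto
    also have "\<dots> = (\<Prod>i\<in>I. emeasure (density (M i) (f i)) (A i))"
      using A by (intro prod.cong refl) (auto simp: emeasure_density)
    finally show "emeasure (density (PiM I M) (\<lambda>x. \<Prod>i\<in>I. f i (x i))) (PiE I A)
      = (\<Prod>i\<in>I. emeasure (density (M i) (f i)) (A i))" .
  qed
qed

lemma gauss_eq_density:
  "gauss n = density (lborel_n n) (\<lambda>x. ennreal (\<Prod>i<n. std_normal_density (x i)))"
proof -
  interpret product_sigma_finite "\<lambda>_::nat. lborel :: real measure" by standard
  show ?thesis
    by (subst density_PiM[of "{..<n}" "\<lambda>_ x. ennreal (std_normal_density x)", symmetric])
       (auto simp: prod_ennreal intro: prob_space_imp_sigma_finite[OF prob_space_std_normal])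
qed

lemma sets_gauss: "sets (gauss n) = sets (borel_n n)" "sets (lborel_n n) = sets (borel_n n)"
  by (auto intro!: sets_PiM_cong)

lemma measurable_gauss_iff:
  "f \<in> borel_measurable (gauss n) \<longleftrightarrow> f \<in> borel_measurable (borel_n n)"
  "f \<in> borel_measurable (lborel_n n) \<longleftrightarrow> f \<in> borel_measurable (borel_n n)"
  using measurable_cong_sets[OF sets_gauss(1) refl] measurable_cong_sets[OF sets_gauss(2) refl] by blast+

lemma gauss_integral_density:
  assumes "f \<in> borel_measurable (gauss n)"
  shows "(\<integral>x. f x \<partial>gauss n) = (\<integral>x. (\<Prod>i<n. std_normal_density (x i)) * f x \<partial>lborel_n n)"
  unfolding gauss_eq_density
  by (subst integral_density)
     (use assms in \<open>auto simp: measurable_gauss_iff prod_nonneg normal_density_nonneg\<close>)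

text \<open>The majorant |u| times the product of the \<open>Q j\<close> is integrable because both
  factors are in L2; nothing pointwise is required of \<open>u\<close>.\<close>

lemma gauss_prod_dominated_convergence:
  assumes u: "u \<in> L2_space (gauss n)"
    and Q: "\<And>j. j < n \<Longrightarrow> Q j \<in> L2_space std_normal_distribution"
    and F: "\<And>m j. j < n \<Longrightarrow> F m j \<in> borel_measurable borel"
    and le: "\<And>m j t. j < n \<Longrightarrow> \<bar>F m j t\<bar> \<le> Q j t"
    and lim: "\<And>j t. j < n \<Longrightarrow> (\<lambda>m. F m j t) \<longlonglongrightarrow> H j t"
  shows "(\<lambda>m::nat. \<integral>x. u x * (\<Prod>j<n. F m j (x j)) \<partial>gauss n) \<longlonglongrightarrow> (\<integral>x. u x * (\<Prod>j<n. H j (x j)) \<partial>gauss n)"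
proof (rule integral_dominated_convergence)
  have [measurable]: "u \<in> borel_measurable (gauss n)" using u by auto
  have Fm: "(\<lambda>x. F m j (x j)) \<in> borel_measurable (gauss n)" if "j < n" for m j
    using F[OF that] that by measurable
  have Hm: "H j \<in> borel_measurable borel" if "j < n" for j
    by (rule borel_measurable_LIMSEQ_real[OF lim[OF that]]) (use F[OF that] in auto)
  have Hm': "(\<lambda>x. H j (x j)) \<in> borel_measurable (gauss n)" if "j < n" for j
    using Hm[OF that] that by measurable
  show "integrable (gauss n) (\<lambda>x. \<bar>u x * (\<Prod>j<n. Q j (x j))\<bar>)"
    by (intro integrable_abs L2_mult_integrable u L2_gauss_prod Q)
  show "AE x in gauss n. (\<lambda>m. u x * (\<Prod>j<n. F m j (x j))) \<longlonglongrightarrow> u x * (\<Prod>j<n. H j (x j))"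
    by (rule AE_I2) (auto intro!: tendsto_intros lim)
  show "AE x in gauss n. norm (u x * (\<Prod>j<n. F m j (x j))) \<le> \<bar>u x * (\<Prod>j<n. Q j (x j))\<bar>" for m
  proof (rule AE_I2)
    fix x
    have "\<bar>\<Prod>j<n. F m j (x j)\<bar> \<le> (\<Prod>j<n. Q j (x j))"
      unfolding abs_prod by (rule prod_mono) (use le in auto)
    also have "\<dots> \<le> \<bar>\<Prod>j<n. Q j (x j)\<bar>" by simp
    finally show "norm (u x * (\<Prod>j<n. F m j (x j))) \<le> \<bar>u x * (\<Prod>j<n. Q j (x j))\<bar>"
      by (simp add: abs_mult mult_left_mono)
  qed
  show "(\<lambda>x. u x * (\<Prod>j<n. F m j (x j))) \<in> borel_measurable (gauss n)" for m
    using Fm by (intro borel_measurable_times borel_measurable_prod) auto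
  show "(\<lambda>x. u x * (\<Prod>j<n. H j (x j))) \<in> borel_measurable (gauss n)"
    using Hm' by (intro borel_measurable_times borel_measurable_prod) auto
qed

lemma bump_0_tendsto: "(\<lambda>k. bump (real (Suc k)) P 0 t) \<longlonglongrightarrow> poly P t"
proof -
  have "(\<lambda>k. poly P t * exp (1 - 1 / (1 - (t / real (Suc k))\<^sup>2))) \<longlonglongrightarrow> poly P t * 1"
  proof (intro tendsto_mult tendsto_const)
    have "(\<lambda>k. t * (1 / real (Suc k))) \<longlonglongrightarrow> 0"
      by (rule tendsto_mult_right_zero[OF lim_1_over_n[THEN LIMSEQ_Suc]])
    then have "(\<lambda>k. t / real (Suc k)) \<longlonglongrightarrow> 0" by simp
    from tendsto_exp[OF tendsto_diff[OF tendsto_const[of 1] tendsto_divide[OF tendsto_const[of 1]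
          tendsto_diff[OF tendsto_const[of 1] tendsto_power[OF this, of 2]]]]]
    show "(\<lambda>k. exp (1 - 1 / (1 - (t / real (Suc k))\<^sup>2))) \<longlonglongrightarrow> 1"
      by (simp del: of_nat_Suc)
  qed
  moreover have "\<forall>\<^sub>F k in sequentially. poly P t * exp (1 - 1 / (1 - (t / real (Suc k))\<^sup>2)) = bump (real (Suc k)) P 0 t"
  proof (rule eventually_sequentiallyI[of "nat \<lceil>\<bar>t\<bar>\<rceil>"])
    fix k assume "nat \<lceil>\<bar>t\<bar>\<rceil> \<le> k"
    then have "\<bar>t\<bar> < real (Suc k)" by linarith
    then show "poly P t * exp (1 - 1 / (1 - (t / real (Suc k))\<^sup>2)) = bump (real (Suc k)) P 0 t"
      by (simp add: bump_def)
  qed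
  ultimately show ?thesis by (simp add: Lim_transform_eventually)
qed

lemma bump_measurable [measurable]: "bump R P m \<in> borel_measurable borel"
  unfolding bump_def[abs_def] by measurable

text \<open>The density of the Gaussian is put into the test function, which turns the Lebesgue
  integrals of the weak derivative into Gaussian ones. The minus sign of the weak derivative cancels
  the one in the derivative of He_k times the density, so index i is raised.\<close>

theorem weak_gradient_hermite:
  assumes wg: "has_weak_gradient n u g" and i: "i < n"
    and u: "u \<in> L2_space (gauss n)" and gi: "(\<lambda>x. g x i) \<in> L2_space (gauss n)"
  shows "hermite_inner n (\<lambda>x. g x i) \<alpha> = hermite_inner n u (\<alpha>(i := Suc (\<alpha> i)))"
proof -
  \<comment> \<open>Radii of at least 1, so that the error of order 1 / R^2 is also at most of order
    1 / R and stays below a fixed majorant.\<close>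
  define R where "R = (\<lambda>k::nat. real (Suc k))"
  have R: "R k > 0" "R k \<ge> 1" for k by (auto simp: R_def)
  define F where "F = (\<lambda>k j. bump (R k) (hermite (\<alpha> j)) 0)"
  define D where "D = (\<lambda>k j t. if j = i then - bump (R k) (hermite (Suc (\<alpha> i))) 0 t
     + bump (R k) (smult (- 2 / (R k)\<^sup>2) ([:0,1:] * hermite (\<alpha> i))) 2 t else F k j t)"
  define \<phi> where "\<phi> = (\<lambda>k (x :: rvec). \<Prod>j<n. gauss_bump (R k) (hermite (\<alpha> j)) 0 (x j))"
  have \<phi>: "\<phi> k \<in> test_functions n" for k
    unfolding \<phi>_def by (rule prod_test_function[where R = "R k"])
      (rule C_line_gauss_bump[OF R(1)], simp add: gauss_bump_def bump_def)
  have \<phi>_eq: "\<phi> k x = (\<Prod>j<n. std_normal_density (x j)) * (\<Prod>j<n. F k j (x j))" for k x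
    by (simp add: \<phi>_def F_def gauss_bump_def prod.distrib)
  have d\<phi>: "partial i (\<phi> k) x = (\<Prod>j<n. std_normal_density (x j)) * (\<Prod>j<n. D k j (x j))" for k x
  proof -
    have "partial i (\<phi> k) x = (\<Prod>j<n. ((\<lambda>j. gauss_bump (R k) (hermite (\<alpha> j)) 0)
       (i := deriv (gauss_bump (R k) (hermite (\<alpha> i)) 0))) j (x j))"
      unfolding \<phi>_def by (subst partial_prod(2)[OF i C_line_deriv(2)[OF C_line_gauss_bump[OF R(1)]]]) simp
    also have "\<dots> = (\<Prod>j<n. std_normal_density (x j) * D k j (x j))"
      by (rule prod.cong) (auto simp: D_def F_def deriv_gauss_bump_hermite[OF R(1)] gauss_bump_def)
    finally show ?thesis by (simp add: prod.distrib)
  qed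
  have um: "u \<in> borel_measurable (gauss n)" "(\<lambda>x. g x i) \<in> borel_measurable (gauss n)"
    using u gi by auto
  have Fm: "(\<lambda>x. \<Prod>j<n. F k j (x j)) \<in> borel_measurable (gauss n)" for k
    unfolding F_def by (intro borel_measurable_prod) measurable
  have Dm1: "D k j \<in> borel_measurable borel" for k j unfolding D_def F_def by measurable
  then have Dm: "(\<lambda>x. \<Prod>j<n. D k j (x j)) \<in> borel_measurable (gauss n)" for k
    by (intro borel_measurable_prod measurable_compose[OF measurable_gauss_component]) auto
  have eq: "(\<integral>x. u x * (\<Prod>j<n. D k j (x j)) \<partial>gauss n) = - (\<integral>x. g x i * (\<Prod>j<n. F k j (x j)) \<partial>gauss n)" for k
  proof -
    have "(\<integral>x. u x * (\<Prod>j<n. D k j (x j)) \<partial>gauss n) = (\<integral>x. u x * partial i (\<phi> k) x \<partial>lborel_n n)"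
      unfolding d\<phi> by (subst gauss_integral_density) (auto intro!: borel_measurable_times um Dm simp: mult_ac)
    also have "\<dots> = - (\<integral>x. g x i * \<phi> k x \<partial>lborel_n n)"
      using wg i \<phi>[of k] unfolding has_weak_gradient_def by blast
    also have "(\<integral>x. g x i * \<phi> k x \<partial>lborel_n n) = (\<integral>x. g x i * (\<Prod>j<n. F k j (x j)) \<partial>gauss n)"
      unfolding \<phi>_eq by (subst gauss_integral_density) (auto intro!: borel_measurable_times um Fm simp: mult_ac)
    finally show ?thesis .
  qed
  define Q where "Q = (\<lambda>j t. \<bar>poly (hermite (\<alpha> j)) t\<bar>)"
  \<comment> \<open>The constant 12 is 3 * 2! from the bound on a bump of exponent 2, times the
    coefficient 2 of the cutoff error.\<close>
  define Q' where "Q' = (\<lambda>j t. if j = i then \<bar>poly (hermite (Suc (\<alpha> i))) t\<bar> + 12 * \<bar>t * poly (hermite (\<alpha> i)) t\<bar> else Q j t)"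
  have L2abs: "(\<lambda>t. \<bar>poly p t\<bar>) \<in> L2_space std_normal_distribution" for p
    by (rule L2_dominated[OF L2_std_normal_poly[of p]]) auto
  have Q: "Q j \<in> L2_space std_normal_distribution" for j
    unfolding Q_def by (rule L2abs)
  have Q': "Q' j \<in> L2_space std_normal_distribution" for j
  proof (cases "j = i")
    case True
    have "(\<lambda>t. \<bar>poly (hermite (Suc (\<alpha> i))) t\<bar> + 12 * \<bar>poly ([:0,1:] * hermite (\<alpha> i)) t\<bar>) \<in> L2_space std_normal_distribution"
      by (intro L2_add L2_scale L2abs)
    then show ?thesis using True by (simp add: Q'_def abs_mult)
  next
    case False
    then show ?thesis using Q[of j] by (simp add: Q'_def[abs_def] Q_def)
  qed
  have smul: "\<bar>bump (R k) (smult (- 2 / (R k)\<^sup>2) ([:0,1:] * hermite (\<alpha> i))) 2 t\<bar>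
     \<le> 12 * \<bar>t * poly (hermite (\<alpha> i)) t\<bar> * (1 / R k)" for k t
  proof -
    have "\<bar>bump (R k) (smult (- 2 / (R k)\<^sup>2) ([:0,1:] * hermite (\<alpha> i))) 2 t\<bar>
      \<le> 3 * fact 2 * \<bar>poly (smult (- 2 / (R k)\<^sup>2) ([:0,1:] * hermite (\<alpha> i))) t\<bar>" by (rule abs_bump_le)
    also have "\<dots> = 12 * \<bar>t * poly (hermite (\<alpha> i)) t\<bar> * (1 / (R k)\<^sup>2)"
      by (simp add: abs_mult fact_numeral)
    also have "\<dots> \<le> 12 * \<bar>t * poly (hermite (\<alpha> i)) t\<bar> * (1 / R k)"
      using R[of k] by (intro mult_left_mono) (auto simp: divide_simps power2_eq_square)
    finally show ?thesis .
  qed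
  have lim1: "(\<lambda>k. \<integral>x. g x i * (\<Prod>j<n. F k j (x j)) \<partial>gauss n) \<longlonglongrightarrow> (\<integral>x. g x i * (\<Prod>j<n. poly (hermite (\<alpha> j)) (x j)) \<partial>gauss n)"
    by (rule gauss_prod_dominated_convergence[where Q = Q, OF gi Q])
       (auto simp: F_def Q_def abs_bump_0_le R_def simp del: of_nat_Suc intro: bump_0_tendsto)
  define H where "H = (\<lambda>j t. if j = i then - poly (hermite (Suc (\<alpha> i))) t else poly (hermite (\<alpha> j)) t)"
  have lim2: "(\<lambda>k. \<integral>x. u x * (\<Prod>j<n. D k j (x j)) \<partial>gauss n) \<longlonglongrightarrow> (\<integral>x. u x * (\<Prod>j<n. H j (x j)) \<partial>gauss n)"
  proof (rule gauss_prod_dominated_convergence[OF u Q' Dm1])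
    fix k j t
    have "1 / R k \<le> 1" using R[of k] by simp
    from mult_left_mono[OF this, of "12 * \<bar>t * poly (hermite (\<alpha> i)) t\<bar>"]
    have i: "\<bar>- bump (R k) (hermite (Suc (\<alpha> i))) 0 t
       + bump (R k) (smult (- 2 / (R k)\<^sup>2) ([:0,1:] * hermite (\<alpha> i))) 2 t\<bar>
      \<le> \<bar>poly (hermite (Suc (\<alpha> i))) t\<bar> + 12 * \<bar>t * poly (hermite (\<alpha> i)) t\<bar>"
      using smul[of k t] abs_bump_0_le[of "R k" "hermite (Suc (\<alpha> i))" t] by linarith
    show "\<bar>D k j t\<bar> \<le> Q' j t"
      using i abs_bump_0_le[of "R k" "hermite (\<alpha> j)" t] unfolding D_def Q'_def Q_def F_def
      by (cases "j = i") (simp_all only: if_True if_False refl)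
  next
    fix j t
    have z: "(\<lambda>k. bump (R k) (smult (- 2 / (R k)\<^sup>2) ([:0,1:] * hermite (\<alpha> i))) 2 t) \<longlonglongrightarrow> 0"
    proof (rule Lim_null_comparison[OF always_eventually])
      show "\<forall>k. norm (bump (R k) (smult (- 2 / (R k)\<^sup>2) ([:0,1:] * hermite (\<alpha> i))) 2 t)
        \<le> 12 * \<bar>t * poly (hermite (\<alpha> i)) t\<bar> * (1 / R k)" using smul by auto
      show "(\<lambda>k. 12 * \<bar>t * poly (hermite (\<alpha> i)) t\<bar> * (1 / R k)) \<longlonglongrightarrow> 0"
        unfolding R_def by (rule tendsto_mult_right_zero[OF lim_1_over_n[THEN LIMSEQ_Suc]])
    qed
    have b: "(\<lambda>k. bump (R k) p 0 t) \<longlonglongrightarrow> poly p t" for p unfolding R_def by (rule bump_0_tendsto)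
    show "(\<lambda>k. D k j t) \<longlonglongrightarrow> H j t"
      using tendsto_add[OF tendsto_minus[OF b[of "hermite (Suc (\<alpha> i))"]] z] b[of "hermite (\<alpha> j)"]
      unfolding D_def H_def F_def add_0_right by (cases "j = i") (simp_all only: if_True if_False refl)
  qed
  have "(\<integral>x. u x * (\<Prod>j<n. H j (x j)) \<partial>gauss n) = - (\<integral>x. g x i * (\<Prod>j<n. poly (hermite (\<alpha> j)) (x j)) \<partial>gauss n)"
    by (rule LIMSEQ_unique[OF lim2]) (unfold eq, rule tendsto_minus[OF lim1])
  moreover have "(\<Prod>j<n. H j (x j)) = - hermite_prod n (\<alpha>(i := Suc (\<alpha> i))) x" for x
  proof -
    have "(\<Prod>j<n. H j (x j)) = H i (x i) * (\<Prod>j\<in>{..<n} - {i}. H j (x j))"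
      using i by (subst prod.remove[of _ i]) auto
    also have "\<dots> = - (poly (hermite (Suc (\<alpha> i))) (x i) * (\<Prod>j\<in>{..<n} - {i}. poly (hermite (\<alpha> j)) (x j)))"
      by (simp add: H_def del: hermite.simps)
    also have "\<dots> = - hermite_prod n (\<alpha>(i := Suc (\<alpha> i))) x"
      unfolding hermite_prod_def using i
      by (subst (2) prod.remove[of _ i]) (auto simp del: hermite.simps)
    finally show ?thesis .
  qed
  ultimately show ?thesis unfolding hermite_inner_def hermite_prod_def[of n \<alpha>] by simp
qed

section \<open>Gaussian Sobolev functions\<close>


text \<open>Weak differentiability is only used through its effect on Hermite coefficients: \<open>g i\<close> acts as the
  \<open>i\<close>-th partial derivative of \<open>u\<close> when its coefficients are those of \<open>u\<close> with the \<open>i\<close>-th index raised.\<close>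

definition gauss_W12 :: "nat \<Rightarrow> (rvec \<Rightarrow> real) \<Rightarrow> (nat \<Rightarrow> rvec \<Rightarrow> real) \<Rightarrow> bool" where
  "gauss_W12 n u g \<longleftrightarrow> u \<in> L2_space (gauss n) \<and> (\<forall>i<n. g i \<in> L2_space (gauss n)) \<and>
     (\<forall>i<n. \<forall>\<alpha>\<in>idx n. hermite_inner n (g i) \<alpha> = hermite_inner n u (\<alpha>(i := Suc (\<alpha> i))))"

lemma gauss_W12D:
  assumes "gauss_W12 n u g"
  shows "u \<in> L2_space (gauss n)" "i < n \<Longrightarrow> g i \<in> L2_space (gauss n)"
    "i < n \<Longrightarrow> \<alpha> \<in> idx n \<Longrightarrow> hermite_inner n (g i) \<alpha> = hermite_inner n u (\<alpha>(i := Suc (\<alpha> i)))"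
  using assms by (auto simp: gauss_W12_def)

lemma hermite_inner_add:
  assumes "u \<in> L2_space (gauss n)" "v \<in> L2_space (gauss n)"
  shows "hermite_inner n (\<lambda>x. u x + v x) \<alpha> = hermite_inner n u \<alpha> + hermite_inner n v \<alpha>"
  unfolding hermite_inner_def distrib_right using assms
  by (simp add: L2_mult_integrable L2_hermite_prod)

lemma gauss_W12_add:
  assumes "gauss_W12 n u g" "gauss_W12 n v h"
  shows "gauss_W12 n (\<lambda>x. u x + v x) (\<lambda>i x. g i x + h i x)"
  using assms unfolding gauss_W12_def by (simp add: L2_add hermite_inner_add)

definition idx0 :: "nat \<Rightarrow> nat \<Rightarrow> nat" where
  "idx0 n = (\<lambda>i\<in>{..<n}. 0)"

lemma idx0: "idx0 n \<in> idx n" "i < n \<Longrightarrow> idx0 n i = 0"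
  by (auto simp: idx0_def)

lemma hermite_prod_idx0: "hermite_prod n (idx0 n) x = 1"
  by (simp add: hermite_prod_def idx0)

lemma hermite_prod_unit: "k < n \<Longrightarrow> hermite_prod n ((idx0 n)(k := Suc 0)) x = x k"
  unfolding hermite_prod_def by (subst prod.remove[of _ k]) (auto simp: idx0 pderiv_1)

lemma L2_gauss_coord: "k < n \<Longrightarrow> (\<lambda>x. x k) \<in> L2_space (gauss n)"
proof -
  assume "k < n"
  then have "hermite_prod n ((idx0 n)(k := Suc 0)) = (\<lambda>x. x k)" by (simp add: fun_eq_iff hermite_prod_unit)
  then show ?thesis using L2_hermite_prod[of n "(idx0 n)(k := Suc 0)"] by simp
qed

text \<open>Here the coefficients are explicit: 1 and x_k are the Hermite products of the zero index
  and of the k-th unit index, so lowering a raised index decides every inner product.\<close>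

lemma gauss_W12_affine: "gauss_W12 n (\<lambda>x. c + (\<Sum>k<n. b k * x k)) (\<lambda>i x. b i)"
  unfolding gauss_W12_def
proof (intro conjI allI ballI impI)
  show "(\<lambda>x. c + (\<Sum>k<n. b k * x k)) \<in> L2_space (gauss n)"
    by (intro L2_add gauss.L2_const L2_sum L2_scale L2_gauss_coord) simp
  show "(\<lambda>x. b i) \<in> L2_space (gauss n)" for i by (rule gauss.L2_const)
  fix i \<alpha> assume i: "i < n" and \<alpha>: "\<alpha> \<in> idx n"
  let ?\<alpha> = "\<alpha>(i := Suc (\<alpha> i))"
  have 0: "(\<integral>x. hermite_prod n ?\<alpha> x \<partial>gauss n) = 0"
    using hermite_prod_lower[OF idx0(1)[of n] \<alpha> i] i by (simp add: hermite_prod_idx0 idx0)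
  have 1: "(\<integral>x. hermite_prod n ?\<alpha> x * x k \<partial>gauss n) = (if i = k then \<integral>x. hermite_prod n \<alpha> x \<partial>gauss n else 0)"
    if "k < n" for k
  proof -
    have "(idx0 n)(i := 0) = idx0 n" using i by (auto simp: idx0 fun_eq_iff)
    then show ?thesis
      using hermite_prod_lower[OF idx_upd[OF that idx0(1)] \<alpha> i, of "Suc 0"] i that
      by (auto simp: hermite_prod_idx0 idx0 hermite_prod_unit)
  qed
  have "hermite_inner n (\<lambda>x. c + (\<Sum>k<n. b k * x k)) ?\<alpha>
     = (\<integral>x. c * hermite_prod n ?\<alpha> x + (\<Sum>k<n. b k * (hermite_prod n ?\<alpha> x * x k)) \<partial>gauss n)"
  proof -
    have "(c + (\<Sum>k<n. b k * x k)) * h = c * h + (\<Sum>k<n. b k * (h * x k))" for x :: rvec and h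
      by (subst distrib_right, subst sum_distrib_right) (simp add: mult_ac)
    then show ?thesis unfolding hermite_inner_def by simp
  qed
  also have "\<dots> = c * (\<integral>x. hermite_prod n ?\<alpha> x \<partial>gauss n) + (\<Sum>k<n. b k * (\<integral>x. hermite_prod n ?\<alpha> x * x k \<partial>gauss n))"
  proof -
    have i1: "integrable (gauss n) (\<lambda>x. c * hermite_prod n ?\<alpha> x)"
      by (intro integrable_mult_right) (simp add: gauss.L2_integrable[OF L2_hermite_prod])
    have i2: "integrable (gauss n) (\<lambda>x. b k * (hermite_prod n ?\<alpha> x * x k))" if "k \<in> {..<n}" for k
      using that by (intro integrable_mult_right L2_mult_integrable L2_hermite_prod L2_gauss_coord) simp
    have i3: "integrable (gauss n) (\<lambda>x. \<Sum>k<n. b k * (hermite_prod n ?\<alpha> x * x k))"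
      by (rule Bochner_Integration.integrable_sum) (rule i2)
    have "(\<integral>x. (\<Sum>k<n. b k * (hermite_prod n ?\<alpha> x * x k)) \<partial>gauss n)
       = (\<Sum>k<n. \<integral>x. b k * (hermite_prod n ?\<alpha> x * x k) \<partial>gauss n)"
      by (rule Bochner_Integration.integral_sum) (rule i2)
    with Bochner_Integration.integral_add[OF i1 i3] show ?thesis by simp
  qed
  also have "(\<Sum>k<n. b k * (\<integral>x. hermite_prod n ?\<alpha> x * x k \<partial>gauss n))
     = (\<Sum>k<n. if i = k then b k * (\<integral>x. hermite_prod n \<alpha> x \<partial>gauss n) else 0)"
    by (rule sum.cong) (auto simp: 1)
  finally have F: "hermite_inner n (\<lambda>x. c + (\<Sum>k<n. b k * x k)) ?\<alpha> = c * (\<integral>x. hermite_prod n ?\<alpha> x \<partial>gauss n)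
     + (\<Sum>k<n. if i = k then b k * (\<integral>x. hermite_prod n \<alpha> x \<partial>gauss n) else 0)" .
  show "hermite_inner n (\<lambda>x. b i) \<alpha> = hermite_inner n (\<lambda>x. c + (\<Sum>k<n. b k * x k)) ?\<alpha>"
    unfolding F 0 using i by (simp add: hermite_inner_def)
qed

section \<open>Differentiation of Hermite sums, its adjoint and their commutation relation\<close>

definition hermite_comb_deriv :: "nat \<Rightarrow> nat \<Rightarrow> (nat \<Rightarrow> nat) set \<Rightarrow> ((nat \<Rightarrow> nat) \<Rightarrow> real) \<Rightarrow> rvec \<Rightarrow> real" where
  "hermite_comb_deriv n i B c x = (\<Sum>\<alpha>\<in>B. c \<alpha> * (\<alpha> i * hermite_prod n (\<alpha>(i := \<alpha> i - 1)) x))"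

lemma L2_hermite_comb_deriv: "hermite_comb_deriv n i B c \<in> L2_space (gauss n)"
  unfolding hermite_comb_deriv_def[abs_def] by (intro L2_sum L2_scale L2_hermite_prod)

text \<open>The three-term recurrence in coordinate i. The left side is the Gaussian adjoint of the
  i-th derivative applied to a Hermite product.\<close>

lemma hermite_prod_raise:
  assumes "i < n"
  shows "x i * hermite_prod n \<alpha> x - \<alpha> i * hermite_prod n (\<alpha>(i := \<alpha> i - 1)) x
    = hermite_prod n (\<alpha>(i := Suc (\<alpha> i))) x"
proof -
  have split: "hermite_prod n (\<alpha>(i := k)) x = poly (hermite k) (x i) * (\<Prod>j\<in>{..<n} - {i}. poly (hermite (\<alpha> j)) (x j))" for k
    unfolding hermite_prod_def using assms by (subst prod.remove[of _ i]) auto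
  have base: "hermite_prod n \<alpha> x = poly (hermite (\<alpha> i)) (x i) * (\<Prod>j\<in>{..<n} - {i}. poly (hermite (\<alpha> j)) (x j))"
    using split[of "\<alpha> i"] by simp
  show ?thesis
    unfolding split base by (simp add: pderiv_hermite algebra_simps)
qed

lemma hermite_comb_delta:
  assumes "i < n"
  shows "x i * hermite_comb n B c x - hermite_comb_deriv n i B c x
    = (\<Sum>\<alpha>\<in>B. c \<alpha> * hermite_prod n (\<alpha>(i := Suc (\<alpha> i))) x)"
  unfolding hermite_comb_def hermite_comb_deriv_def hermite_prod_raise[OF assms, symmetric]
  by (simp add: sum_distrib_left sum_subtractf right_diff_distrib mult_ac)

text \<open>The canonical commutation relation on basis elements. Write d for derivatives and D for
  their adjoints; since d_j D_i = D_i d_j, plus the identity if i = j, the product <D_i u, D_j v>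
  becomes <d_j u, d_i v> plus <u, v> if i = j. For i = j the raised index gives the factor \<beta> j
  + 1, whose 1 is the extra term.\<close>

lemma hermite_prod_commutation:
  assumes \<alpha>: "\<alpha> \<in> idx n" and \<beta>: "\<beta> \<in> idx n" and i: "i < n" and j: "j < n"
  shows "(\<integral>x. hermite_prod n (\<alpha>(i := Suc (\<alpha> i))) x * hermite_prod n (\<beta>(j := Suc (\<beta> j))) x \<partial>gauss n)
    = (if i = j then \<integral>x. hermite_prod n \<alpha> x * hermite_prod n \<beta> x \<partial>gauss n else 0)
      + \<alpha> j * (\<beta> i * (\<integral>x. hermite_prod n (\<alpha>(j := \<alpha> j - 1)) x * hermite_prod n (\<beta>(i := \<beta> i - 1)) x \<partial>gauss n))"
proof -
  define I where "I = (\<lambda>\<alpha> \<beta>. \<integral>x. hermite_prod n \<alpha> x * hermite_prod n \<beta> x \<partial>gauss n)"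
  have sym: "I \<alpha> \<beta> = I \<beta> \<alpha>" for \<alpha> \<beta> unfolding I_def by (simp add: mult.commute)
  have low: "I (\<beta>(j := Suc (\<beta> j))) \<alpha> = \<alpha> j * I \<beta> (\<alpha>(j := \<alpha> j - 1))" if "\<alpha> \<in> idx n" "\<beta> \<in> idx n" "j < n" for \<alpha> \<beta> j
    unfolding I_def by (rule hermite_prod_lower[OF that])
  have 1: "I (\<alpha>(i := Suc (\<alpha> i))) (\<beta>(j := Suc (\<beta> j)))
     = (\<beta>(j := Suc (\<beta> j))) i * I \<alpha> ((\<beta>(j := Suc (\<beta> j)))(i := (\<beta>(j := Suc (\<beta> j))) i - 1))"
    by (rule low[OF idx_upd[OF j \<beta>] \<alpha> i])
  have "I (\<alpha>(i := Suc (\<alpha> i))) (\<beta>(j := Suc (\<beta> j)))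
    = (if i = j then I \<alpha> \<beta> else 0) + \<alpha> j * (\<beta> i * I (\<alpha>(j := \<alpha> j - 1)) (\<beta>(i := \<beta> i - 1)))"
  proof (cases "i = j")
    case True
    have "\<beta> j * I \<alpha> \<beta> = \<alpha> j * (\<beta> j * I (\<alpha>(j := \<alpha> j - 1)) (\<beta>(j := \<beta> j - 1)))"
    proof (cases "\<beta> j")
      case (Suc k)
      then have "\<beta> = (\<beta>(j := k))(j := Suc ((\<beta>(j := k)) j))" by auto
      then have "I \<beta> \<alpha> = \<alpha> j * I (\<beta>(j := k)) (\<alpha>(j := \<alpha> j - 1))"
        using low[OF \<alpha> idx_upd[OF j \<beta>] j, of k] by simp
      then show ?thesis using Suc sym by simp
    qed simp
    then show ?thesis using 1 True by (simp add: algebra_simps)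
  next
    case False
    \<comment> \<open>Updates at different coordinates commute, so a second lowering, now in
      coordinate j, applies.\<close>
    have "(\<beta>(j := Suc (\<beta> j)))(i := \<beta> i - 1) = (\<beta>(i := \<beta> i - 1))(j := Suc ((\<beta>(i := \<beta> i - 1)) j))"
      using False by auto
    then have "I \<alpha> ((\<beta>(j := Suc (\<beta> j)))(i := \<beta> i - 1)) = \<alpha> j * I (\<beta>(i := \<beta> i - 1)) (\<alpha>(j := \<alpha> j - 1))"
      using low[OF \<alpha> idx_upd[OF i \<beta>] j, of "\<beta> i - 1"] sym by metis
    then show ?thesis using 1 False sym[of "\<beta>(i := \<beta> i - 1)"] by simp
  qed
  then show ?thesis by (simp add: I_def)
qed

lemma L2_sum_inner:
  assumes "\<And>a. a \<in> B \<Longrightarrow> F a \<in> L2_space M" "\<And>b. b \<in> B' \<Longrightarrow> G b \<in> L2_space M"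
  shows "(\<integral>x. (\<Sum>a\<in>B. c a * F a x) * (\<Sum>b\<in>B'. d b * G b x) \<partial>M)
    = (\<Sum>a\<in>B. \<Sum>b\<in>B'. c a * d b * (\<integral>x. F a x * G b x \<partial>M))"
proof -
  have "(\<integral>x. (\<Sum>a\<in>B. c a * F a x) * (\<Sum>b\<in>B'. d b * G b x) \<partial>M)
    = (\<integral>x. (\<Sum>a\<in>B. \<Sum>b\<in>B'. c a * d b * (F a x * G b x)) \<partial>M)"
    by (simp add: sum_product mult_ac)
  also have "\<dots> = (\<Sum>a\<in>B. \<integral>x. (\<Sum>b\<in>B'. c a * d b * (F a x * G b x)) \<partial>M)"
    using assms by (intro Bochner_Integration.integral_sum Bochner_Integration.integrable_sum
        integrable_mult_right L2_mult_integrable)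
  also have "\<dots> = (\<Sum>a\<in>B. \<Sum>b\<in>B'. c a * d b * (\<integral>x. F a x * G b x \<partial>M))"
    using assms by (intro sum.cong refl) (subst Bochner_Integration.integral_sum, auto intro!: L2_mult_integrable)
  finally show ?thesis .
qed

lemma L2_hermite_delta: "i < n \<Longrightarrow> (\<lambda>x. x i * hermite_comb n B c x - hermite_comb_deriv n i B c x) \<in> L2_space (gauss n)"
  unfolding hermite_comb_delta by (intro L2_sum L2_scale L2_hermite_prod)

lemma hermite_delta_inner:
  assumes B: "B \<subseteq> idx n" "B' \<subseteq> idx n" and i: "i < n" and j: "j < n"
  shows "(\<integral>x. (x i * hermite_comb n B c x - hermite_comb_deriv n i B c x)
       * (x j * hermite_comb n B' d x - hermite_comb_deriv n j B' d x) \<partial>gauss n)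
    = (if i = j then \<integral>x. hermite_comb n B c x * hermite_comb n B' d x \<partial>gauss n else 0)
      + (\<integral>x. hermite_comb_deriv n j B c x * hermite_comb_deriv n i B' d x \<partial>gauss n)"
proof -
  have L: "(\<lambda>x. real k * hermite_prod n \<alpha> x) \<in> L2_space (gauss n)" for k \<alpha>
    by (intro L2_scale L2_hermite_prod)
  have "(\<integral>x. (x i * hermite_comb n B c x - hermite_comb_deriv n i B c x)
       * (x j * hermite_comb n B' d x - hermite_comb_deriv n j B' d x) \<partial>gauss n)
    = (\<Sum>\<alpha>\<in>B. \<Sum>\<beta>\<in>B'. c \<alpha> * d \<beta> * (\<integral>x. hermite_prod n (\<alpha>(i := Suc (\<alpha> i))) x * hermite_prod n (\<beta>(j := Suc (\<beta> j))) x \<partial>gauss n))"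
    unfolding hermite_comb_delta[OF i] hermite_comb_delta[OF j] by (rule L2_sum_inner) (rule L2_hermite_prod)+
  also have "\<dots> = (\<Sum>\<alpha>\<in>B. \<Sum>\<beta>\<in>B'. c \<alpha> * d \<beta> *
     ((if i = j then \<integral>x. hermite_prod n \<alpha> x * hermite_prod n \<beta> x \<partial>gauss n else 0)
      + (\<integral>x. (\<alpha> j * hermite_prod n (\<alpha>(j := \<alpha> j - 1)) x) * (\<beta> i * hermite_prod n (\<beta>(i := \<beta> i - 1)) x) \<partial>gauss n)))"
  proof (intro sum.cong refl arg_cong2[where f = "(*)"])
    fix \<alpha> \<beta> assume "\<alpha> \<in> B" "\<beta> \<in> B'"
    then have "\<alpha> \<in> idx n" "\<beta> \<in> idx n" using B by auto
    have "(\<integral>x. (\<alpha> j * hermite_prod n (\<alpha>(j := \<alpha> j - 1)) x) * (\<beta> i * hermite_prod n (\<beta>(i := \<beta> i - 1)) x) \<partial>gauss n)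
      = (\<integral>x. (\<alpha> j * \<beta> i) * (hermite_prod n (\<alpha>(j := \<alpha> j - 1)) x * hermite_prod n (\<beta>(i := \<beta> i - 1)) x) \<partial>gauss n)"
      by (simp add: mult_ac)
    then show "(\<integral>x. hermite_prod n (\<alpha>(i := Suc (\<alpha> i))) x * hermite_prod n (\<beta>(j := Suc (\<beta> j))) x \<partial>gauss n)
      = (if i = j then \<integral>x. hermite_prod n \<alpha> x * hermite_prod n \<beta> x \<partial>gauss n else 0)
      + (\<integral>x. (\<alpha> j * hermite_prod n (\<alpha>(j := \<alpha> j - 1)) x) * (\<beta> i * hermite_prod n (\<beta>(i := \<beta> i - 1)) x) \<partial>gauss n)"
      unfolding hermite_prod_commutation[OF \<open>\<alpha> \<in> idx n\<close> \<open>\<beta> \<in> idx n\<close> i j] by simp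
  qed
  also have "\<dots> = (if i = j then \<Sum>\<alpha>\<in>B. \<Sum>\<beta>\<in>B'. c \<alpha> * d \<beta> * (\<integral>x. hermite_prod n \<alpha> x * hermite_prod n \<beta> x \<partial>gauss n) else 0)
     + (\<Sum>\<alpha>\<in>B. \<Sum>\<beta>\<in>B'. c \<alpha> * d \<beta> *
         (\<integral>x. (\<alpha> j * hermite_prod n (\<alpha>(j := \<alpha> j - 1)) x) * (\<beta> i * hermite_prod n (\<beta>(i := \<beta> i - 1)) x) \<partial>gauss n))"
    by (simp add: distrib_left sum.distrib)
  also have "(\<Sum>\<alpha>\<in>B. \<Sum>\<beta>\<in>B'. c \<alpha> * d \<beta> *
         (\<integral>x. (\<alpha> j * hermite_prod n (\<alpha>(j := \<alpha> j - 1)) x) * (\<beta> i * hermite_prod n (\<beta>(i := \<beta> i - 1)) x) \<partial>gauss n))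
     = (\<integral>x. hermite_comb_deriv n j B c x * hermite_comb_deriv n i B' d x \<partial>gauss n)"
    unfolding hermite_comb_deriv_def by (rule L2_sum_inner[symmetric]) (rule L)+
  also have "(\<Sum>\<alpha>\<in>B. \<Sum>\<beta>\<in>B'. c \<alpha> * d \<beta> * (\<integral>x. hermite_prod n \<alpha> x * hermite_prod n \<beta> x \<partial>gauss n))
     = (\<integral>x. hermite_comb n B c x * hermite_comb n B' d x \<partial>gauss n)"
    unfolding hermite_comb_def by (rule L2_sum_inner[symmetric]) (rule L2_hermite_prod)+
  finally show ?thesis .
qed

text \<open>The indices that survive when a sum over \<open>B\<close> is differentiated in
  coordinate i: those whose raised index lies in \<open>B\<close>.\<close>

definition idx_lower :: "nat \<Rightarrow> nat \<Rightarrow> (nat \<Rightarrow> nat) set \<Rightarrow> (nat \<Rightarrow> nat) set" where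
  "idx_lower n i B = {\<beta> \<in> idx n. \<beta>(i := Suc (\<beta> i)) \<in> B}"

lemma idx_lower_reindex:
  fixes F :: "(nat \<Rightarrow> nat) \<Rightarrow> real"
  assumes B: "finite B" "B \<subseteq> idx n" and i: "i < n"
  shows "finite (idx_lower n i B)"
    "(\<Sum>\<alpha>\<in>B. if \<alpha> i = 0 then 0 else F (\<alpha>(i := \<alpha> i - 1))) = (\<Sum>\<beta>\<in>idx_lower n i B. F \<beta>)"
proof -
  have eq: "idx_lower n i B = (\<lambda>\<alpha>. \<alpha>(i := \<alpha> i - 1)) ` {\<alpha> \<in> B. \<alpha> i \<noteq> 0}"
  proof (intro equalityI subsetI)
    fix \<beta> assume "\<beta> \<in> idx_lower n i B"
    then show "\<beta> \<in> (\<lambda>\<alpha>. \<alpha>(i := \<alpha> i - 1)) ` {\<alpha> \<in> B. \<alpha> i \<noteq> 0}"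
      by (intro image_eqI[of _ _ "\<beta>(i := Suc (\<beta> i))"]) (simp_all add: idx_lower_def)
  next
    fix \<beta> assume "\<beta> \<in> (\<lambda>\<alpha>. \<alpha>(i := \<alpha> i - 1)) ` {\<alpha> \<in> B. \<alpha> i \<noteq> 0}"
    then obtain \<alpha> where \<alpha>: "\<alpha> \<in> B" "\<alpha> i \<noteq> 0" "\<beta> = \<alpha>(i := \<alpha> i - 1)" by auto
    have "\<beta> \<in> idx n" unfolding \<alpha>(3) using idx_upd[OF i] \<alpha>(1) B by blast
    moreover have "\<beta>(i := Suc (\<beta> i)) = \<alpha>" unfolding \<alpha>(3) using \<alpha>(2) by auto
    ultimately show "\<beta> \<in> idx_lower n i B" using \<alpha>(1) by (simp add: idx_lower_def)
  qed
  have inj: "inj_on (\<lambda>\<alpha>. \<alpha>(i := \<alpha> i - 1)) {\<alpha> \<in> B. \<alpha> i \<noteq> 0}"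
  proof (rule inj_onI)
    fix \<alpha> \<beta> assume a: "\<alpha> \<in> {\<alpha> \<in> B. \<alpha> i \<noteq> 0}" "\<beta> \<in> {\<alpha> \<in> B. \<alpha> i \<noteq> 0}" "\<alpha>(i := \<alpha> i - 1) = \<beta>(i := \<beta> i - 1)"
    then have "\<alpha> i - 1 = \<beta> i - 1" by (metis fun_upd_same)
    moreover have "\<alpha> i \<noteq> 0" "\<beta> i \<noteq> 0" using a(1,2) by simp_all
    ultimately have "\<alpha> i = \<beta> i" by linarith
    then show "\<alpha> = \<beta>" using a(3) by (metis fun_upd_triv fun_upd_upd)
  qed
  show "finite (idx_lower n i B)" unfolding eq using B by simp
  have "(\<Sum>\<alpha>\<in>B. if \<alpha> i = 0 then 0 else F (\<alpha>(i := \<alpha> i - 1))) = (\<Sum>\<alpha>\<in>{\<alpha> \<in> B. \<alpha> i \<noteq> 0}. F (\<alpha>(i := \<alpha> i - 1)))"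
    using B(1) by (subst sum.inter_filter) (auto intro!: sum.cong)
  also have "\<dots> = (\<Sum>\<beta>\<in>idx_lower n i B. F \<beta>)"
    unfolding eq by (subst sum.reindex[OF inj]) simp
  finally show "(\<Sum>\<alpha>\<in>B. if \<alpha> i = 0 then 0 else F (\<alpha>(i := \<alpha> i - 1))) = (\<Sum>\<beta>\<in>idx_lower n i B. F \<beta>)" .
qed

lemma idx_fact_lower:
  assumes "i < n" "\<alpha> i \<noteq> 0"
  shows "idx_fact n \<alpha> = \<alpha> i * idx_fact n (\<alpha>(i := \<alpha> i - 1))"
  using idx_fact_upd[OF assms(1), of "\<alpha>(i := \<alpha> i - 1)"] assms(2) by (simp add: Suc_diff_1)

text \<open>Differentiation intertwines projections: differentiating the projection of
  \<open>u\<close> onto \<open>B\<close> gives the projection of \<open>g i\<close> onto the lowered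
  index set. The factor \<alpha> i cancels in \<alpha>! = \<alpha> i * (\<alpha> - e_i)!.\<close>

lemma hermite_proj_deriv:
  assumes W: "gauss_W12 n u g" and B: "finite B" "B \<subseteq> idx n" and i: "i < n"
  shows "hermite_comb_deriv n i B (\<lambda>\<alpha>. hermite_inner n u \<alpha> / idx_fact n \<alpha>) = hermite_proj n (idx_lower n i B) (g i)"
proof
  fix x
  define F where "F = (\<lambda>\<beta>. hermite_inner n (g i) \<beta> / idx_fact n \<beta> * hermite_prod n \<beta> x)"
  have "hermite_comb_deriv n i B (\<lambda>\<alpha>. hermite_inner n u \<alpha> / idx_fact n \<alpha>) x
     = (\<Sum>\<alpha>\<in>B. if \<alpha> i = 0 then 0 else F (\<alpha>(i := \<alpha> i - 1)))"
    unfolding hermite_comb_deriv_def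
  proof (rule sum.cong[OF refl])
    fix \<alpha> assume "\<alpha> \<in> B"
    then have \<alpha>: "\<alpha> \<in> idx n" using B by auto
    show "hermite_inner n u \<alpha> / idx_fact n \<alpha> * (\<alpha> i * hermite_prod n (\<alpha>(i := \<alpha> i - 1)) x)
      = (if \<alpha> i = 0 then 0 else F (\<alpha>(i := \<alpha> i - 1)))"
    proof (cases "\<alpha> i = 0")
      case False
      then have "hermite_inner n (g i) (\<alpha>(i := \<alpha> i - 1)) = hermite_inner n u \<alpha>"
        using gauss_W12D(3)[OF W i idx_upd[OF i \<alpha>], of "\<alpha> i - 1"] by simp
      then show ?thesis using False idx_fact_lower[where \<alpha> = \<alpha>, OF i False] by (simp add: F_def)
    qed simp
  qed
  also have "\<dots> = hermite_proj n (idx_lower n i B) (g i) x"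
    unfolding idx_lower_reindex(2)[OF B i] by (simp add: F_def hermite_proj_def hermite_comb_def)
  finally show "hermite_comb_deriv n i B (\<lambda>\<alpha>. hermite_inner n u \<alpha> / idx_fact n \<alpha>) x
    = hermite_proj n (idx_lower n i B) (g i) x" .
qed

text \<open>One Hermite sum has to approximate \<open>u\<close> while its derivatives approximate
  all \<open>g i\<close>, which works because projection errors are monotone in the index
  set.\<close>

lemma gauss_W12_approx:
  assumes W: "gauss_W12 n u g" and e: "e > 0"
  shows "\<exists>B c. finite B \<and> B \<subseteq> idx n \<and> (\<integral>x. (hermite_comb n B c x - u x)\<^sup>2 \<partial>gauss n) < e \<and>
    (\<forall>i<n. (\<integral>x. (hermite_comb_deriv n i B c x - g i x)\<^sup>2 \<partial>gauss n) < e)"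
proof -
  obtain F where F: "finite F" "F \<subseteq> idx n"
    "\<forall>B. finite B \<and> F \<subseteq> B \<and> B \<subseteq> idx n \<longrightarrow> (\<integral>x. (u x - hermite_proj n B u x)\<^sup>2 \<partial>gauss n) < e"
    using hermite_proj_approx[OF gauss_W12D(1)[OF W] e] by (elim exE conjE)
  have "\<exists>F. i < n \<longrightarrow> finite F \<and> F \<subseteq> idx n \<and>
    (\<forall>B. finite B \<and> F \<subseteq> B \<and> B \<subseteq> idx n \<longrightarrow> (\<integral>x. (g i x - hermite_proj n B (g i) x)\<^sup>2 \<partial>gauss n) < e)" for i
  proof (cases "i < n")
    case True
    show ?thesis using hermite_proj_approx[OF gauss_W12D(2)[OF W True] e] by simp
  qed simp
  then have "\<exists>G. \<forall>i. i < n \<longrightarrow> finite (G i) \<and> G i \<subseteq> idx n \<and>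
    (\<forall>B. finite B \<and> G i \<subseteq> B \<and> B \<subseteq> idx n \<longrightarrow> (\<integral>x. (g i x - hermite_proj n B (g i) x)\<^sup>2 \<partial>gauss n) < e)"
    by (intro choice allI)
  then obtain G where GG: "\<forall>i. i < n \<longrightarrow> finite (G i) \<and> G i \<subseteq> idx n \<and>
    (\<forall>B. finite B \<and> G i \<subseteq> B \<and> B \<subseteq> idx n \<longrightarrow> (\<integral>x. (g i x - hermite_proj n B (g i) x)\<^sup>2 \<partial>gauss n) < e)"
    by (elim exE)
  have G: "finite (G i)" "G i \<subseteq> idx n"
    "finite B \<and> G i \<subseteq> B \<and> B \<subseteq> idx n \<longrightarrow> (\<integral>x. (g i x - hermite_proj n B (g i) x)\<^sup>2 \<partial>gauss n) < e"
    if "i < n" for i B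
    using GG[rule_format, OF that] by simp_all
  \<comment> \<open>Raising \<open>G i\<close> in coordinate i ensures that the lowered set of
    \<open>B\<close> contains \<open>G i\<close>.\<close>
  define B where "B = F \<union> (\<Union>i<n. (\<lambda>\<beta>. \<beta>(i := Suc (\<beta> i))) ` G i)"
  have finB: "finite B" using F G by (auto simp: B_def)
  have subB: "B \<subseteq> idx n" using F G(2) idx_upd by (fastforce simp: B_def)
  have u: "(\<integral>x. (u x - hermite_proj n B u x)\<^sup>2 \<partial>gauss n) < e"
    using F(3)[rule_format, of B] finB subB by (simp add: B_def)
  have g: "(\<integral>x. (g i x - hermite_proj n (idx_lower n i B) (g i) x)\<^sup>2 \<partial>gauss n) < e" if i: "i < n" for i
  proof (rule G(3)[OF i, THEN mp], intro conjI)
    show "finite (idx_lower n i B)" by (rule idx_lower_reindex(1)[OF finB subB i])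
    show "G i \<subseteq> idx_lower n i B" using G(2)[OF i] i by (auto simp: idx_lower_def B_def)
    show "idx_lower n i B \<subseteq> idx n" by (auto simp: idx_lower_def)
  qed
  show ?thesis
    using finB subB u g hermite_proj_deriv[OF W finB subB]
    by (intro exI[of _ B] exI[of _ "\<lambda>\<alpha>. hermite_inner n u \<alpha> / idx_fact n \<alpha>"])
       (simp add: hermite_proj_def[symmetric] power2_commute)
qed

definition is_hermite_comb :: "nat \<Rightarrow> (rvec \<Rightarrow> real) \<Rightarrow> (nat \<Rightarrow> rvec \<Rightarrow> real) \<Rightarrow> bool" where
  "is_hermite_comb n p dp \<longleftrightarrow> (\<exists>B c. finite B \<and> B \<subseteq> idx n \<and> p = hermite_comb n B c \<and>
     dp = (\<lambda>i. hermite_comb_deriv n i B c))"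

lemma is_hermite_comb_L2:
  assumes "is_hermite_comb n p dp"
  shows "p \<in> L2_space (gauss n)" "dp i \<in> L2_space (gauss n)"
    "i < n \<Longrightarrow> (\<lambda>x. x i * p x - dp i x) \<in> L2_space (gauss n)"
  using assms by (auto simp: is_hermite_comb_def L2_hermite_comb L2_hermite_comb_deriv L2_hermite_delta)

lemma is_hermite_comb_inner:
  assumes "is_hermite_comb n p dp" "is_hermite_comb n q dq" "i < n" "j < n"
  shows "(\<integral>x. (x i * p x - dp i x) * (x j * q x - dq j x) \<partial>gauss n)
    = (if i = j then \<integral>x. p x * q x \<partial>gauss n else 0) + (\<integral>x. dp j x * dq i x \<partial>gauss n)"
proof -
  obtain B c where 1: "B \<subseteq> idx n" "p = hermite_comb n B c" "dp = (\<lambda>i. hermite_comb_deriv n i B c)"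
    using assms(1) unfolding is_hermite_comb_def by blast
  obtain B' d where 2: "B' \<subseteq> idx n" "q = hermite_comb n B' d" "dq = (\<lambda>i. hermite_comb_deriv n i B' d)"
    using assms(2) unfolding is_hermite_comb_def by blast
  show ?thesis unfolding 1(2,3) 2(2,3) by (rule hermite_delta_inner[OF 1(1) 2(1) assms(3,4)])
qed

lemma gauss_W12_approx_seq:
  assumes W: "gauss_W12 n u g"
  shows "\<exists>p dp. (\<forall>k::nat. is_hermite_comb n (p k) (dp k)) \<and>
    (\<lambda>k. \<integral>x. (p k x - u x)\<^sup>2 \<partial>gauss n) \<longlonglongrightarrow> 0 \<and>
    (\<forall>i<n. (\<lambda>k. \<integral>x. (dp k i x - g i x)\<^sup>2 \<partial>gauss n) \<longlonglongrightarrow> 0)"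
proof -
  have "\<exists>B c. finite B \<and> B \<subseteq> idx n \<and> (\<integral>x. (hermite_comb n B c x - u x)\<^sup>2 \<partial>gauss n) < 1 / real (Suc k) \<and>
    (\<forall>i<n. (\<integral>x. (hermite_comb_deriv n i B c x - g i x)\<^sup>2 \<partial>gauss n) < 1 / real (Suc k))" for k
    by (rule gauss_W12_approx[OF W]) simp
  then have "\<exists>B. \<forall>k. \<exists>c. finite (B k) \<and> B k \<subseteq> idx n \<and> (\<integral>x. (hermite_comb n (B k) c x - u x)\<^sup>2 \<partial>gauss n) < 1 / real (Suc k) \<and>
    (\<forall>i<n. (\<integral>x. (hermite_comb_deriv n i (B k) c x - g i x)\<^sup>2 \<partial>gauss n) < 1 / real (Suc k))"
    by (intro choice allI)
  then obtain B where "\<forall>k. \<exists>c. finite (B k) \<and> B k \<subseteq> idx n \<and> (\<integral>x. (hermite_comb n (B k) c x - u x)\<^sup>2 \<partial>gauss n) < 1 / real (Suc k) \<and>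
    (\<forall>i<n. (\<integral>x. (hermite_comb_deriv n i (B k) c x - g i x)\<^sup>2 \<partial>gauss n) < 1 / real (Suc k))"
    by (elim exE)
  then have "\<exists>c. \<forall>k. finite (B k) \<and> B k \<subseteq> idx n \<and> (\<integral>x. (hermite_comb n (B k) (c k) x - u x)\<^sup>2 \<partial>gauss n) < 1 / real (Suc k) \<and>
    (\<forall>i<n. (\<integral>x. (hermite_comb_deriv n i (B k) (c k) x - g i x)\<^sup>2 \<partial>gauss n) < 1 / real (Suc k))"
    by (rule choice)
  then obtain c where c: "\<forall>k. finite (B k) \<and> B k \<subseteq> idx n \<and> (\<integral>x. (hermite_comb n (B k) (c k) x - u x)\<^sup>2 \<partial>gauss n) < 1 / real (Suc k) \<and>
    (\<forall>i<n. (\<integral>x. (hermite_comb_deriv n i (B k) (c k) x - g i x)\<^sup>2 \<partial>gauss n) < 1 / real (Suc k))"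
    by (elim exE)
  note Bc = c[rule_format, THEN conjunct1] c[rule_format, THEN conjunct2, THEN conjunct1]
    c[rule_format, THEN conjunct2, THEN conjunct2, THEN conjunct1]
    c[rule_format, THEN conjunct2, THEN conjunct2, THEN conjunct2, rule_format]
  have lim: "a \<longlonglongrightarrow> 0" if "\<And>k. 0 \<le> a k" "\<And>k. a k < 1 / real (Suc k)" for a :: "nat \<Rightarrow> real"
    by (rule tendsto_sandwich[OF always_eventually always_eventually tendsto_const
          lim_1_over_n[THEN LIMSEQ_Suc]]) (use that in \<open>auto intro: less_imp_le\<close>)
  show ?thesis
  proof (intro exI[of _ "\<lambda>k. hermite_comb n (B k) (c k)"]
      exI[of _ "\<lambda>k i. hermite_comb_deriv n i (B k) (c k)"] conjI allI)
    show "is_hermite_comb n (hermite_comb n (B k) (c k)) (\<lambda>i. hermite_comb_deriv n i (B k) (c k))" for k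
      unfolding is_hermite_comb_def by (intro exI[of _ "B k"] exI[of _ "c k"] conjI refl Bc(1,2))
    show "(\<lambda>k. \<integral>x. (hermite_comb n (B k) (c k) x - u x)\<^sup>2 \<partial>gauss n) \<longlonglongrightarrow> 0"
      by (rule lim[OF _ Bc(3)]) simp
    show "i < n \<longrightarrow> (\<lambda>k. \<integral>x. (hermite_comb_deriv n i (B k) (c k) x - g i x)\<^sup>2 \<partial>gauss n) \<longlonglongrightarrow> 0" for i
      by (intro impI, rule lim[OF _ Bc(4)]) simp_all
  qed
qed

text \<open>The commutation identity on Hermite sums controls the L2 norm of x_i p - d_i p by those
  of p and its derivatives, so approximating sequences stay Cauchy after this operation; the
  identity then passes to the limit.\<close>

theorem gauss_delta_inner:
  assumes W: "gauss_W12 n u g" and W': "gauss_W12 n v h" and i: "i < n" and j: "j < n"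
  shows "(\<lambda>x. x i * u x - g i x) \<in> L2_space (gauss n)"
    "(\<integral>x. (x i * u x - g i x) * (x j * v x - h j x) \<partial>gauss n)
      = (if i = j then \<integral>x. u x * v x \<partial>gauss n else 0) + (\<integral>x. g j x * h i x \<partial>gauss n)"
proof -
  have conv: "(\<lambda>x. x i * u x - g i x) \<in> L2_space (gauss n) \<and>
     (\<lambda>k. \<integral>x. ((x i * p k x - dp k i x) - (x i * u x - g i x))\<^sup>2 \<partial>gauss n) \<longlonglongrightarrow> 0"
    if W: "gauss_W12 n u g" and i: "i < n" and p: "\<And>k. is_hermite_comb n (p k) (dp k)"
      and pu: "(\<lambda>k. \<integral>x. (p k x - u x)\<^sup>2 \<partial>gauss n) \<longlonglongrightarrow> 0"
      and dg: "(\<lambda>k. \<integral>x. (dp k i x - g i x)\<^sup>2 \<partial>gauss n) \<longlonglongrightarrow> 0"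
    for u g i and p :: "nat \<Rightarrow> rvec \<Rightarrow> real" and dp
  proof -
    note L = is_hermite_comb_L2[OF p] gauss_W12D(1)[OF W] gauss_W12D(2)[OF W i] L2_gauss_coord[OF i]
    let ?us = "\<lambda>k x. x i * p k x - dp k i x" and ?u = "\<lambda>x. x i * u x - g i x"
    have int: "integrable (gauss n) ?u"
      using L2_mult_integrable[OF L(6) L(4)] gauss.L2_integrable[OF L(5)] by simp
    \<comment> \<open>Expanding the square and using the identity for the pairs (k, k), (k, l), (l,
      l) reassembles into the distances of the functions and of their i-th derivatives.\<close>
    have dist: "(\<integral>x. (?us k x - ?us l x)\<^sup>2 \<partial>gauss n)
       = (\<integral>x. (p k x - p l x)\<^sup>2 \<partial>gauss n) + (\<integral>x. (dp k i x - dp l i x)\<^sup>2 \<partial>gauss n)" for k l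
    proof -
      have sq: "(\<integral>x. (a x - b x)\<^sup>2 \<partial>gauss n) = (\<integral>x. a x * a x \<partial>gauss n)
         - 2 * (\<integral>x. a x * b x \<partial>gauss n) + (\<integral>x. b x * b x \<partial>gauss n)"
        if "a \<in> L2_space (gauss n)" "b \<in> L2_space (gauss n)" for a b
      proof -
        have "(\<integral>x. (a x - b x)\<^sup>2 \<partial>gauss n) = (\<integral>x. a x * a x - 2 * (a x * b x) + b x * b x \<partial>gauss n)"
          by (rule Bochner_Integration.integral_cong) (auto simp: power2_eq_square algebra_simps)
        then show ?thesis using that by (simp add: L2_mult_integrable)
      qed
      show ?thesis
        unfolding sq[OF L(3)[OF i] L(3)[OF i]] sq[OF L(1) L(1)] sq[OF L(2) L(2)]
        using is_hermite_comb_inner[OF p p i i] by simp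
    qed
    have tri: "(\<integral>x. (?us k x - ?us l x)\<^sup>2 \<partial>gauss n)
       \<le> 2 * (\<integral>x. (p k x - u x)\<^sup>2 \<partial>gauss n) + 2 * (\<integral>x. (p l x - u x)\<^sup>2 \<partial>gauss n)
        + 2 * (\<integral>x. (dp k i x - g i x)\<^sup>2 \<partial>gauss n) + 2 * (\<integral>x. (dp l i x - g i x)\<^sup>2 \<partial>gauss n)" for k l
      using L2_triangle_le[OF L(1) L(4) L(1), of k l] L2_triangle_le[OF L(2) L(5) L(2), of k i l i]
      unfolding dist by (simp add: power2_commute[of "u _"] power2_commute[of "g i _"])
    have cauchy: "\<exists>N. \<forall>k\<ge>N. \<forall>l\<ge>N. (\<integral>x. (?us k x - ?us l x)\<^sup>2 \<partial>gauss n) \<le> e" if "e > 0" for e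
    proof -
      have "\<forall>\<^sub>F k in sequentially. (\<integral>x. (p k x - u x)\<^sup>2 \<partial>gauss n) < e/8 \<and> (\<integral>x. (dp k i x - g i x)\<^sup>2 \<partial>gauss n) < e/8"
        using order_tendstoD(2)[OF pu, of "e/8"] order_tendstoD(2)[OF dg, of "e/8"] \<open>e > 0\<close>
        by (simp add: eventually_conj)
      then obtain N where N: "\<And>k. k \<ge> N \<Longrightarrow> (\<integral>x. (p k x - u x)\<^sup>2 \<partial>gauss n) < e/8 \<and> (\<integral>x. (dp k i x - g i x)\<^sup>2 \<partial>gauss n) < e/8"
        by (auto simp: eventually_sequentially)
      have "(\<integral>x. (?us k x - ?us l x)\<^sup>2 \<partial>gauss n) \<le> e" if "k \<ge> N" "l \<ge> N" for k l
        using tri[of k l] N[OF that(1)] N[OF that(2)] by linarith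
      then show ?thesis by blast
    qed
    \<comment> \<open>Only L1 convergence is directly available: multiplication by a coordinate is
      not continuous on L2, but by Cauchy-Schwarz it maps L2 continuously into L1.\<close>
    have L1: "(\<lambda>k. \<integral>x. \<bar>?us k x - ?u x\<bar> \<partial>gauss n) \<longlonglongrightarrow> 0"
    proof (rule tendsto_sandwich[OF always_eventually always_eventually tendsto_const])
      show "\<forall>k. (\<integral>x. \<bar>?us k x - ?u x\<bar> \<partial>gauss n) \<le>
         sqrt (\<integral>x. (x i)\<^sup>2 \<partial>gauss n) * sqrt (\<integral>x. (p k x - u x)\<^sup>2 \<partial>gauss n) + sqrt (\<integral>x. (dp k i x - g i x)\<^sup>2 \<partial>gauss n)"
      proof
        fix k
        have A: "(\<lambda>x. \<bar>x i\<bar>) \<in> L2_space (gauss n)" by (rule L2_dominated[OF L(6)]) (use i in auto)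
        have D1: "(\<lambda>x. p k x - u x) \<in> L2_space (gauss n)" by (rule L2_diff[OF L(1) L(4)])
        have D2: "(\<lambda>x. dp k i x - g i x) \<in> L2_space (gauss n)" by (rule L2_diff[OF L(2) L(5)])
        have D1': "(\<lambda>x. \<bar>p k x - u x\<bar>) \<in> L2_space (gauss n)"
          by (rule L2_dominated[OF D1]) (use D1 in auto)
        have D2': "integrable (gauss n) (\<lambda>x. \<bar>dp k i x - g i x\<bar>)"
          by (intro integrable_abs gauss.L2_integrable D2)
        have "(\<integral>x. \<bar>?us k x - ?u x\<bar> \<partial>gauss n) \<le> (\<integral>x. \<bar>x i\<bar> * \<bar>p k x - u x\<bar> + \<bar>dp k i x - g i x\<bar> \<partial>gauss n)"
        proof (rule integral_mono)
          show "integrable (gauss n) (\<lambda>x. \<bar>?us k x - ?u x\<bar>)"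
            using gauss.L2_integrable[OF L(3)[OF i]] int by (intro integrable_abs) simp
          show "integrable (gauss n) (\<lambda>x. \<bar>x i\<bar> * \<bar>p k x - u x\<bar> + \<bar>dp k i x - g i x\<bar>)"
            using L2_mult_integrable[OF A D1'] D2' by simp
          show "\<bar>?us k x - ?u x\<bar> \<le> \<bar>x i\<bar> * \<bar>p k x - u x\<bar> + \<bar>dp k i x - g i x\<bar>" for x
          proof -
            have "?us k x - ?u x = x i * (p k x - u x) - (dp k i x - g i x)" by (simp add: algebra_simps)
            then show ?thesis using abs_triangle_ineq4[of "x i * (p k x - u x)" "dp k i x - g i x"]
              unfolding abs_mult by presburger
          qed
        qed
        also have "\<dots> = (\<integral>x. \<bar>x i\<bar> * \<bar>p k x - u x\<bar> \<partial>gauss n) + (\<integral>x. \<bar>dp k i x - g i x\<bar> \<partial>gauss n)"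
          using L2_mult_integrable[OF A D1'] D2' by simp
        also have "\<dots> \<le> sqrt (\<integral>x. (x i)\<^sup>2 \<partial>gauss n) * sqrt (\<integral>x. (p k x - u x)\<^sup>2 \<partial>gauss n) + sqrt (\<integral>x. (dp k i x - g i x)\<^sup>2 \<partial>gauss n)"
          using L2_Cauchy_Schwarz_abs[OF A D1'] gauss.L2_abs_integral_le[OF D2] by simp
        finally show "(\<integral>x. \<bar>?us k x - ?u x\<bar> \<partial>gauss n) \<le>
         sqrt (\<integral>x. (x i)\<^sup>2 \<partial>gauss n) * sqrt (\<integral>x. (p k x - u x)\<^sup>2 \<partial>gauss n) + sqrt (\<integral>x. (dp k i x - g i x)\<^sup>2 \<partial>gauss n)" .
      qed
      show "(\<lambda>k. sqrt (\<integral>x. (x i)\<^sup>2 \<partial>gauss n) * sqrt (\<integral>x. (p k x - u x)\<^sup>2 \<partial>gauss n) + sqrt (\<integral>x. (dp k i x - g i x)\<^sup>2 \<partial>gauss n)) \<longlonglongrightarrow> 0"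
        using tendsto_add[OF tendsto_mult[OF tendsto_const tendsto_real_sqrt[OF pu]] tendsto_real_sqrt[OF dg]] by simp
    qed auto
    show ?thesis
      using L2_limit_of_Cauchy[of ?us "gauss n" ?u, OF L(3)[OF i] gauss.L2_integrable[OF L(3)[OF i]] int cauchy L1] by blast
  qed
  obtain p dp where p: "\<forall>k::nat. is_hermite_comb n (p k) (dp k)"
    "(\<lambda>k. \<integral>x. (p k x - u x)\<^sup>2 \<partial>gauss n) \<longlonglongrightarrow> 0"
    "\<forall>i<n. (\<lambda>k. \<integral>x. (dp k i x - g i x)\<^sup>2 \<partial>gauss n) \<longlonglongrightarrow> 0"
    using gauss_W12_approx_seq[OF W] by (elim exE conjE)
  note p = p(1)[rule_format] p(2,3)
  obtain q dq where q: "\<forall>k::nat. is_hermite_comb n (q k) (dq k)"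
    "(\<lambda>k. \<integral>x. (q k x - v x)\<^sup>2 \<partial>gauss n) \<longlonglongrightarrow> 0"
    "\<forall>i<n. (\<lambda>k. \<integral>x. (dq k i x - h i x)\<^sup>2 \<partial>gauss n) \<longlonglongrightarrow> 0"
    using gauss_W12_approx_seq[OF W'] by (elim exE conjE)
  note q = q(1)[rule_format] q(2,3)
  note cp = conv[OF W i p(1,2) p(3)[rule_format, OF i]] and cq = conv[OF W' j q(1,2) q(3)[rule_format, OF j]]
  note Lp = is_hermite_comb_L2[OF p(1)] and Lq = is_hermite_comb_L2[OF q(1)]
  show "(\<lambda>x. x i * u x - g i x) \<in> L2_space (gauss n)" using cp by simp
  have 1: "(\<lambda>k. \<integral>x. (x i * p k x - dp k i x) * (x j * q k x - dq k j x) \<partial>gauss n)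
     \<longlonglongrightarrow> (\<integral>x. (x i * u x - g i x) * (x j * v x - h j x) \<partial>gauss n)"
    by (rule L2_tendsto_inner[OF Lp(3)[rule_format, OF i] conjunct1[OF cp] Lq(3)[rule_format, OF j] conjunct1[OF cq] conjunct2[OF cp] conjunct2[OF cq]])
  have 2: "(\<lambda>k. \<integral>x. p k x * q k x \<partial>gauss n) \<longlonglongrightarrow> (\<integral>x. u x * v x \<partial>gauss n)"
    by (rule L2_tendsto_inner[OF Lp(1) gauss_W12D(1)[OF W] Lq(1) gauss_W12D(1)[OF W'] p(2) q(2)])
  have 3: "(\<lambda>k. \<integral>x. dp k j x * dq k i x \<partial>gauss n) \<longlonglongrightarrow> (\<integral>x. g j x * h i x \<partial>gauss n)"
    by (rule L2_tendsto_inner[OF Lp(2) gauss_W12D(2)[OF W j] Lq(2) gauss_W12D(2)[OF W' i] p(3)[rule_format, OF j] q(3)[rule_format, OF i]])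
  have "(\<lambda>k. (if i = j then \<integral>x. p k x * q k x \<partial>gauss n else 0) + (\<integral>x. dp k j x * dq k i x \<partial>gauss n))
     \<longlonglongrightarrow> (if i = j then \<integral>x. u x * v x \<partial>gauss n else 0) + (\<integral>x. g j x * h i x \<partial>gauss n)"
    using 2 by (intro tendsto_add 3) (cases "i = j", simp_all)
  with 1 show "(\<integral>x. (x i * u x - g i x) * (x j * v x - h j x) \<partial>gauss n)
      = (if i = j then \<integral>x. u x * v x \<partial>gauss n else 0) + (\<integral>x. g j x * h i x \<partial>gauss n)"
    unfolding is_hermite_comb_inner[OF p(1) q(1) i j] by (rule LIMSEQ_unique)
qed

text \<open>In Hermite coordinates the squared norms of the derivatives give the coefficient of
  index \<alpha> the weight \<alpha>_1 + ... + \<alpha>_n. This is at least 1 unless \<alpha> = 0,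
  whose coefficient is the mean. Keeping one coordinate with \<alpha> i > 0 is enough, and Bessel
  bounds each derivative.\<close>

theorem gauss_Poincare:
  assumes W: "gauss_W12 n u g" and mean: "(\<integral>x. u x \<partial>gauss n) = 0"
  shows "(\<integral>x. (u x)\<^sup>2 \<partial>gauss n) \<le> (\<Sum>i<n. \<integral>x. (g i x)\<^sup>2 \<partial>gauss n)"
proof (rule field_le_epsilon)
  fix e :: real assume "e > 0"
  then obtain B where B: "finite B" "B \<subseteq> idx n" "(\<integral>x. (u x - hermite_proj n B u x)\<^sup>2 \<partial>gauss n) < e"
    using hermite_proj_approx[OF gauss_W12D(1)[OF W] \<open>e > 0\<close>] by blast
  define F where "F = (\<lambda>i \<beta>. (hermite_inner n (g i) \<beta>)\<^sup>2 / idx_fact n \<beta>)"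
  have F0: "F i \<beta> \<ge> 0" for i \<beta> unfolding F_def by (intro divide_nonneg_pos idx_fact_pos) simp
  have "(\<Sum>\<alpha>\<in>B. (hermite_inner n u \<alpha>)\<^sup>2 / idx_fact n \<alpha>)
     \<le> (\<Sum>\<alpha>\<in>B. \<Sum>i<n. if \<alpha> i = 0 then 0 else F i (\<alpha>(i := \<alpha> i - 1)))"
  proof (rule sum_mono)
    fix \<alpha> assume "\<alpha> \<in> B"
    then have \<alpha>: "\<alpha> \<in> idx n" using B by auto
    show "(hermite_inner n u \<alpha>)\<^sup>2 / idx_fact n \<alpha> \<le> (\<Sum>i<n. if \<alpha> i = 0 then 0 else F i (\<alpha>(i := \<alpha> i - 1)))"
    proof (cases "\<exists>i<n. \<alpha> i \<noteq> 0")
      case False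
      then have "hermite_prod n \<alpha> x = 1" for x by (simp add: hermite_prod_def)
      then have "hermite_inner n u \<alpha> = 0" using mean by (simp add: hermite_inner_def)
      then show ?thesis using F0 by (simp add: sum_nonneg)
    next
      case True
      then obtain i where i: "i < n" "\<alpha> i \<noteq> 0" by blast
      have "hermite_inner n (g i) (\<alpha>(i := \<alpha> i - 1)) = hermite_inner n u \<alpha>"
        using gauss_W12D(3)[OF W i(1) idx_upd[OF i(1) \<alpha>], of "\<alpha> i - 1"] i by simp
      then have "F i (\<alpha>(i := \<alpha> i - 1)) = \<alpha> i * ((hermite_inner n u \<alpha>)\<^sup>2 / idx_fact n \<alpha>)"
        using i idx_fact_lower[of i n \<alpha>] by (simp add: F_def)
      moreover have "1 * ((hermite_inner n u \<alpha>)\<^sup>2 / idx_fact n \<alpha>) \<le> \<alpha> i * ((hermite_inner n u \<alpha>)\<^sup>2 / idx_fact n \<alpha>)"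
        using i idx_fact_pos[of n \<alpha>] by (intro mult_right_mono) auto
      ultimately have "(hermite_inner n u \<alpha>)\<^sup>2 / idx_fact n \<alpha> \<le> (if \<alpha> i = 0 then 0 else F i (\<alpha>(i := \<alpha> i - 1)))"
        using i by simp
      also have "\<dots> \<le> (\<Sum>i<n. if \<alpha> i = 0 then 0 else F i (\<alpha>(i := \<alpha> i - 1)))"
        using i F0 by (intro member_le_sum) auto
      finally show ?thesis .
    qed
  qed
  also have "\<dots> = (\<Sum>i<n. \<Sum>\<beta>\<in>idx_lower n i B. F i \<beta>)"
    by (subst sum.swap) (simp add: idx_lower_reindex(2)[OF B(1,2)])
  also have "\<dots> \<le> (\<Sum>i<n. \<integral>x. (g i x)\<^sup>2 \<partial>gauss n)"
    unfolding F_def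
    by (intro sum_mono hermite_Bessel gauss_W12D(2)[OF W] idx_lower_reindex(1)[OF B(1,2)])
       (auto simp: idx_lower_def)
  finally show "(\<integral>x. (u x)\<^sup>2 \<partial>gauss n) \<le> (\<Sum>i<n. \<integral>x. (g i x)\<^sup>2 \<partial>gauss n) + e"
    using hermite_proj_distance[OF gauss_W12D(1)[OF W] B(1,2)] B(3) by linarith
qed

section \<open>The second order Stein formula\<close>


lemma weak_gradient_gauss_W12:
  assumes "has_weak_gradient n u g" "u \<in> L2_space (gauss n)"
    "\<And>i. i < n \<Longrightarrow> (\<lambda>x. g x i) \<in> L2_space (gauss n)"
  shows "gauss_W12 n u (\<lambda>i x. g x i)"
  unfolding gauss_W12_def using assms weak_gradient_hermite by blast

text \<open>First order Stein: the raised zero index says that the mean of u x_k is the mean of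
  g_k.\<close>

lemma gauss_W12_inner_affine:
  assumes W: "gauss_W12 n u g"
  shows "(\<integral>x. u x * (c + (\<Sum>k<n. b k * x k)) \<partial>gauss n) = c * (\<integral>x. u x \<partial>gauss n) + (\<Sum>k<n. b k * (\<integral>x. g k x \<partial>gauss n))"
proof -
  note u = gauss_W12D(1)[OF W]
  have i1: "integrable (gauss n) (\<lambda>x. c * u x)" using gauss.L2_integrable[OF u] by simp
  have i2: "integrable (gauss n) (\<lambda>x. b k * (u x * x k))" if "k \<in> {..<n}" for k
    using that by (intro integrable_mult_right L2_mult_integrable u L2_gauss_coord) simp
  have i3: "integrable (gauss n) (\<lambda>x. \<Sum>k<n. b k * (u x * x k))"
    by (rule Bochner_Integration.integrable_sum) (rule i2)
  have eq: "u x * (c + (\<Sum>k<n. b k * x k)) = c * u x + (\<Sum>k<n. b k * (u x * x k))" for x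
    by (subst distrib_left, subst sum_distrib_left) (simp add: mult_ac)
  have co: "(\<integral>x. u x * x k \<partial>gauss n) = (\<integral>x. g k x \<partial>gauss n)" if "k < n" for k
    using gauss_W12D(3)[OF W that idx0(1)] that
    by (simp add: hermite_inner_def hermite_prod_idx0 idx0 hermite_prod_unit)
  have "(\<integral>x. u x * (c + (\<Sum>k<n. b k * x k)) \<partial>gauss n)
    = (\<integral>x. c * u x \<partial>gauss n) + (\<integral>x. (\<Sum>k<n. b k * (u x * x k)) \<partial>gauss n)"
    unfolding eq by (rule Bochner_Integration.integral_add[OF i1 i3])
  also have "(\<integral>x. (\<Sum>k<n. b k * (u x * x k)) \<partial>gauss n) = (\<Sum>k<n. \<integral>x. b k * (u x * x k) \<partial>gauss n)"
    by (rule Bochner_Integration.integral_sum) (rule i2)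
  also have "\<dots> = (\<Sum>k<n. b k * (\<integral>x. g k x \<partial>gauss n))"
    by (rule sum.cong) (simp_all add: co)
  finally show ?thesis by simp
qed

lemma gauss_affine_mean: "(\<integral>x. c + (\<Sum>k<n. b k * x k) \<partial>gauss n) = c"
  using gauss_W12_inner_affine[OF gauss_W12_affine[of n 1 "\<lambda>_. 0"], of c b] gauss.prob_space by simp

definition stein_system :: "nat \<Rightarrow> (rvec \<Rightarrow> rvec) \<Rightarrow> (rvec \<Rightarrow> rmat) \<Rightarrow> bool" where
  "stein_system n f G \<longleftrightarrow> (\<forall>j<n. gauss_W12 n (\<lambda>x. f x j) (\<lambda>i x. G x i j))"

abbreviation gxi :: "nat \<Rightarrow> (rvec \<Rightarrow> rvec) \<Rightarrow> (rvec \<Rightarrow> rmat) \<Rightarrow> rvec \<Rightarrow> real" where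
  "gxi n \<equiv> xi n (\<lambda>x. x)"

abbreviation gxi_lin :: "nat \<Rightarrow> rvec \<Rightarrow> rmat \<Rightarrow> rvec \<Rightarrow> real" where
  "gxi_lin n \<equiv> xi_lin n (\<lambda>x. x)"

lemma gxi_eq: "gxi n f G x = (\<Sum>j<n. x j * f x j - G x j j)"
  by (simp add: xi_def mtrace_def sum_subtractf)

lemma stein_systemD: "stein_system n f G \<Longrightarrow> j < n \<Longrightarrow> gauss_W12 n (\<lambda>x. f x j) (\<lambda>i x. G x i j)"
  by (simp add: stein_system_def)

lemma stein_system_L2:
  assumes "stein_system n f G"
  shows "j < n \<Longrightarrow> (\<lambda>x. f x j) \<in> L2_space (gauss n)"
    "i < n \<Longrightarrow> j < n \<Longrightarrow> (\<lambda>x. G x i j) \<in> L2_space (gauss n)"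
    "gxi n f G \<in> L2_space (gauss n)"
proof -
  show "j < n \<Longrightarrow> (\<lambda>x. f x j) \<in> L2_space (gauss n)" for j
    using gauss_W12D(1)[OF stein_systemD[OF assms]] by simp
  show "i < n \<Longrightarrow> j < n \<Longrightarrow> (\<lambda>x. G x i j) \<in> L2_space (gauss n)"
    using gauss_W12D(2)[OF stein_systemD[OF assms]] by simp
  show "gxi n f G \<in> L2_space (gauss n)"
    unfolding gxi_eq[abs_def]
    by (intro L2_sum gauss_delta_inner(1)[OF stein_systemD[OF assms] stein_systemD[OF assms]]) auto
qed

text \<open>The double sum over coordinates of the commutation identity; the diagonal gives f . h
  and the derivative terms give the trace of G K.\<close>

theorem second_order_Stein:
  assumes S: "stein_system n f G" and T: "stein_system n h K"
  shows "(\<integral>x. gxi n f G x * gxi n h K x \<partial>gauss n)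
    = (\<Sum>j<n. \<integral>x. f x j * h x j \<partial>gauss n) + (\<Sum>i<n. \<Sum>j<n. \<integral>x. G x j i * K x i j \<partial>gauss n)"
proof -
  have L: "(\<lambda>x. x j * f x j - G x j j) \<in> L2_space (gauss n)" "(\<lambda>x. x j * h x j - K x j j) \<in> L2_space (gauss n)"
    if "j \<in> {..<n}" for j
    using that gauss_delta_inner(1)[OF stein_systemD[OF S] stein_systemD[OF S], of j j j]
      gauss_delta_inner(1)[OF stein_systemD[OF T] stein_systemD[OF T], of j j j] by simp_all
  have "(\<integral>x. gxi n f G x * gxi n h K x \<partial>gauss n)
     = (\<Sum>i<n. \<Sum>j<n. \<integral>x. (x i * f x i - G x i i) * (x j * h x j - K x j j) \<partial>gauss n)"
    unfolding gxi_eq using L2_sum_inner[of "{..<n}" "\<lambda>j x. x j * f x j - G x j j" "gauss n" "{..<n}"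
        "\<lambda>j x. x j * h x j - K x j j" "\<lambda>_. 1" "\<lambda>_. 1", OF L] by simp
  also have "\<dots> = (\<Sum>i<n. \<Sum>j<n. (if i = j then \<integral>x. f x i * h x j \<partial>gauss n else 0) + (\<integral>x. G x j i * K x i j \<partial>gauss n))"
  proof (intro sum.cong refl)
    fix i j assume "i \<in> {..<n}" "j \<in> {..<n}"
    then have ij: "i < n" "j < n" by simp_all
    show "(\<integral>x. (x i * f x i - G x i i) * (x j * h x j - K x j j) \<partial>gauss n)
      = (if i = j then \<integral>x. f x i * h x j \<partial>gauss n else 0) + (\<integral>x. G x j i * K x i j \<partial>gauss n)"
      by (rule gauss_delta_inner(2)[OF stein_systemD[OF S ij(1)] stein_systemD[OF T ij(2)] ij])
  qed
  also have "\<dots> = (\<Sum>j<n. \<integral>x. f x j * h x j \<partial>gauss n) + (\<Sum>i<n. \<Sum>j<n. \<integral>x. G x j i * K x i j \<partial>gauss n)"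
    by (simp add: sum.distrib)
  finally show ?thesis .
qed

lemma stein_system_affine: "stein_system n (\<lambda>x j. \<mu> j + (\<Sum>k<n. A k j * x k)) (\<lambda>x. A)"
  unfolding stein_system_def by (intro allI impI gauss_W12_affine)

text \<open>Since columns are gradients, a field with constant gradient matrix A has linear part the
  transpose of A applied to x. The quadratic form does not see the transpose, so the result is still
  \<open>xi_lin\<close> with A.\<close>

lemma gxi_affine: "gxi n (\<lambda>x j. \<mu> j + (\<Sum>k<n. A k j * x k)) (\<lambda>x. A) = gxi_lin n \<mu> A"
proof
  fix x
  have "(\<Sum>j<n. x j * (\<Sum>k<n. A k j * x k)) = (\<Sum>k<n. x k * (\<Sum>j<n. A k j * x j))"
    unfolding sum_distrib_left by (subst sum.swap) (simp add: mult_ac)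
  then show "gxi n (\<lambda>x j. \<mu> j + (\<Sum>k<n. A k j * x k)) (\<lambda>x. A) x = gxi_lin n \<mu> A x"
    by (simp add: xi_def xi_lin_def mvec_def distrib_left sum.distrib)
qed

lemma L2_gxi_lin: "gxi_lin n \<mu> A \<in> L2_space (gauss n)"
  using stein_system_L2(3)[OF stein_system_affine[of n \<mu> A]] by (simp add: gxi_affine)

text \<open>In matrix terms \<mu> . \<nu> plus the Frobenius inner product of A and B plus trace (A
  B), that is \<mu> . \<nu> plus twice the Frobenius inner product of the symmetric parts.\<close>

definition lin_inner :: "nat \<Rightarrow> rvec \<Rightarrow> rmat \<Rightarrow> rvec \<Rightarrow> rmat \<Rightarrow> real" where
  "lin_inner n \<mu> A \<nu> B = (\<Sum>j<n. \<mu> j * \<nu> j) + (\<Sum>i<n. \<Sum>j<n. A i j * B i j) + (\<Sum>i<n. \<Sum>j<n. A j i * B i j)"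

text \<open>Against an affine field the Stein formula involves \<open>f\<close> and \<open>G\<close>
  only through their means. This is why the means determine every projection.\<close>

lemma gxi_gxi_lin_inner:
  assumes S: "stein_system n f G"
    and \<mu>: "\<And>j. j < n \<Longrightarrow> \<mu> j = (\<integral>x. f x j \<partial>gauss n)"
    and A: "\<And>i j. i < n \<Longrightarrow> j < n \<Longrightarrow> A i j = (\<integral>x. G x i j \<partial>gauss n)"
  shows "(\<integral>x. gxi n f G x * gxi_lin n \<nu> B x \<partial>gauss n) = lin_inner n \<mu> A \<nu> B"
proof -
  have "(\<integral>x. gxi n f G x * gxi_lin n \<nu> B x \<partial>gauss n)
     = (\<Sum>j<n. \<integral>x. f x j * (\<nu> j + (\<Sum>k<n. B k j * x k)) \<partial>gauss n) + (\<Sum>i<n. \<Sum>j<n. \<integral>x. G x j i * B i j \<partial>gauss n)"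
    using second_order_Stein[OF S stein_system_affine[of n \<nu> B]] by (simp add: gxi_affine)
  also have "(\<Sum>j<n. \<integral>x. f x j * (\<nu> j + (\<Sum>k<n. B k j * x k)) \<partial>gauss n)
     = (\<Sum>j<n. \<mu> j * \<nu> j + (\<Sum>k<n. A k j * B k j))"
  proof (rule sum.cong[OF refl])
    fix j assume "j \<in> {..<n}"
    then have j: "j < n" by simp
    show "(\<integral>x. f x j * (\<nu> j + (\<Sum>k<n. B k j * x k)) \<partial>gauss n) = \<mu> j * \<nu> j + (\<Sum>k<n. A k j * B k j)"
      unfolding gauss_W12_inner_affine[OF stein_systemD[OF S j]] by (simp add: \<mu> A j mult.commute)
  qed
  also have "(\<Sum>i<n. \<Sum>j<n. \<integral>x. G x j i * B i j \<partial>gauss n) = (\<Sum>i<n. \<Sum>j<n. A j i * B i j)"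
    by (intro sum.cong) (auto simp: A)
  also have "(\<Sum>j<n. \<mu> j * \<nu> j + (\<Sum>k<n. A k j * B k j)) = (\<Sum>j<n. \<mu> j * \<nu> j) + (\<Sum>i<n. \<Sum>j<n. A i j * B i j)"
    unfolding sum.distrib by (subst (2) sum.swap) simp
  finally show ?thesis by (simp add: lin_inner_def)
qed

lemma gxi_lin_inner: "(\<integral>x. gxi_lin n \<mu> A x * gxi_lin n \<nu> B x \<partial>gauss n) = lin_inner n \<mu> A \<nu> B"
  using gxi_gxi_lin_inner[OF stein_system_affine, of n \<mu> \<mu> A A \<nu> B] gauss.prob_space
  by (simp add: gxi_affine gauss_affine_mean)

lemma vnorm_square: "(vnorm n v)\<^sup>2 = (\<Sum>i<n. (v i)\<^sup>2)"
  by (simp add: L2_set_def sum_nonneg)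

lemma fnorm_square: "(fnorm n A)\<^sup>2 = (\<Sum>i<n. \<Sum>j<n. (A i j)\<^sup>2)"
  by (simp add: fnorm_def L2_set_def sum_nonneg case_prod_unfold sum.cartesian_product)

lemma mtrace_mmul: "mtrace n (mmul n A B) = (\<Sum>i<n. \<Sum>j<n. A i j * B j i)"
  by (simp add: mtrace_def mmul_def)

lemma fnorm_sym_part_square:
  "2 * (fnorm n (sym_part A))\<^sup>2 = (\<Sum>i<n. \<Sum>j<n. (A i j)\<^sup>2) + (\<Sum>i<n. \<Sum>j<n. A i j * A j i)"
proof -
  have "2 * (fnorm n (sym_part A))\<^sup>2 = (\<Sum>i<n. \<Sum>j<n. (A i j)\<^sup>2/2 + (A j i)\<^sup>2/2 + A i j * A j i)"
    unfolding fnorm_square sum_distrib_left sym_part_def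
    by (intro sum.cong refl) (simp add: power2_eq_square field_simps)
  also have "\<dots> = (\<Sum>i<n. \<Sum>j<n. (A i j)\<^sup>2/2) + (\<Sum>i<n. \<Sum>j<n. (A j i)\<^sup>2/2) + (\<Sum>i<n. \<Sum>j<n. A i j * A j i)"
    by (simp add: sum.distrib)
  also have "(\<Sum>i<n. \<Sum>j<n. (A j i)\<^sup>2/2) = (\<Sum>i<n. \<Sum>j<n. (A i j)\<^sup>2/2)" by (rule sum.swap)
  finally show ?thesis by (simp add: sum_divide_distrib[symmetric])
qed

lemma lin_inner_self: "lin_inner n \<mu> A \<mu> A = (vnorm n \<mu>)\<^sup>2 + 2 * (fnorm n (sym_part A))\<^sup>2"
  unfolding fnorm_sym_part_square vnorm_square lin_inner_def by (simp add: power2_eq_square mult.commute)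

lemma gxi_lin_square: "(\<integral>x. (gxi_lin n \<mu> A x)\<^sup>2 \<partial>gauss n) = (vnorm n \<mu>)\<^sup>2 + 2 * (fnorm n (sym_part A))\<^sup>2"
  using gxi_lin_inner[of n \<mu> A \<mu> A] by (simp add: lin_inner_self power2_eq_square)

lemma L2_diff_square:
  assumes "u \<in> L2_space M" "v \<in> L2_space M"
  shows "(\<integral>x. (u x - v x)\<^sup>2 \<partial>M) = (\<integral>x. (u x)\<^sup>2 \<partial>M) - 2 * (\<integral>x. u x * v x \<partial>M) + (\<integral>x. (v x)\<^sup>2 \<partial>M)"
proof -
  have "(\<integral>x. (u x - v x)\<^sup>2 \<partial>M) = (\<integral>x. (u x)\<^sup>2 - 2 * (u x * v x) + (v x)\<^sup>2 \<partial>M)"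
    by (rule Bochner_Integration.integral_cong) (auto simp: power2_eq_square algebra_simps)
  then show ?thesis using assms by (simp add: L2_mult_integrable L2_square_integrable)
qed

text \<open>Works entirely on Gaussian space; the means are prescribed for indices below
  \<open>n\<close> only, the only ones that enter norms and traces.\<close>

locale stein_means =
  fixes n :: nat and f :: "rvec \<Rightarrow> rvec" and G :: "rvec \<Rightarrow> rmat" and \<mu> :: rvec and A :: rmat
  assumes S: "stein_system n f G"
    and \<mu>: "j < n \<Longrightarrow> \<mu> j = (\<integral>x. f x j \<partial>gauss n)"
    and A: "i < n \<Longrightarrow> j < n \<Longrightarrow> A i j = (\<integral>x. G x i j \<partial>gauss n)"
begin

lemma inner_lin: "(\<integral>x. gxi n f G x * gxi_lin n \<nu> B x \<partial>gauss n) = lin_inner n \<mu> A \<nu> B"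
  by (rule gxi_gxi_lin_inner[OF S \<mu> A])

lemma centered_f_square:
  "(\<integral>x. (vnorm n (\<lambda>i. f x i - \<mu> i))\<^sup>2 \<partial>gauss n) = (\<Sum>j<n. (\<integral>x. (f x j)\<^sup>2 \<partial>gauss n) - (\<mu> j)\<^sup>2)"
proof -
  have "(\<integral>x. (vnorm n (\<lambda>i. f x i - \<mu> i))\<^sup>2 \<partial>gauss n) = (\<Sum>j<n. \<integral>x. (f x j - \<mu> j)\<^sup>2 \<partial>gauss n)"
    unfolding vnorm_square
    by (rule Bochner_Integration.integral_sum)
       (intro L2_square_integrable L2_diff stein_system_L2(1)[OF S] gauss.L2_const, simp)
  also have "\<dots> = (\<Sum>j<n. (\<integral>x. (f x j)\<^sup>2 \<partial>gauss n) - (\<mu> j)\<^sup>2)"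
  proof (rule sum.cong[OF refl])
    fix j assume "j \<in> {..<n}"
    then have j: "j < n" by simp
    show "(\<integral>x. (f x j - \<mu> j)\<^sup>2 \<partial>gauss n) = (\<integral>x. (f x j)\<^sup>2 \<partial>gauss n) - (\<mu> j)\<^sup>2"
      unfolding L2_diff_square[OF stein_system_L2(1)[OF S j] gauss.L2_const]
      using \<mu>[OF j, symmetric] gauss.prob_space by (simp add: power2_eq_square)
  qed
  finally show ?thesis .
qed

lemma D_L2: "i < n \<Longrightarrow> j < n \<Longrightarrow> (\<lambda>x. G x i j - A i j) \<in> L2_space (gauss n)"
  by (intro L2_diff stein_system_L2(2)[OF S] gauss.L2_const)

lemma D_inner:
  assumes "i < n" "j < n" "k < n" "l < n"
  shows "(\<integral>x. (G x i j - A i j) * (G x k l - A k l) \<partial>gauss n) = (\<integral>x. G x i j * G x k l \<partial>gauss n) - A i j * A k l"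
proof -
  note L = stein_system_L2(2)[OF S assms(1,2)] stein_system_L2(2)[OF S assms(3,4)]
  have "(\<integral>x. (G x i j - A i j) * (G x k l - A k l) \<partial>gauss n)
    = (\<integral>x. G x i j * G x k l - A k l * G x i j - A i j * G x k l + A i j * A k l \<partial>gauss n)"
    by (rule Bochner_Integration.integral_cong) (auto simp: algebra_simps)
  also have "\<dots> = (\<integral>x. G x i j * G x k l \<partial>gauss n) - A k l * A i j - A i j * A k l + A i j * A k l"
    using L2_mult_integrable[OF L] gauss.L2_integrable[OF L(1)] gauss.L2_integrable[OF L(2)] gauss.prob_space
    by (simp add: A assms)
  finally show ?thesis by simp
qed

lemma trace_D_square:
  "(\<integral>x. mtrace n (mmul n (\<lambda>i j. G x i j - A i j) (\<lambda>i j. G x i j - A i j)) \<partial>gauss n)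
    = (\<Sum>i<n. \<Sum>j<n. (\<integral>x. G x i j * G x j i \<partial>gauss n) - A i j * A j i)"
proof -
  have "(\<integral>x. mtrace n (mmul n (\<lambda>i j. G x i j - A i j) (\<lambda>i j. G x i j - A i j)) \<partial>gauss n)
    = (\<Sum>i<n. \<Sum>j<n. \<integral>x. (G x i j - A i j) * (G x j i - A j i) \<partial>gauss n)"
    unfolding mtrace_mmul
    by (subst Bochner_Integration.integral_sum, intro Bochner_Integration.integrable_sum L2_mult_integrable D_L2)
       (auto intro!: sum.cong Bochner_Integration.integral_sum L2_mult_integrable D_L2)
  then show ?thesis by (simp add: D_inner)
qed

lemma integral_fnorm_sym_square:
  assumes "\<And>i j. i < n \<Longrightarrow> j < n \<Longrightarrow> (\<lambda>x. K x i j) \<in> L2_space (gauss n)"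
  shows "2 * (\<integral>x. (fnorm n (sym_part (K x)))\<^sup>2 \<partial>gauss n)
    = (\<Sum>i<n. \<Sum>j<n. \<integral>x. (K x i j)\<^sup>2 \<partial>gauss n) + (\<Sum>i<n. \<Sum>j<n. \<integral>x. K x i j * K x j i \<partial>gauss n)"
proof -
  have i1: "integrable (gauss n) (\<lambda>x. \<Sum>i<n. \<Sum>j<n. (K x i j)\<^sup>2)"
    and i2: "integrable (gauss n) (\<lambda>x. \<Sum>i<n. \<Sum>j<n. K x i j * K x j i)"
    by (intro Bochner_Integration.integrable_sum L2_square_integrable L2_mult_integrable assms; simp)+
  have "2 * (\<integral>x. (fnorm n (sym_part (K x)))\<^sup>2 \<partial>gauss n) = (\<integral>x. 2 * (fnorm n (sym_part (K x)))\<^sup>2 \<partial>gauss n)" by simp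
  also have "\<dots> = (\<integral>x. (\<Sum>i<n. \<Sum>j<n. (K x i j)\<^sup>2) \<partial>gauss n) + (\<integral>x. (\<Sum>i<n. \<Sum>j<n. K x i j * K x j i) \<partial>gauss n)"
    unfolding fnorm_sym_part_square by (rule Bochner_Integration.integral_add[OF i1 i2])
  also have "(\<integral>x. (\<Sum>i<n. \<Sum>j<n. (K x i j)\<^sup>2) \<partial>gauss n) = (\<Sum>i<n. \<Sum>j<n. \<integral>x. (K x i j)\<^sup>2 \<partial>gauss n)"
    by (subst Bochner_Integration.integral_sum, intro Bochner_Integration.integrable_sum L2_square_integrable assms)
       (auto intro!: sum.cong Bochner_Integration.integral_sum L2_square_integrable assms)
  also have "(\<integral>x. (\<Sum>i<n. \<Sum>j<n. K x i j * K x j i) \<partial>gauss n) = (\<Sum>i<n. \<Sum>j<n. \<integral>x. K x i j * K x j i \<partial>gauss n)"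
    by (subst Bochner_Integration.integral_sum, intro Bochner_Integration.integrable_sum L2_mult_integrable assms)
       (auto intro!: sum.cong Bochner_Integration.integral_sum L2_mult_integrable assms)
  finally show ?thesis .
qed

lemma xi_square: "(\<integral>x. (gxi n f G x)\<^sup>2 \<partial>gauss n)
    = (\<Sum>j<n. \<integral>x. (f x j)\<^sup>2 \<partial>gauss n) + (\<Sum>i<n. \<Sum>j<n. \<integral>x. G x i j * G x j i \<partial>gauss n)"
  using second_order_Stein[OF S S] by (simp add: power2_eq_square mult.commute)

text \<open>Pythagoras: \<xi> has the same inner product with its linear-quadratic part as that part
  has with itself.\<close>

lemma xi_minus_lin_square:
  "(\<integral>x. (gxi n f G x - gxi_lin n \<mu> A x)\<^sup>2 \<partial>gauss n)
    = (\<integral>x. (gxi n f G x)\<^sup>2 \<partial>gauss n) - ((vnorm n \<mu>)\<^sup>2 + 2 * (fnorm n (sym_part A))\<^sup>2)"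
  unfolding L2_diff_square[OF stein_system_L2(3)[OF S] L2_gxi_lin]
  by (simp add: inner_lin lin_inner_self gxi_lin_square)

lemma xi_minus_lin_square_formula:
  "(\<integral>x. (gxi n f G x - gxi_lin n \<mu> A x)\<^sup>2 \<partial>gauss n)
    = (\<integral>x. (vnorm n (\<lambda>i. f x i - \<mu> i))\<^sup>2 \<partial>gauss n) - (fnorm n A)\<^sup>2
      + (\<integral>x. mtrace n (mmul n (\<lambda>i j. G x i j - A i j) (\<lambda>i j. G x i j - A i j)) \<partial>gauss n)"
  unfolding xi_minus_lin_square xi_square centered_f_square trace_D_square fnorm_sym_part_square
  by (simp add: vnorm_square fnorm_square sum_subtractf)

text \<open>Poincare for the residual of \<open>f x j\<close> after subtracting the affine function
  \<open>l\<close> with the same mean and the same mean gradient. Since the inner product of f_j and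
  l equals the squared norm of l, the squared norm of the residual is a difference of
  squares.\<close>

lemma centered_affine_Poincare:
  assumes j: "j < n"
  shows "(\<integral>x. (f x j)\<^sup>2 \<partial>gauss n) - (\<mu> j)\<^sup>2 - (\<Sum>k<n. (A k j)\<^sup>2)
    \<le> (\<Sum>i<n. \<integral>x. (G x i j - A i j)\<^sup>2 \<partial>gauss n)"
proof -
  define l where "l = (\<lambda>x :: rvec. \<mu> j + (\<Sum>k<n. A k j * x k))"
  have Wl: "gauss_W12 n l (\<lambda>i x. A i j)" unfolding l_def by (rule gauss_W12_affine)
  have Wm: "gauss_W12 n (\<lambda>x. - \<mu> j + (\<Sum>k<n. - A k j * x k)) (\<lambda>i x. - A i j)"
    by (rule gauss_W12_affine)
  have "gauss_W12 n (\<lambda>x. f x j + (- \<mu> j + (\<Sum>k<n. - A k j * x k))) (\<lambda>i x. G x i j + (- A i j))"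
    by (rule gauss_W12_add[OF stein_systemD[OF S j] Wm])
  then have W: "gauss_W12 n (\<lambda>x. f x j - l x) (\<lambda>i x. G x i j - A i j)"
    by (simp add: l_def sum_negf algebra_simps)
  have Lf: "(\<lambda>x. f x j) \<in> L2_space (gauss n)" and Ll: "l \<in> L2_space (gauss n)"
    using stein_system_L2(1)[OF S j] gauss_W12D(1)[OF Wl] by auto
  have ml: "(\<integral>x. l x \<partial>gauss n) = \<mu> j" unfolding l_def by (rule gauss_affine_mean)
  have mean: "(\<integral>x. f x j - l x \<partial>gauss n) = 0"
    using gauss.L2_integrable[OF Lf] gauss.L2_integrable[OF Ll] ml \<mu>[OF j] by simp
  have fl: "(\<integral>x. f x j * l x \<partial>gauss n) = (\<mu> j)\<^sup>2 + (\<Sum>k<n. (A k j)\<^sup>2)"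
    unfolding l_def gauss_W12_inner_affine[OF stein_systemD[OF S j]] \<mu>[OF j, symmetric]
    by (simp add: power2_eq_square A[OF _ j, symmetric])
  have ll: "(\<integral>x. (l x)\<^sup>2 \<partial>gauss n) = (\<mu> j)\<^sup>2 + (\<Sum>k<n. (A k j)\<^sup>2)"
  proof -
    have "(\<integral>x. (l x)\<^sup>2 \<partial>gauss n) = (\<integral>x. l x * (\<mu> j + (\<Sum>k<n. A k j * x k)) \<partial>gauss n)"
      by (simp add: l_def power2_eq_square)
    then show ?thesis
      unfolding gauss_W12_inner_affine[OF Wl] ml using gauss.prob_space by (simp add: power2_eq_square)
  qed
  show ?thesis
    using gauss_Poincare[OF W mean] L2_diff_square[OF Lf Ll] fl ll by simp
qed

lemma xi_minus_lin_square_le: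
  "(\<integral>x. (gxi n f G x - gxi_lin n \<mu> A x)\<^sup>2 \<partial>gauss n)
    \<le> 2 * (\<integral>x. (fnorm n (sym_part (\<lambda>i j. G x i j - A i j)))\<^sup>2 \<partial>gauss n)"
proof -
  have "(\<Sum>j<n. (\<integral>x. (f x j)\<^sup>2 \<partial>gauss n) - (\<mu> j)\<^sup>2 - (\<Sum>k<n. (A k j)\<^sup>2))
     \<le> (\<Sum>j<n. \<Sum>i<n. \<integral>x. (G x i j - A i j)\<^sup>2 \<partial>gauss n)"
    by (intro sum_mono centered_affine_Poincare) simp
  also have "\<dots> = (\<Sum>i<n. \<Sum>j<n. \<integral>x. (G x i j - A i j)\<^sup>2 \<partial>gauss n)" by (rule sum.swap)
  finally have "(\<integral>x. (vnorm n (\<lambda>i. f x i - \<mu> i))\<^sup>2 \<partial>gauss n) - (fnorm n A)\<^sup>2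
     \<le> (\<Sum>i<n. \<Sum>j<n. \<integral>x. (G x i j - A i j)\<^sup>2 \<partial>gauss n)"
    unfolding centered_f_square fnorm_square sum_subtractf sum.swap[of "\<lambda>j k. (A k j)\<^sup>2"] .
  moreover have "2 * (\<integral>x. (fnorm n (sym_part (\<lambda>i j. G x i j - A i j)))\<^sup>2 \<partial>gauss n)
     = (\<Sum>i<n. \<Sum>j<n. \<integral>x. (G x i j - A i j)\<^sup>2 \<partial>gauss n)
      + (\<integral>x. mtrace n (mmul n (\<lambda>i j. G x i j - A i j) (\<lambda>i j. G x i j - A i j)) \<partial>gauss n)"
  proof -
    have "2 * (\<integral>x. (fnorm n (sym_part (\<lambda>i j. G x i j - A i j)))\<^sup>2 \<partial>gauss n)
      = (\<Sum>i<n. \<Sum>j<n. \<integral>x. (G x i j - A i j)\<^sup>2 \<partial>gauss n)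
        + (\<Sum>i<n. \<Sum>j<n. \<integral>x. (G x i j - A i j) * (G x j i - A j i) \<partial>gauss n)"
      by (rule integral_fnorm_sym_square[of "\<lambda>x i j. G x i j - A i j"]) (rule D_L2)
    then show ?thesis unfolding trace_D_square by (simp add: D_inner)
  qed
  ultimately show ?thesis unfolding xi_minus_lin_square_formula by linarith
qed

text \<open>The centred gradient has mean zero, so the cross term with the constant matrix A
  vanishes.\<close>

lemma sym_square_decomposition:
  "2 * (\<integral>x. (fnorm n (sym_part (G x)))\<^sup>2 \<partial>gauss n)
    = 2 * (fnorm n (sym_part A))\<^sup>2 + 2 * (\<integral>x. (fnorm n (sym_part (\<lambda>i j. G x i j - A i j)))\<^sup>2 \<partial>gauss n)"
proof -
  have sq: "(\<integral>x. (G x i j - A i j)\<^sup>2 \<partial>gauss n) = (\<integral>x. (G x i j)\<^sup>2 \<partial>gauss n) - (A i j)\<^sup>2"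
    if "i < n" "j < n" for i j
    using D_inner[OF that that] by (simp add: power2_eq_square)
  have "2 * (\<integral>x. (fnorm n (sym_part (G x)))\<^sup>2 \<partial>gauss n)
    = (\<Sum>i<n. \<Sum>j<n. \<integral>x. (G x i j)\<^sup>2 \<partial>gauss n) + (\<Sum>i<n. \<Sum>j<n. \<integral>x. G x i j * G x j i \<partial>gauss n)"
    by (rule integral_fnorm_sym_square[of G]) (rule stein_system_L2(2)[OF S])
  moreover have "2 * (\<integral>x. (fnorm n (sym_part (\<lambda>i j. G x i j - A i j)))\<^sup>2 \<partial>gauss n)
    = (\<Sum>i<n. \<Sum>j<n. \<integral>x. (G x i j - A i j)\<^sup>2 \<partial>gauss n)
      + (\<Sum>i<n. \<Sum>j<n. \<integral>x. (G x i j - A i j) * (G x j i - A j i) \<partial>gauss n)"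
    by (rule integral_fnorm_sym_square[of "\<lambda>x i j. G x i j - A i j"]) (rule D_L2)
  ultimately show ?thesis
    using fnorm_sym_part_square[of n A] by (simp add: D_inner sq sum_subtractf)
qed

end

section \<open>Projections onto the first two chaoses\<close>


text \<open>Each of the three subspaces is the image under \<open>xi_lin\<close> of a set of
  parameters, so a single projection lemma covers them.\<close>

lemma H12_eq: "H12 n z = {xi_lin n z \<mu> A | \<mu> A. True}"
proof -
  have "(\<lambda>\<omega>. (\<Sum>i<n. \<mu> i * z \<omega> i) + (\<Sum>i<n. z \<omega> i * mvec n A (z \<omega>) i) - mtrace n A) = xi_lin n z \<mu> A" for \<mu> A
    by (simp add: xi_lin_def fun_eq_iff distrib_left sum.distrib mult.commute)
  then show ?thesis by (simp add: H12_def)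
qed

lemma H1_eq: "H1 n z = {xi_lin n z \<mu> (\<lambda>i j. 0) | \<mu>. True}"
proof -
  have "(\<lambda>\<omega>. \<Sum>i<n. \<mu> i * z \<omega> i) = xi_lin n z \<mu> (\<lambda>i j. 0)" for \<mu>
    by (simp add: xi_lin_def mvec_def mtrace_def fun_eq_iff mult.commute)
  then show ?thesis by (simp add: H1_def)
qed

lemma H2_eq: "H2 n z = {xi_lin n z (\<lambda>i. 0) A | A. True}"
  by (simp add: H2_def xi_lin_def[abs_def])

locale stein_data =
  fixes n :: nat and M :: "'a measure" and z :: "'a \<Rightarrow> rvec" and f :: "rvec \<Rightarrow> rvec" and G :: "rvec \<Rightarrow> rmat"
  assumes model: "stein_model n M z f G"
begin

lemma z_measurable: "z \<in> M \<rightarrow>\<^sub>M borel_n n" and distr_z: "distr M (borel_n n) z = gauss n"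
  using model by (auto simp: stein_model_def std_gaussian_vector_def)

lemma M_prob_space: "prob_space M"
  using model by (auto simp: stein_model_def)

lemma integral_z:
  fixes \<phi> :: "rvec \<Rightarrow> 'b::{banach, second_countable_topology}"
  shows "\<phi> \<in> borel_measurable (borel_n n) \<Longrightarrow> (\<integral>\<omega>. \<phi> (z \<omega>) \<partial>M) = (\<integral>x. \<phi> x \<partial>gauss n)"
  using integral_distr[OF z_measurable, of \<phi>] by (simp add: distr_z)

lemma integrable_z:
  fixes \<phi> :: "rvec \<Rightarrow> 'b::{banach, second_countable_topology}"
  shows "\<phi> \<in> borel_measurable (borel_n n) \<Longrightarrow> integrable M (\<lambda>\<omega>. \<phi> (z \<omega>)) \<longleftrightarrow> integrable (gauss n) \<phi>"
  using integrable_distr_eq[OF z_measurable, of \<phi>] by (simp add: distr_z)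

lemma L2_gauss_measurable: "u \<in> L2_space (gauss n) \<Longrightarrow> u \<in> borel_measurable (borel_n n)"
  using L2_measurable[of u "gauss n"] by (simp add: measurable_gauss_iff)

lemma L2_z:
  assumes u: "u \<in> L2_space (gauss n)"
  shows "(\<lambda>\<omega>. u (z \<omega>)) \<in> L2_space M"
proof -
  note um = L2_gauss_measurable[OF u]
  have "integrable M (\<lambda>\<omega>. (u (z \<omega>))\<^sup>2)"
    by (subst integrable_z[of "\<lambda>x. (u x)\<^sup>2"]) (use um u in \<open>simp_all add: L2_square_integrable\<close>)
  moreover have "(\<lambda>\<omega>. u (z \<omega>)) \<in> borel_measurable M"
    by (rule measurable_compose[OF z_measurable um])
  ultimately show ?thesis by (simp add: L2_space_def)
qed

lemma system: "stein_system n f G"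
  unfolding stein_system_def
proof (intro allI impI)
  fix j assume j: "j < n"
  have wg: "has_weak_gradient n (\<lambda>x. f x j) (\<lambda>x i. G x i j)"
    and fi: "integrable M (\<lambda>\<omega>. (f (z \<omega>) j)\<^sup>2)"
    and gi: "integrable M (\<lambda>\<omega>. (vnorm n (\<lambda>i. G (z \<omega>) i j))\<^sup>2)"
    using model j by (auto simp: stein_model_def)
  have fm: "(\<lambda>x. f x j) \<in> borel_measurable (borel_n n)"
    and gm: "\<And>i. i < n \<Longrightarrow> (\<lambda>x. G x i j) \<in> borel_measurable (borel_n n)"
    using wg by (auto simp: has_weak_gradient_def loc_integrable_def measurable_gauss_iff)
  have vm: "(\<lambda>x. (vnorm n (\<lambda>i. G x i j))\<^sup>2) \<in> borel_measurable (borel_n n)"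
    unfolding vnorm_square using gm by (intro borel_measurable_sum borel_measurable_power) auto
  show "gauss_W12 n (\<lambda>x. f x j) (\<lambda>i x. G x i j)"
  proof (rule weak_gradient_gauss_W12[OF wg])
    show "(\<lambda>x. f x j) \<in> L2_space (gauss n)"
      using integrable_z[of "\<lambda>x. (f x j)\<^sup>2"] fm fi by (simp add: L2_space_def measurable_gauss_iff)
    fix i assume i: "i < n"
    have V: "integrable (gauss n) (\<lambda>x. (vnorm n (\<lambda>i. G x i j))\<^sup>2)" using integrable_z[OF vm] gi by simp
    have "integrable (gauss n) (\<lambda>x. (G x i j)\<^sup>2)"
    proof (rule Bochner_Integration.integrable_bound[OF V])
      show "(\<lambda>x. (G x i j)\<^sup>2) \<in> borel_measurable (gauss n)"
        using gm[OF i] by (simp add: measurable_gauss_iff)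
      have "(G x i j)\<^sup>2 \<le> (vnorm n (\<lambda>i. G x i j))\<^sup>2" for x
        unfolding vnorm_square using i by (intro member_le_sum) auto
      then show "AE x in gauss n. norm ((G x i j)\<^sup>2) \<le> norm ((vnorm n (\<lambda>i. G x i j))\<^sup>2)"
        by (intro AE_I2) simp
    qed
    then show "(\<lambda>x. G x i j) \<in> L2_space (gauss n)"
      using gm[OF i] by (simp add: L2_space_def measurable_gauss_iff)
  qed
qed

abbreviation "m \<equiv> mean_f M z f"
abbreviation "a \<equiv> mean_G M z G"

sublocale stein_means n f G m a
proof
  show "stein_system n f G" by (rule system)
  show "m j = (\<integral>x. f x j \<partial>gauss n)" if "j < n" for j
    unfolding mean_f_def using integral_z[OF L2_gauss_measurable[OF stein_system_L2(1)[OF system that]]] .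
  show "a i j = (\<integral>x. G x i j \<partial>gauss n)" if "i < n" "j < n" for i j
    unfolding mean_G_def using integral_z[OF L2_gauss_measurable[OF stein_system_L2(2)[OF system that]]] .
qed

lemma xi_z: "xi n z f G = (\<lambda>\<omega>. gxi n f G (z \<omega>))" "xi_lin n z \<nu> B = (\<lambda>\<omega>. gxi_lin n \<nu> B (z \<omega>))"
  by (simp_all add: fun_eq_iff xi_def xi_lin_def)

lemma L2_integral_z:
  assumes "u \<in> L2_space (gauss n)" "v \<in> L2_space (gauss n)"
  shows "(\<integral>\<omega>. u (z \<omega>) * v (z \<omega>) \<partial>M) = (\<integral>x. u x * v x \<partial>gauss n)"
    "(\<integral>\<omega>. (u (z \<omega>))\<^sup>2 \<partial>M) = (\<integral>x. (u x)\<^sup>2 \<partial>gauss n)"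
    "(\<integral>\<omega>. (u (z \<omega>) - v (z \<omega>))\<^sup>2 \<partial>M) = (\<integral>x. (u x - v x)\<^sup>2 \<partial>gauss n)"
    "h \<in> L2_space (gauss n) \<Longrightarrow>
      (\<integral>\<omega>. (u (z \<omega>) - v (z \<omega>)) * h (z \<omega>) \<partial>M) = (\<integral>x. u x * h x \<partial>gauss n) - (\<integral>x. v x * h x \<partial>gauss n)"
proof -
  note mm = L2_gauss_measurable[OF assms(1)] L2_gauss_measurable[OF assms(2)]
  show "(\<integral>\<omega>. u (z \<omega>) * v (z \<omega>) \<partial>M) = (\<integral>x. u x * v x \<partial>gauss n)"
    by (rule integral_z) (use mm in auto)
  show "(\<integral>\<omega>. (u (z \<omega>))\<^sup>2 \<partial>M) = (\<integral>x. (u x)\<^sup>2 \<partial>gauss n)"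
    by (rule integral_z) (use mm in auto)
  show "(\<integral>\<omega>. (u (z \<omega>) - v (z \<omega>))\<^sup>2 \<partial>M) = (\<integral>x. (u x - v x)\<^sup>2 \<partial>gauss n)"
    by (rule integral_z) (use mm in auto)
  assume h: "h \<in> L2_space (gauss n)"
  have "(\<integral>\<omega>. (u (z \<omega>) - v (z \<omega>)) * h (z \<omega>) \<partial>M) = (\<integral>x. (u x - v x) * h x \<partial>gauss n)"
    by (rule integral_z) (use mm L2_gauss_measurable[OF h] in auto)
  then show "(\<integral>\<omega>. (u (z \<omega>) - v (z \<omega>)) * h (z \<omega>) \<partial>M) = (\<integral>x. u x * h x \<partial>gauss n) - (\<integral>x. v x * h x \<partial>gauss n)"
    using L2_mult_integrable[OF assms(1) h] L2_mult_integrable[OF assms(2) h]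
    by (simp add: left_diff_distrib)
qed

text \<open>The predicate \<open>P\<close> selects the admissible parameters. Orthogonality of the
  error becomes an equality of values of \<open>lin_inner\<close>, so no Hilbert space projection
  theorem enters.\<close>

lemma projection_lin:
  assumes X: "X \<in> L2_space (gauss n)" and P: "P \<nu> B"
    and orth: "\<And>\<nu>' B'. P \<nu>' B' \<Longrightarrow> (\<integral>x. X x * gxi_lin n \<nu>' B' x \<partial>gauss n) = lin_inner n \<nu> B \<nu>' B'"
  shows "is_L2_projection M {xi_lin n z \<nu> B | \<nu> B. P \<nu> B} (\<lambda>\<omega>. X (z \<omega>)) (xi_lin n z \<nu> B)"
  unfolding is_L2_projection_def
proof (intro conjI ballI)
  show "(\<lambda>\<omega>. X (z \<omega>)) \<in> L2_space M" by (rule L2_z[OF X])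
  show "{xi_lin n z \<nu> B | \<nu> B. P \<nu> B} \<subseteq> L2_space M"
    using L2_z[OF L2_gxi_lin] by (auto simp: xi_z)
  show "xi_lin n z \<nu> B \<in> {xi_lin n z \<nu> B | \<nu> B. P \<nu> B}" using P by blast
  fix h assume "h \<in> {xi_lin n z \<nu> B | \<nu> B. P \<nu> B}"
  then obtain \<nu>' B' where h: "h = (\<lambda>\<omega>. gxi_lin n \<nu>' B' (z \<omega>))" and P': "P \<nu>' B'" by (auto simp: xi_z)
  show "(\<integral>\<omega>. (X (z \<omega>) - xi_lin n z \<nu> B \<omega>) * h \<omega> \<partial>M) = 0"
    unfolding h xi_z(2) L2_integral_z(4)[OF X L2_gxi_lin L2_gxi_lin] gxi_lin_inner orth[OF P'] by simp
qed

lemma lin_diff: "gxi_lin n m a x - gxi_lin n m (\<lambda>i j. 0) x = gxi_lin n (\<lambda>i. 0) a x"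
  "gxi_lin n m a x - gxi_lin n (\<lambda>i. 0) a x = gxi_lin n m (\<lambda>i j. 0) x"
  by (simp_all add: xi_lin_def mvec_def mtrace_def distrib_left sum.distrib)

lemma part1:
  "is_L2_projection M (H12 n z) (xi n z f G) (xi_lin n z m a)"
  "is_L2_projection M (H1 n z) (xi n z f G) (xi_lin n z m (\<lambda>i j. 0))"
  "is_L2_projection M (H1 n z) (xi_lin n z m a) (xi_lin n z m (\<lambda>i j. 0))"
  "is_L2_projection M (H2 n z) (xi n z f G) (xi_lin n z (\<lambda>i. 0) a)"
  "is_L2_projection M (H2 n z) (xi_lin n z m a) (xi_lin n z (\<lambda>i. 0) a)"
proof -
  have 12: "H12 n z = {xi_lin n z \<nu> B | \<nu> B. (\<lambda>_ _. True) \<nu> B}" by (simp add: H12_eq)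
  have 1: "H1 n z = {xi_lin n z \<nu> B | \<nu> B. (\<lambda>_ B. B = (\<lambda>i j. 0)) \<nu> B}" by (auto simp: H1_eq)
  have 2: "H2 n z = {xi_lin n z \<nu> B | \<nu> B. (\<lambda>\<nu> _. \<nu> = (\<lambda>i. 0)) \<nu> B}" by (auto simp: H2_eq)
  note L = stein_system_L2(3)[OF system] L2_gxi_lin
  show "is_L2_projection M (H12 n z) (xi n z f G) (xi_lin n z m a)"
    unfolding 12 xi_z(1) by (rule projection_lin[OF L(1)]) (simp_all add: inner_lin)
  show "is_L2_projection M (H1 n z) (xi n z f G) (xi_lin n z m (\<lambda>i j. 0))"
    unfolding 1 xi_z(1) by (rule projection_lin[OF L(1)]) (simp_all add: inner_lin, simp add: lin_inner_def)
  show "is_L2_projection M (H1 n z) (xi_lin n z m a) (xi_lin n z m (\<lambda>i j. 0))"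
    unfolding 1 by (subst xi_z(2), rule projection_lin[OF L(2)])
      (simp_all add: gxi_lin_inner, simp add: lin_inner_def)
  show "is_L2_projection M (H2 n z) (xi n z f G) (xi_lin n z (\<lambda>i. 0) a)"
    unfolding 2 xi_z(1) by (rule projection_lin[OF L(1)]) (simp_all add: inner_lin, simp add: lin_inner_def)
  show "is_L2_projection M (H2 n z) (xi_lin n z m a) (xi_lin n z (\<lambda>i. 0) a)"
    unfolding 2 by (subst xi_z(2), rule projection_lin[OF L(2)])
      (simp_all add: gxi_lin_inner, simp add: lin_inner_def)
qed

lemma integrals_z:
  "(\<integral>\<omega>. (vnorm n (\<lambda>i. f (z \<omega>) i - m i))\<^sup>2 \<partial>M) = (\<integral>x. (vnorm n (\<lambda>i. f x i - m i))\<^sup>2 \<partial>gauss n)"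
  "(\<integral>\<omega>. mtrace n (mmul n (\<lambda>i j. G (z \<omega>) i j - a i j) (\<lambda>i j. G (z \<omega>) i j - a i j)) \<partial>M)
    = (\<integral>x. mtrace n (mmul n (\<lambda>i j. G x i j - a i j) (\<lambda>i j. G x i j - a i j)) \<partial>gauss n)"
  "(\<integral>\<omega>. (fnorm n (sym_part (\<lambda>i j. G (z \<omega>) i j - a i j)))\<^sup>2 \<partial>M)
    = (\<integral>x. (fnorm n (sym_part (\<lambda>i j. G x i j - a i j)))\<^sup>2 \<partial>gauss n)"
  "(\<integral>\<omega>. (fnorm n (sym_part (G (z \<omega>))))\<^sup>2 \<partial>M) = (\<integral>x. (fnorm n (sym_part (G x)))\<^sup>2 \<partial>gauss n)"
proof -
  have fm: "(\<lambda>x. f x j) \<in> borel_measurable (borel_n n)" if "j < n" for j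
    using L2_gauss_measurable[OF stein_system_L2(1)[OF system that]] .
  have gm: "(\<lambda>x. G x i j) \<in> borel_measurable (borel_n n)" if "i < n" "j < n" for i j
    using L2_gauss_measurable[OF stein_system_L2(2)[OF system that]] .
  show "(\<integral>\<omega>. (vnorm n (\<lambda>i. f (z \<omega>) i - m i))\<^sup>2 \<partial>M) = (\<integral>x. (vnorm n (\<lambda>i. f x i - m i))\<^sup>2 \<partial>gauss n)"
    by (rule integral_z, unfold vnorm_square)
       (intro borel_measurable_sum borel_measurable_power borel_measurable_diff fm borel_measurable_const, simp)
  show "(\<integral>\<omega>. mtrace n (mmul n (\<lambda>i j. G (z \<omega>) i j - a i j) (\<lambda>i j. G (z \<omega>) i j - a i j)) \<partial>M)
    = (\<integral>x. mtrace n (mmul n (\<lambda>i j. G x i j - a i j) (\<lambda>i j. G x i j - a i j)) \<partial>gauss n)"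
    by (rule integral_z, unfold mtrace_mmul)
       (intro borel_measurable_sum borel_measurable_times borel_measurable_diff gm borel_measurable_const; simp)
  show "(\<integral>\<omega>. (fnorm n (sym_part (\<lambda>i j. G (z \<omega>) i j - a i j)))\<^sup>2 \<partial>M)
    = (\<integral>x. (fnorm n (sym_part (\<lambda>i j. G x i j - a i j)))\<^sup>2 \<partial>gauss n)"
    by (rule integral_z, unfold fnorm_square sym_part_def)
       (intro borel_measurable_sum borel_measurable_power borel_measurable_divide borel_measurable_add
          borel_measurable_diff gm borel_measurable_const; simp)
  show "(\<integral>\<omega>. (fnorm n (sym_part (G (z \<omega>))))\<^sup>2 \<partial>M) = (\<integral>x. (fnorm n (sym_part (G x)))\<^sup>2 \<partial>gauss n)"
    by (rule integral_z, unfold fnorm_square sym_part_def)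
       (intro borel_measurable_sum borel_measurable_power borel_measurable_divide borel_measurable_add
          gm borel_measurable_const; simp)
qed

lemma square_integrals:
  "(\<integral>\<omega>. (xi n z f G \<omega>)\<^sup>2 \<partial>M) = (\<integral>x. (gxi n f G x)\<^sup>2 \<partial>gauss n)"
  "(\<integral>\<omega>. (xi_lin n z \<nu> B \<omega>)\<^sup>2 \<partial>M) = (vnorm n \<nu>)\<^sup>2 + 2 * (fnorm n (sym_part B))\<^sup>2"
  "(\<integral>\<omega>. (xi n z f G \<omega> - xi_lin n z m a \<omega>)\<^sup>2 \<partial>M) = (\<integral>x. (gxi n f G x - gxi_lin n m a x)\<^sup>2 \<partial>gauss n)"
  unfolding xi_z
  by (rule L2_integral_z(2)[OF stein_system_L2(3)[OF system] stein_system_L2(3)[OF system]],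
      subst L2_integral_z(2)[OF L2_gxi_lin L2_gxi_lin], rule gxi_lin_square,
      rule L2_integral_z(3)[OF stein_system_L2(3)[OF system] L2_gxi_lin])

lemma norms_zero: "vnorm n (\<lambda>i. 0) = 0" "fnorm n (sym_part (\<lambda>i j. 0)) = 0"
  by (simp_all add: L2_set_def fnorm_def sym_part_def)

lemma lin_differences:
  "(\<integral>\<omega>. (xi_lin n z m a \<omega> - xi_lin n z m (\<lambda>i j. 0) \<omega>)\<^sup>2 \<partial>M) = 2 * (fnorm n (sym_part a))\<^sup>2"
  "(\<integral>\<omega>. (xi_lin n z m a \<omega> - xi_lin n z (\<lambda>i. 0) a \<omega>)\<^sup>2 \<partial>M) = (vnorm n m)\<^sup>2"
  using square_integrals(2)[of "\<lambda>i. 0" a] square_integrals(2)[of m "\<lambda>i j. 0"]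
  unfolding xi_z lin_diff by (simp_all add: norms_zero)

text \<open>The error estimate of part (1) gives E \<le> v + F + S, and the common denominator of
  the two bounds is exactly v + F + S by the decomposition of the gradient into mean and centred
  part.\<close>

lemma part2_bounds:
  assumes pos: "(\<integral>\<omega>. (xi n z f G \<omega>)\<^sup>2 \<partial>M) > 0"
  shows "eps12_sq n M z f G \<le> 2 * (\<integral>\<omega>. (fnorm n (sym_part (\<lambda>i j. G (z \<omega>) i j - a i j)))\<^sup>2 \<partial>M)
      / ((vnorm n m)\<^sup>2 + 2 * (\<integral>\<omega>. (fnorm n (sym_part (G (z \<omega>))))\<^sup>2 \<partial>M))"
    "eps2_sq n M z f G \<le> ((vnorm n m)\<^sup>2 + 2 * (\<integral>\<omega>. (fnorm n (sym_part (\<lambda>i j. G (z \<omega>) i j - a i j)))\<^sup>2 \<partial>M))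
      / ((vnorm n m)\<^sup>2 + 2 * (\<integral>\<omega>. (fnorm n (sym_part (G (z \<omega>))))\<^sup>2 \<partial>M))"
proof -
  define E where "E = (\<integral>x. (gxi n f G x)\<^sup>2 \<partial>gauss n)"
  define v where "v = (vnorm n m)\<^sup>2"
  define F where "F = 2 * (fnorm n (sym_part a))\<^sup>2"
  define S where "S = 2 * (\<integral>x. (fnorm n (sym_part (\<lambda>i j. G x i j - a i j)))\<^sup>2 \<partial>gauss n)"
  have E: "E > 0" using pos by (simp add: square_integrals E_def)
  have vF: "v \<ge> 0" "F \<ge> 0" by (simp_all add: v_def F_def)
  have x: "E - (v + F) \<le> S"
    using xi_minus_lin_square_le unfolding xi_minus_lin_square by (simp add: E_def v_def F_def S_def)
  have y: "0 \<le> E - (v + F)"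
  proof -
    have "0 \<le> (\<integral>x. (gxi n f G x - gxi_lin n m a x)\<^sup>2 \<partial>gauss n)" by simp
    then show ?thesis unfolding xi_minus_lin_square by (simp add: E_def v_def F_def)
  qed
  have T: "2 * (\<integral>x. (fnorm n (sym_part (G x)))\<^sup>2 \<partial>gauss n) = F + S"
    using sym_square_decomposition by (simp add: F_def S_def)
  have e12: "eps12_sq n M z f G = 1 - (v + F) / E" and e2: "eps2_sq n M z f G = 1 - F / E"
    unfolding eps12_sq_def eps2_sq_def square_integrals by (simp_all add: norms_zero v_def F_def E_def)
  \<comment> \<open>1 - c / E increases with E. Both bounds are instances, with c = v + F for the
    full projection and c = F for the second chaos alone.\<close>
  have key: "1 - c / E \<le> (v + F + S - c) / (v + F + S)" if "0 \<le> c" for c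
  proof -
    have "E \<le> v + F + S" using x by simp
    then have "c / (v + F + S) \<le> c / E" using that E by (intro divide_left_mono) auto
    moreover have "(v + F + S - c) / (v + F + S) = 1 - c / (v + F + S)"
      using \<open>E \<le> v + F + S\<close> E by (simp add: diff_divide_distrib)
    ultimately show ?thesis by simp
  qed
  show "eps12_sq n M z f G \<le> 2 * (\<integral>\<omega>. (fnorm n (sym_part (\<lambda>i j. G (z \<omega>) i j - a i j)))\<^sup>2 \<partial>M)
      / ((vnorm n m)\<^sup>2 + 2 * (\<integral>\<omega>. (fnorm n (sym_part (G (z \<omega>))))\<^sup>2 \<partial>M))"
    unfolding integrals_z T e12 S_def[symmetric] v_def[symmetric]
    using key[of "v + F"] vF by (simp add: add.assoc)
  show "eps2_sq n M z f G \<le> ((vnorm n m)\<^sup>2 + 2 * (\<integral>\<omega>. (fnorm n (sym_part (\<lambda>i j. G (z \<omega>) i j - a i j)))\<^sup>2 \<partial>M))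
      / ((vnorm n m)\<^sup>2 + 2 * (\<integral>\<omega>. (fnorm n (sym_part (G (z \<omega>))))\<^sup>2 \<partial>M))"
    unfolding integrals_z T e2 S_def[symmetric] v_def[symmetric]
    using key[of F] vF by (simp add: add.assoc add.left_commute)
qed

end

section \<open>Gaussian approximation in the first two chaoses\<close>


lemma vnorm_scale: "vnorm n (\<lambda>i. c * v i) = \<bar>c\<bar> * vnorm n v"
  by (simp add: L2_set_def power_mult_distrib sum_distrib_left[symmetric] real_sqrt_mult)

lemma mvec_scale: "mvec n A (\<lambda>i. c * v i) = (\<lambda>i. c * mvec n A v i)"
  by (simp add: mvec_def sum_distrib_left mult_ac)

lemma mvec_add: "mvec n A (\<lambda>i. u i + v i) = (\<lambda>i. mvec n A u i + mvec n A v i)"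
  by (simp add: mvec_def distrib_left sum.distrib)

lemma mvec_diff: "mvec n A (\<lambda>i. u i - v i) = (\<lambda>i. mvec n A u i - mvec n A v i)"
  by (simp add: mvec_def right_diff_distrib sum_subtractf)

lemma vnorm_zeroD: "vnorm n v = 0 \<Longrightarrow> i < n \<Longrightarrow> v i = 0"
  using L2_set_eq_0_iff[of "{..<n}" v] by simp

lemma vnorm_mvec_le_fnorm: "vnorm n (mvec n A v) \<le> fnorm n A * vnorm n v"
proof -
  have "(vnorm n (mvec n A v))\<^sup>2 \<le> (\<Sum>i<n. (\<Sum>j<n. (A i j)\<^sup>2) * (\<Sum>j<n. (v j)\<^sup>2))"
    unfolding vnorm_square mvec_def by (intro sum_mono Cauchy_Schwarz_ineq_sum)
  also have "\<dots> = (fnorm n A * vnorm n v)\<^sup>2"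
    unfolding power_mult_distrib fnorm_square vnorm_square by (simp add: sum_distrib_right)
  finally show ?thesis by (rule power2_le_imp_le) (simp add: fnorm_def)
qed

lemma opnorm_bdd: "bdd_above ((\<lambda>v. vnorm n (mvec n A v)) ` {v. vnorm n v \<le> 1})"
proof (rule bdd_aboveI2)
  fix v assume "v \<in> {v. vnorm n v \<le> 1}"
  then show "vnorm n (mvec n A v) \<le> fnorm n A * 1"
    using vnorm_mvec_le_fnorm[of n A v] mult_left_mono[of "vnorm n v" 1 "fnorm n A"] by (simp add: fnorm_def)
qed

lemma vnorm_mvec_le: "vnorm n (mvec n A v) \<le> opnorm n A * vnorm n v"
proof (cases "vnorm n v = 0")
  case True
  then have "mvec n A v i = 0" for i unfolding mvec_def using vnorm_zeroD by (intro sum.neutral) auto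
  then show ?thesis using True by (simp add: L2_set_def)
next
  case False
  then have pos: "vnorm n v > 0" using L2_set_nonneg[of v "{..<n}"] by linarith
  let ?w = "\<lambda>i. inverse (vnorm n v) * v i"
  have "vnorm n (mvec n A ?w) \<le> opnorm n A"
    unfolding opnorm_def by (rule cSUP_upper[OF _ opnorm_bdd]) (use pos in \<open>simp add: vnorm_scale\<close>)
  then show ?thesis using pos unfolding mvec_scale vnorm_scale by (simp add: field_simps)
qed

lemma opnorm_nonneg: "0 \<le> opnorm n A"
proof -
  have "vnorm n (mvec n A (\<lambda>i. 0)) \<le> opnorm n A"
    unfolding opnorm_def by (rule cSUP_upper[OF _ opnorm_bdd]) (simp add: L2_set_def)
  then show ?thesis using L2_set_nonneg order_trans by blast
qed

lemma opnorm_least: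
  assumes "\<And>v. vnorm n v \<le> 1 \<Longrightarrow> vnorm n (mvec n A v) \<le> r"
  shows "opnorm n A \<le> r"
  unfolding opnorm_def by (rule cSUP_least) (use assms in \<open>auto intro: exI[of _ "\<lambda>_. 0"] simp: L2_set_def\<close>)

lemma opnorm_le_fnorm: "opnorm n A \<le> fnorm n A"
proof (rule opnorm_least)
  fix v assume "vnorm n v \<le> 1"
  then show "vnorm n (mvec n A v) \<le> fnorm n A"
    using vnorm_mvec_le_fnorm[of n A v] mult_left_mono[of "vnorm n v" 1 "fnorm n A"] by (simp add: fnorm_def)
qed

lemma vnorm_mvec_square_le: "(vnorm n (mvec n A v))\<^sup>2 \<le> (opnorm n A)\<^sup>2 * (vnorm n v)\<^sup>2"
  using power_mono[OF vnorm_mvec_le L2_set_nonneg, of n A v 2] by (simp add: power_mult_distrib)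

text \<open>The squared Frobenius norm is the sum of the squared norms of the columns, and
  \<open>A\<close> acts on each column of \<open>B\<close>.\<close>

lemma fnorm_mmul_le: "(fnorm n (mmul n A B))\<^sup>2 \<le> (opnorm n A)\<^sup>2 * (fnorm n B)\<^sup>2"
proof -
  have col: "(fnorm n C)\<^sup>2 = (\<Sum>k<n. (vnorm n (\<lambda>i. C i k))\<^sup>2)" for C
    unfolding fnorm_square vnorm_square by (rule sum.swap)
  have "mmul n A B i k = mvec n A (\<lambda>j. B j k) i" for i k by (simp add: mmul_def mvec_def)
  then show ?thesis
    unfolding col sum_distrib_left using vnorm_mvec_square_le[of n A] by (simp add: sum_mono)
qed

lemma mvec_adjoint:
  assumes "\<And>i j. A i j = A j i"
  shows "(\<Sum>i<n. u i * mvec n A v i) = (\<Sum>i<n. mvec n A u i * v i)"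
  unfolding mvec_def sum_distrib_left sum_distrib_right
  by (subst sum.swap) (simp add: assms mult_ac)

definition qform :: "nat \<Rightarrow> rmat \<Rightarrow> rvec \<Rightarrow> real" where
  "qform n A v = (\<Sum>i<n. v i * mvec n A v i)"

lemma qform_scale: "qform n A (\<lambda>i. c * v i) = c\<^sup>2 * qform n A v"
  by (simp add: qform_def mvec_scale sum_distrib_left power2_eq_square mult_ac)

text \<open>Polarization: with u the unit vector along A v, 4 |A v| is the value of the form at u +
  v minus that at u - v, which the parallelogram law bounds by r (2 + 2 |v|^2). The maximum with 0
  covers negative \<open>r\<close>.\<close>

lemma opnorm_le_qform:
  assumes sym: "\<And>i j. A i j = A j i" and r: "\<And>v. \<bar>qform n A v\<bar> \<le> r * (vnorm n v)\<^sup>2"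
  shows "opnorm n A \<le> max r 0"
proof (rule opnorm_least)
  fix v assume v: "vnorm n v \<le> 1"
  define w where "w = mvec n A v"
  show "vnorm n (mvec n A v) \<le> max r 0"
  proof (cases "vnorm n w = 0")
    case False
    then have w: "vnorm n w > 0" using L2_set_nonneg[of w "{..<n}"] by linarith
    define u where "u = (\<lambda>i. inverse (vnorm n w) * w i)"
    have u1: "vnorm n u = 1" using w by (simp add: u_def vnorm_scale)
    have uw: "vnorm n w = (\<Sum>i<n. u i * mvec n A v i)"
    proof -
      have "(\<Sum>i<n. u i * mvec n A v i) = inverse (vnorm n w) * (vnorm n w)\<^sup>2"
        unfolding vnorm_square by (simp add: u_def w_def sum_distrib_left power2_eq_square mult_ac)
      then show ?thesis using w by (simp add: power2_eq_square)
    qed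
    have "qform n A (\<lambda>i. u i + v i) - qform n A (\<lambda>i. u i - v i) = 4 * (\<Sum>i<n. u i * mvec n A v i)"
    proof -
      have "qform n A (\<lambda>i. u i + v i) - qform n A (\<lambda>i. u i - v i)
        = 2 * (\<Sum>i<n. u i * mvec n A v i) + 2 * (\<Sum>i<n. mvec n A u i * v i)"
        unfolding qform_def mvec_add mvec_diff sum_subtractf[symmetric] sum_distrib_left sum.distrib[symmetric]
        by (rule sum.cong) (auto simp: algebra_simps)
      then show ?thesis using mvec_adjoint[where A = A and n = n and u = u and v = v, OF sym] by simp
    qed
    moreover have "(vnorm n (\<lambda>i. u i + v i))\<^sup>2 + (vnorm n (\<lambda>i. u i - v i))\<^sup>2 = 2 * (vnorm n u)\<^sup>2 + 2 * (vnorm n v)\<^sup>2"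
      unfolding vnorm_square sum.distrib[symmetric] sum_distrib_left
      by (rule sum.cong) (auto simp: power2_eq_square algebra_simps)
    then have "r * (vnorm n (\<lambda>i. u i + v i))\<^sup>2 + r * (vnorm n (\<lambda>i. u i - v i))\<^sup>2 = r * (2 + 2 * (vnorm n v)\<^sup>2)"
      using u1 by (simp add: distrib_left[symmetric])
    ultimately have "4 * vnorm n w \<le> r * (2 + 2 * (vnorm n v)\<^sup>2)"
      using r[of "\<lambda>i. u i + v i"] r[of "\<lambda>i. u i - v i"] unfolding uw by linarith
    also have "\<dots> \<le> max r 0 * (2 + 2 * (vnorm n v)\<^sup>2)" by (intro mult_right_mono) auto
    also have "\<dots> \<le> max r 0 * 4"
      using power_le_one[OF L2_set_nonneg v, of 2] by (intro mult_left_mono) auto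
    finally show ?thesis by (simp add: w_def)
  qed (simp add: w_def)
qed

text \<open>Giving up a factor 1/2 replaces the extremal eigenvector by a contradiction: if no such
  direction existed, the form would bound the operator norm by half of itself.\<close>

lemma opnorm_witness:
  assumes sym: "\<And>i j. A i j = A j i" and pos: "opnorm n A > 0"
  obtains q where "vnorm n q = 1" "opnorm n A / 2 \<le> \<bar>qform n A q\<bar>"
proof -
  have "\<not> (\<forall>v. \<bar>qform n A v\<bar> \<le> opnorm n A / 2 * (vnorm n v)\<^sup>2)"
    using opnorm_le_qform[where A = A and n = n and r = "opnorm n A / 2", OF sym] pos by auto
  then obtain v where v: "opnorm n A / 2 * (vnorm n v)\<^sup>2 < \<bar>qform n A v\<bar>" by (auto simp: not_le)
  have "vnorm n v \<noteq> 0"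
  proof
    assume "vnorm n v = 0"
    then have "qform n A v = 0" unfolding qform_def using vnorm_zeroD by (intro sum.neutral) auto
    then show False using v \<open>vnorm n v = 0\<close> by simp
  qed
  then have vp: "vnorm n v > 0" using L2_set_nonneg[of v "{..<n}"] by linarith
  show ?thesis
  proof (rule that[of "\<lambda>i. inverse (vnorm n v) * v i"])
    show "vnorm n (\<lambda>i. inverse (vnorm n v) * v i) = 1" using vp by (simp add: vnorm_scale)
    show "opnorm n A / 2 \<le> \<bar>qform n A (\<lambda>i. inverse (vnorm n v) * v i)\<bar>"
      unfolding qform_scale abs_mult using v vp by (simp add: field_simps power2_eq_square)
  qed
qed

section \<open>Integration by parts and the characteristic function of a quadratic
  polynomial\<close>

lemma gauss_integration_by_parts:
  fixes u du :: "rvec \<Rightarrow> complex"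
  assumes i: "i < n"
    and deriv: "\<And>x t. ((\<lambda>t. u (x(i := t))) has_vector_derivative du (x(i := t))) (at t)"
    and cont: "\<And>x. continuous_on UNIV (\<lambda>t. du (x(i := t)))"
    and bu: "\<And>x. \<exists>C a. \<forall>t. norm (u (x(i := t))) \<le> C * exp (a * \<bar>t\<bar>)"
    and bdu: "\<And>x. \<exists>C a. \<forall>t. norm (du (x(i := t))) \<le> C * exp (a * \<bar>t\<bar>)"
    and int1: "integrable (gauss n) (\<lambda>x. x i *\<^sub>R u x)" and int2: "integrable (gauss n) du"
  shows "(\<integral>x. x i *\<^sub>R u x \<partial>gauss n) = (\<integral>x. du x \<partial>gauss n)"
proof -
  define I where "I = {..<n} - {i}"
  have I: "finite I" "i \<notin> I" "insert i I = {..<n}" using i by (auto simp: I_def)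
  \<comment> \<open>One-dimensional Stein with the other coordinates frozen. The growth constants
    may depend on them; the two integrability hypotheses supply what Fubini needs.\<close>
  have slice: "(\<integral>t. t *\<^sub>R u (x(i := t)) \<partial>std_normal_distribution) = (\<integral>t. du (x(i := t)) \<partial>std_normal_distribution)" for x
  proof -
    obtain C a where C: "\<And>t. norm (u (x(i := t))) \<le> C * exp (a * \<bar>t\<bar>)" using bu by blast
    obtain D b where D: "\<And>t. norm (du (x(i := t))) \<le> D * exp (b * \<bar>t\<bar>)" using bdu by blast
    show ?thesis by (rule std_normal_stein(1)[OF deriv cont C D])
  qed
  have "(\<integral>x. x i *\<^sub>R u x \<partial>gauss n)
     = (\<integral>x. (\<integral>t. (x(i := t)) i *\<^sub>R u (x(i := t)) \<partial>std_normal_distribution) \<partial>(\<Pi>\<^sub>M i\<in>I. std_normal_distribution))"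
    using std_normals.product_integral_insert[OF I(1,2), of "\<lambda>x. x i *\<^sub>R u x"] int1 unfolding I(3) .
  also have "\<dots> = (\<integral>x. (\<integral>t. du (x(i := t)) \<partial>std_normal_distribution) \<partial>(\<Pi>\<^sub>M i\<in>I. std_normal_distribution))"
    by (simp add: slice)
  also have "\<dots> = (\<integral>x. du x \<partial>gauss n)"
    using std_normals.product_integral_insert[OF I(1,2), of du] int2 unfolding I(3) by simp
  finally show ?thesis .
qed

lemma gxi_mean:
  assumes S: "stein_system n f G"
  shows "(\<integral>x. gxi n f G x \<partial>gauss n) = 0"
proof -
  have one: "(\<integral>x. x j * f x j - G x j j \<partial>gauss n) = 0" if j: "j < n" for j
  proof -
    have sum: "(\<Sum>k<n. (if k = j then 1 else 0) * y k) = y j" for y :: "nat \<Rightarrow> real"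
      using j by (simp add: if_distrib[of "\<lambda>c. c * _"] cong: if_cong)
    have "(\<integral>x. f x j * x j \<partial>gauss n) = (\<integral>x. G x j j \<partial>gauss n)"
      using gauss_W12_inner_affine[OF stein_systemD[OF S j], of 0 "\<lambda>k. if k = j then 1 else 0"]
      unfolding sum by simp
    moreover have "integrable (gauss n) (\<lambda>x. f x j * x j)"
      by (intro L2_mult_integrable stein_system_L2(1)[OF S] L2_gauss_coord j)
    moreover have "integrable (gauss n) (\<lambda>x. G x j j)"
      by (intro gauss.L2_integrable stein_system_L2(2)[OF S] j)
    ultimately show ?thesis by (simp add: mult.commute)
  qed
  have "(\<integral>x. gxi n f G x \<partial>gauss n) = (\<Sum>j<n. \<integral>x. x j * f x j - G x j j \<partial>gauss n)"
    unfolding gxi_eq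
  proof (rule Bochner_Integration.integral_sum)
    fix j assume "j \<in> {..<n}"
    then have "j < n" by simp
    then show "integrable (gauss n) (\<lambda>x. x j * f x j - G x j j)"
      by (intro gauss.L2_integrable gauss_delta_inner(1)[OF stein_systemD[OF S] stein_systemD[OF S]])
  qed
  then show ?thesis by (simp add: one)
qed

text \<open>Quadratic form and trace depend on the symmetric part only, so a symmetric matrix may be
  assumed from here on.\<close>

lemma gxi_lin_sym_part: "gxi_lin n \<mu> A x = gxi_lin n \<mu> (sym_part A) x"
proof -
  have "(\<Sum>i<n. x i * mvec n (sym_part A) x i)
    = (\<Sum>i<n. \<Sum>j<n. x i * A i j * x j) / 2 + (\<Sum>i<n. \<Sum>j<n. x i * A j i * x j) / 2"
    unfolding mvec_def sym_part_def sum_distrib_left sum_divide_distrib sum.distrib[symmetric]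
    by (intro sum.cong refl) (simp add: field_simps)
  also have "(\<Sum>i<n. \<Sum>j<n. x i * A j i * x j) = (\<Sum>i<n. \<Sum>j<n. x i * A i j * x j)"
    by (subst sum.swap) (simp add: mult_ac)
  finally have "(\<Sum>i<n. x i * mvec n (sym_part A) x i) = (\<Sum>i<n. x i * mvec n A x i)"
    by (simp add: mvec_def sum_distrib_left mult.assoc)
  moreover have "mtrace n (sym_part A) = mtrace n A" by (simp add: mtrace_def sym_part_def)
  ultimately show ?thesis by (simp add: xi_lin_def distrib_left sum.distrib)
qed

locale sym_chaos =
  fixes n :: nat and \<mu> :: rvec and A :: rmat
  assumes sym: "A i j = A j i"
begin

definition Y :: "rvec \<Rightarrow> real" where "Y = gxi_lin n \<mu> A"
text \<open>The affine field whose Gaussian divergence x . h - trace A is \<open>Y\<close>. It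
  differs from the gradient \<open>dY\<close> by a factor 2 in the linear term, since the second
  chaos has degree two.\<close>

definition h :: "nat \<Rightarrow> rvec \<Rightarrow> real" where "h i x = \<mu> i + mvec n A x i"
definition dY :: "nat \<Rightarrow> rvec \<Rightarrow> real" where "dY i x = \<mu> i + 2 * mvec n A x i"
definition var :: real where "var = (vnorm n \<mu>)\<^sup>2 + 2 * (fnorm n A)\<^sup>2"

lemma sym_part_A: "sym_part A = A"
  using sym by (auto simp: sym_part_def fun_eq_iff)

lemma L2_Y: "Y \<in> L2_space (gauss n)"
  unfolding Y_def by (rule L2_gxi_lin)

lemma Y_square: "(\<integral>x. (Y x)\<^sup>2 \<partial>gauss n) = var"
  unfolding Y_def gxi_lin_square sym_part_A var_def ..

lemma L2_mvec: "i < n \<Longrightarrow> (\<lambda>x. mvec n A x i) \<in> L2_space (gauss n)"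
  unfolding mvec_def by (intro L2_sum L2_scale L2_gauss_coord) simp

lemma L2_h: "i < n \<Longrightarrow> h i \<in> L2_space (gauss n)"
  unfolding h_def[abs_def] by (intro L2_add gauss.L2_const L2_mvec)

lemma L2_dY: "i < n \<Longrightarrow> dY i \<in> L2_space (gauss n)"
  unfolding dY_def[abs_def] by (intro L2_add gauss.L2_const L2_scale L2_mvec)

lemma mvec_upd: "i < n \<Longrightarrow> mvec n A (x(i := t)) j = mvec n A (x(i := 0)) j + A j i * t"
  unfolding mvec_def by (subst (1 2) sum.remove[of _ i]) auto

lemma h_poly:
  assumes "i < n"
  obtains \<alpha> where "\<And>t. h j (x(i := t)) = poly [:\<alpha>, A j i:] t"
proof (rule that)
  show "h j (x(i := t)) = poly [:h j (x(i := 0)), A j i:] t" for t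
    unfolding h_def mvec_upd[OF assms, of x t] by simp
qed

lemma dY_poly:
  assumes "i < n"
  obtains \<beta> where "\<And>t. dY j (x(i := t)) = poly [:\<beta>, 2 * A j i:] t"
proof (rule that)
  show "dY j (x(i := t)) = poly [:dY j (x(i := 0)), 2 * A j i:] t" for t
    unfolding dY_def mvec_upd[OF assms, of x t] by simp
qed

lemma Y_eq: "Y x = (\<Sum>j<n. x j * h j x) - mtrace n A"
  by (simp add: Y_def xi_lin_def h_def)

lemma Y_derivative:
  assumes i: "i < n"
  shows "((\<lambda>t. Y (x(i := t))) has_real_derivative dY i (x(i := t))) (at t)"
proof -
  have d1: "((\<lambda>t. (x(i := t)) j) has_real_derivative (if j = i then 1 else 0)) (at t)" for j
    by (cases "j = i") auto
  have d2: "((\<lambda>t. h j (x(i := t))) has_real_derivative A j i) (at t)" for j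
  proof -
    obtain \<alpha> where \<alpha>: "\<And>t. h j (x(i := t)) = poly [:\<alpha>, A j i:] t" using h_poly[OF i] by blast
    show ?thesis unfolding \<alpha> by (auto intro!: derivative_eq_intros)
  qed
  have "((\<lambda>t. (\<Sum>j<n. (x(i := t)) j * h j (x(i := t))) - mtrace n A) has_real_derivative
      (\<Sum>j<n. (if j = i then 1 else 0) * h j (x(i := t)) + A j i * (x(i := t)) j) - 0) (at t)"
    by (intro DERIV_diff DERIV_sum DERIV_mult d1 d2 DERIV_const)
  moreover have "(\<Sum>j<n. (if j = i then 1 else 0) * h j (x(i := t)) + A j i * (x(i := t)) j) - 0 = dY i (x(i := t))"
  proof -
    have "(\<Sum>j<n. (if j = i then 1 else 0) * h j (x(i := t))) = h i (x(i := t))"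
      using i by (simp add: if_distrib[of "\<lambda>c. c * _"] cong: if_cong)
    moreover have "(\<Sum>j<n. A j i * (x(i := t)) j) = mvec n A (x(i := t)) i"
      unfolding mvec_def using sym by (intro sum.cong) auto
    ultimately show ?thesis unfolding sum.distrib dY_def h_def by simp
  qed
  ultimately show ?thesis unfolding Y_eq by simp
qed

lemma Y_slice_continuous: "i < n \<Longrightarrow> continuous_on UNIV (\<lambda>t. Y (x(i := t)))"
  using DERIV_isCont[OF Y_derivative] by (intro continuous_at_imp_continuous_on) auto

lemma Y_measurable [measurable]: "Y \<in> borel_measurable (gauss n)"
  using L2_Y by auto

text \<open>On each slice \<open>h i\<close> and \<open>dY i\<close> are affine in t and the
  exponential has modulus 1, so the growth condition reduces to a bound on a quadratic
  polynomial.\<close>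

lemma iexp_Y_parts:
  assumes i: "i < n"
  shows "(\<integral>x. x i *\<^sub>R (h i x *\<^sub>R iexp (s * Y x)) \<partial>gauss n)
    = (\<integral>x. A i i *\<^sub>R iexp (s * Y x) + (\<i> * (s * h i x * dY i x)) * iexp (s * Y x) \<partial>gauss n)"
    "integrable (gauss n) (\<lambda>x. x i *\<^sub>R (h i x *\<^sub>R iexp (s * Y x)))"
    "integrable (gauss n) (\<lambda>x. (\<i> * (s * h i x * dY i x)) * iexp (s * Y x))"
proof -
  have [measurable]: "h i \<in> borel_measurable (gauss n)" "dY i \<in> borel_measurable (gauss n)"
    "(\<lambda>x. x i) \<in> borel_measurable (gauss n)"
    using L2_h[OF i] L2_dY[OF i] L2_gauss_coord[OF i] by auto
  show i1: "integrable (gauss n) (\<lambda>x. x i *\<^sub>R (h i x *\<^sub>R iexp (s * Y x)))"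
    by (rule Bochner_Integration.integrable_bound[OF L2_mult_integrable[OF L2_gauss_coord[OF i] L2_h[OF i]]])
       (auto simp: norm_mult abs_mult)
  show i2: "integrable (gauss n) (\<lambda>x. (\<i> * (s * h i x * dY i x)) * iexp (s * Y x))"
    by (rule Bochner_Integration.integrable_bound[OF integrable_mult_right[OF L2_mult_integrable[OF L2_h[OF i] L2_dY[OF i]], of s]])
       (auto simp: norm_mult abs_mult)
  have i3: "integrable (gauss n) (\<lambda>x. A i i *\<^sub>R iexp (s * Y x))"
    by (rule gauss.integrable_const_bound[of _ "\<bar>A i i\<bar>"]) (auto simp: norm_mult)
  show "(\<integral>x. x i *\<^sub>R (h i x *\<^sub>R iexp (s * Y x)) \<partial>gauss n)
    = (\<integral>x. A i i *\<^sub>R iexp (s * Y x) + (\<i> * (s * h i x * dY i x)) * iexp (s * Y x) \<partial>gauss n)"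
  proof (rule gauss_integration_by_parts[OF i])
    fix x t
    have d2: "((\<lambda>t. h i (x(i := t))) has_real_derivative A i i) (at t)"
    proof -
      obtain \<alpha> where \<alpha>: "\<And>t. h i (x(i := t)) = poly [:\<alpha>, A i i:] t" using h_poly[OF i] by blast
      show ?thesis unfolding \<alpha> by (auto intro!: derivative_eq_intros)
    qed
    have d3: "((\<lambda>t. iexp (s * Y (x(i := t)))) has_vector_derivative
       (\<i> * (s * dY i (x(i := t)))) * iexp (s * Y (x(i := t)))) (at t)"
    proof -
      have "((\<lambda>t. \<i> * (s * Y (x(i := t)))) has_vector_derivative \<i> * (s * dY i (x(i := t)))) (at t)"
        using DERIV_cmult[OF Y_derivative[OF i], of s x t]
        by (intro has_vector_derivative_mult_right has_vector_derivative_of_real)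
           (simp add: has_real_derivative_iff_has_vector_derivative)
      from field_vector_diff_chain_at[OF this DERIV_exp] show ?thesis by (simp add: o_def)
    qed
    show "((\<lambda>t. h i (x(i := t)) *\<^sub>R iexp (s * Y (x(i := t)))) has_vector_derivative
       A i i *\<^sub>R iexp (s * Y (x(i := t))) + (\<i> * (s * h i (x(i := t)) * dY i (x(i := t)))) * iexp (s * Y (x(i := t)))) (at t)"
      by (rule has_vector_derivative_eq_rhs[OF has_vector_derivative_scaleR[OF d2 d3]])
         (simp add: scaleR_conv_of_real algebra_simps)
  next
    fix x
    obtain \<alpha> where \<alpha>: "\<And>t. h i (x(i := t)) = poly [:\<alpha>, A i i:] t" using h_poly[OF i] by blast
    obtain \<beta> where \<beta>: "\<And>t. dY i (x(i := t)) = poly [:\<beta>, 2 * A i i:] t" using dY_poly[OF i] by blast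
    show "continuous_on UNIV (\<lambda>t. A i i *\<^sub>R iexp (s * Y (x(i := t)))
      + (\<i> * (s * h i (x(i := t)) * dY i (x(i := t)))) * iexp (s * Y (x(i := t))))"
      unfolding \<alpha> \<beta> by (intro continuous_intros Y_slice_continuous i)
    show "\<exists>C a. \<forall>t. norm (h i (x(i := t)) *\<^sub>R iexp (s * Y (x(i := t)))) \<le> C * exp (a * \<bar>t\<bar>)"
      unfolding \<alpha> using poly_exp_bound[of "[:\<alpha>, A i i:]"] by simp
    obtain C a where C: "\<And>t. \<bar>poly ([:\<alpha>, A i i:] * [:\<beta>, 2 * A i i:]) t\<bar> \<le> C * exp (a * \<bar>t\<bar>)"
      using poly_exp_bound by blast
    have "norm (A i i *\<^sub>R iexp (s * Y (x(i := t))) + (\<i> * (s * h i (x(i := t)) * dY i (x(i := t)))) * iexp (s * Y (x(i := t))))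
      \<le> (\<bar>A i i\<bar> + \<bar>s\<bar> * C) * exp (max a 0 * \<bar>t\<bar>)" for t
    proof -
      have hd: "\<bar>h i (x(i := t)) * dY i (x(i := t))\<bar> \<le> C * exp (a * \<bar>t\<bar>)"
        using C[of t] unfolding poly_mult \<alpha> \<beta> .
      have C0: "C \<ge> 0" using order_trans[OF abs_ge_zero C[of 0]] by simp
      have "norm (A i i *\<^sub>R iexp (s * Y (x(i := t))) + (\<i> * (s * h i (x(i := t)) * dY i (x(i := t)))) * iexp (s * Y (x(i := t))))
        \<le> \<bar>A i i\<bar> + \<bar>s\<bar> * \<bar>h i (x(i := t)) * dY i (x(i := t))\<bar>"
        by (rule order_trans[OF norm_triangle_ineq]) (simp add: norm_mult abs_mult)
      also have "\<dots> \<le> \<bar>A i i\<bar> * exp (max a 0 * \<bar>t\<bar>) + \<bar>s\<bar> * (C * exp (max a 0 * \<bar>t\<bar>))"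
      proof (intro add_mono mult_left_mono)
        show "\<bar>A i i\<bar> \<le> \<bar>A i i\<bar> * exp (max a 0 * \<bar>t\<bar>)" by (simp add: mult_le_cancel_left1)
        have "exp (a * \<bar>t\<bar>) \<le> exp (max a 0 * \<bar>t\<bar>)" by (simp add: mult_right_mono)
        then show "\<bar>h i (x(i := t)) * dY i (x(i := t))\<bar> \<le> C * exp (max a 0 * \<bar>t\<bar>)"
          using hd C0 by (meson mult_left_mono order_trans)
      qed simp
      finally show ?thesis by (simp add: algebra_simps)
    qed
    then show "\<exists>C a. \<forall>t. norm (A i i *\<^sub>R iexp (s * Y (x(i := t)))
      + (\<i> * (s * h i (x(i := t)) * dY i (x(i := t)))) * iexp (s * Y (x(i := t)))) \<le> C * exp (a * \<bar>t\<bar>)" by blast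
  qed (use i1 i2 i3 in auto)
qed

text \<open>\<open>R\<close> is the centred part of \<open>\<Sum>i<n. h i x * dY i x\<close>; it lies again in the first two chaoses, so
  its variance is explicit.\<close>

definition R :: "rvec \<Rightarrow> real" where
  "R = gxi_lin n (\<lambda>i. 3 * mvec n A \<mu> i) (\<lambda>i j. 2 * mmul n A A i j)"

lemma L2_R: "R \<in> L2_space (gauss n)"
  unfolding R_def by (rule L2_gxi_lin)

text \<open>The product (\<mu> + A x) . (\<mu> + 2 A x) equals |\<mu>|^2 + 3 \<mu> . A x + 2 |A
  x|^2. The coefficient 3 is 1 + 2, and the mean of the last term is the trace of 2 A^2, which
  equals twice the squared Frobenius norm of A.\<close>

lemma carre_du_champ: "(\<Sum>i<n. h i x * dY i x) = var + R x"
proof -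
  have 1: "(\<Sum>i<n. x i * mvec n A \<mu> i) = (\<Sum>i<n. \<mu> i * mvec n A x i)"
    using mvec_adjoint[where A = A and n = n and u = x and v = \<mu>, OF sym] by (simp add: mult.commute)
  have "mvec n (\<lambda>i j. 2 * mmul n A A i j) x = (\<lambda>i. 2 * mvec n A (mvec n A x) i)"
  proof
    fix i
    have "(\<Sum>j<n. (\<Sum>k<n. A i k * A k j) * x j) = (\<Sum>k<n. A i k * (\<Sum>j<n. A k j * x j))"
      unfolding sum_distrib_left sum_distrib_right by (subst sum.swap) (simp add: mult.assoc)
    then show "mvec n (\<lambda>i j. 2 * mmul n A A i j) x i = 2 * mvec n A (mvec n A x) i"
      by (simp add: mvec_def mmul_def sum_distrib_left[symmetric] mult.assoc)
  qed
  then have 2: "(\<Sum>i<n. x i * mvec n (\<lambda>i j. 2 * mmul n A A i j) x i) = 2 * (\<Sum>i<n. (mvec n A x i)\<^sup>2)"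
    using mvec_adjoint[where A = A and n = n and u = x and v = "mvec n A x", OF sym]
    by (simp add: power2_eq_square sum_distrib_left[symmetric] mult.left_commute[of _ 2])
  have 3: "mtrace n (\<lambda>i j. 2 * mmul n A A i j) = 2 * (fnorm n A)\<^sup>2"
  proof -
    have "A i k * A k i = (A i k)\<^sup>2" for i k using sym[of k i] by (simp add: power2_eq_square)
    then show ?thesis unfolding fnorm_square mtrace_def mmul_def by (simp add: sum_distrib_left)
  qed
  have "R x = 3 * (\<Sum>i<n. x i * mvec n A \<mu> i) + 2 * (\<Sum>i<n. (mvec n A x i)\<^sup>2) - 2 * (fnorm n A)\<^sup>2"
    unfolding R_def xi_lin_def distrib_left sum.distrib 2 3
    by (simp add: sum_distrib_left mult.left_commute)
  moreover have "(\<Sum>i<n. h i x * dY i x) = (\<Sum>i<n. (\<mu> i)\<^sup>2) + 3 * (\<Sum>i<n. \<mu> i * mvec n A x i) + 2 * (\<Sum>i<n. (mvec n A x i)\<^sup>2)"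
    unfolding sum_distrib_left sum.distrib[symmetric]
    by (rule sum.cong) (auto simp: h_def dY_def power2_eq_square algebra_simps)
  ultimately show ?thesis unfolding 1 var_def vnorm_square by simp
qed

text \<open>The exact variance is 9 |A \<mu>|^2 plus 8 times the squared Frobenius norm of A^2.
  Raising 8 to 18 makes 9 times the squared operator norm a common factor, with \<open>var\<close>
  remaining.\<close>

lemma R_square_le: "(\<integral>x. (R x)\<^sup>2 \<partial>gauss n) \<le> (3 * opnorm n A)\<^sup>2 * var"
proof -
  have "sym_part (\<lambda>i j. 2 * mmul n A A i j) = (\<lambda>i j. 2 * mmul n A A i j)"
    unfolding sym_part_def mmul_def fun_eq_iff using sym by (simp add: mult.commute)
  moreover have "(fnorm n (\<lambda>i j. 2 * mmul n A A i j))\<^sup>2 = 4 * (fnorm n (mmul n A A))\<^sup>2"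
    unfolding fnorm_square by (simp add: power_mult_distrib sum_distrib_left)
  moreover have "(vnorm n (\<lambda>i. 3 * mvec n A \<mu> i))\<^sup>2 = 9 * (vnorm n (mvec n A \<mu>))\<^sup>2"
    unfolding vnorm_square by (simp add: power_mult_distrib sum_distrib_left)
  ultimately have "(\<integral>x. (R x)\<^sup>2 \<partial>gauss n) = 9 * (vnorm n (mvec n A \<mu>))\<^sup>2 + 8 * (fnorm n (mmul n A A))\<^sup>2"
    unfolding R_def gxi_lin_square by simp
  also have "\<dots> \<le> 9 * ((opnorm n A)\<^sup>2 * (vnorm n \<mu>)\<^sup>2) + 18 * ((opnorm n A)\<^sup>2 * (fnorm n A)\<^sup>2)"
  proof -
    have "0 \<le> (opnorm n A)\<^sup>2 * (fnorm n A)\<^sup>2" by simp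
    then show ?thesis
      using vnorm_mvec_square_le[of n A \<mu>] fnorm_mmul_le[of n A A] by linarith
  qed
  also have "\<dots> = (3 * opnorm n A)\<^sup>2 * var" by (simp add: var_def power_mult_distrib algebra_simps)
  finally show ?thesis .
qed

definition \<phi> :: "real \<Rightarrow> complex" where "\<phi> s = (\<integral>x. iexp (s * Y x) \<partial>gauss n)"

lemma integrable_iexp_Y: "integrable (gauss n) (\<lambda>x. iexp (s * Y x))"
  by (rule gauss.integrable_const_bound[of _ 1]) auto

lemma integrable_L2_iexp: "u \<in> L2_space (gauss n) \<Longrightarrow> integrable (gauss n) (\<lambda>x. of_real (u x) * iexp (s * Y x))"
  by (rule Bochner_Integration.integrable_bound[OF gauss.L2_integrable]) (auto simp: norm_mult)

text \<open>Write \<open>Y\<close> as the sum of x_i h_i - A_ii and integrate by parts in each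
  coordinate. The diagonal entries cancel, and the derivative of the exponential leaves i s times
  the sum of the h_i dY_i.\<close>

lemma Y_iexp: "(\<integral>x. of_real (Y x) * iexp (s * Y x) \<partial>gauss n)
    = \<i> * s * (var * \<phi> s + (\<integral>x. of_real (R x) * iexp (s * Y x) \<partial>gauss n))"
proof -
  have "(\<integral>x. of_real (Y x) * iexp (s * Y x) \<partial>gauss n)
    = (\<integral>x. (\<Sum>i<n. x i *\<^sub>R (h i x *\<^sub>R iexp (s * Y x)) - A i i *\<^sub>R iexp (s * Y x)) \<partial>gauss n)"
    unfolding Y_eq mtrace_def
    by (rule Bochner_Integration.integral_cong)
       (auto simp: scaleR_conv_of_real sum_distrib_right left_diff_distrib sum_subtractf mult.assoc)
  also have "\<dots> = (\<Sum>i<n. \<integral>x. x i *\<^sub>R (h i x *\<^sub>R iexp (s * Y x)) - A i i *\<^sub>R iexp (s * Y x) \<partial>gauss n)"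
    by (rule Bochner_Integration.integral_sum)
       (intro Bochner_Integration.integrable_diff iexp_Y_parts(2) integrable_scaleR_right integrable_iexp_Y, simp)
  also have "\<dots> = (\<Sum>i<n. \<integral>x. (\<i> * (s * h i x * dY i x)) * iexp (s * Y x) \<partial>gauss n)"
  proof (rule sum.cong[OF refl])
    fix i assume "i \<in> {..<n}"
    then have i: "i < n" by simp
    have a: "integrable (gauss n) (\<lambda>x. A i i *\<^sub>R iexp (s * Y x))"
      by (intro integrable_scaleR_right integrable_iexp_Y)
    show "(\<integral>x. x i *\<^sub>R (h i x *\<^sub>R iexp (s * Y x)) - A i i *\<^sub>R iexp (s * Y x) \<partial>gauss n)
      = (\<integral>x. (\<i> * (s * h i x * dY i x)) * iexp (s * Y x) \<partial>gauss n)"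
      unfolding Bochner_Integration.integral_diff[OF iexp_Y_parts(2)[OF i] a] iexp_Y_parts(1)[OF i]
        Bochner_Integration.integral_add[OF a iexp_Y_parts(3)[OF i]] by simp
  qed
  also have "\<dots> = (\<integral>x. (\<Sum>i<n. (\<i> * (s * h i x * dY i x)) * iexp (s * Y x)) \<partial>gauss n)"
    by (rule Bochner_Integration.integral_sum[symmetric]) (rule iexp_Y_parts(3), simp)
  also have "\<dots> = (\<integral>x. \<i> * s * (var * iexp (s * Y x) + of_real (R x) * iexp (s * Y x)) \<partial>gauss n)"
  proof (rule Bochner_Integration.integral_cong[OF refl])
    fix x
    have "(\<Sum>i<n. (\<i> * (s * h i x * dY i x)) * iexp (s * Y x))
      = \<i> * s * of_real (\<Sum>i<n. h i x * dY i x) * iexp (s * Y x)"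
      by (simp add: sum_distrib_left sum_distrib_right mult.assoc)
    then show "(\<Sum>i<n. (\<i> * (s * h i x * dY i x)) * iexp (s * Y x))
      = \<i> * s * (var * iexp (s * Y x) + of_real (R x) * iexp (s * Y x))"
      unfolding carre_du_champ by (simp add: algebra_simps)
  qed
  also have "\<dots> = \<i> * s * (var * \<phi> s + (\<integral>x. of_real (R x) * iexp (s * Y x) \<partial>gauss n))"
    unfolding \<phi>_def using integrable_iexp_Y integrable_L2_iexp[OF L2_R] by simp
  finally show ?thesis .
qed

text \<open>Second order Taylor expansion of exp (i k Y) leaves a remainder of at most k^2 Y^2 / 2,
  whose mean is a multiple of k^2; differentiation under the integral is thereby
  quantitative.\<close>

lemma \<phi>_derivative: "(\<phi> has_vector_derivative (\<i> * (\<integral>x. of_real (Y x) * iexp (s * Y x) \<partial>gauss n))) (at s)"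
proof -
  define D where "D = \<i> * (\<integral>x. of_real (Y x) * iexp (s * Y x) \<partial>gauss n)"
  have bd: "norm (\<phi> (s + k) - \<phi> s - k *\<^sub>R D) \<le> var / 2 * k\<^sup>2" for k
  proof -
    have eq: "\<phi> (s + k) - \<phi> s - k *\<^sub>R D
      = (\<integral>x. iexp ((s + k) * Y x) - iexp (s * Y x) - k *\<^sub>R (\<i> * (of_real (Y x) * iexp (s * Y x))) \<partial>gauss n)"
      unfolding \<phi>_def D_def using integrable_iexp_Y integrable_L2_iexp[OF L2_Y]
      by (simp del: of_real_mult of_real_add)
    have int: "integrable (gauss n) (\<lambda>x. iexp ((s + k) * Y x) - iexp (s * Y x) - k *\<^sub>R (\<i> * (of_real (Y x) * iexp (s * Y x))))"
      using integrable_iexp_Y integrable_L2_iexp[OF L2_Y] by (simp del: of_real_mult of_real_add)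
    have "norm (\<phi> (s + k) - \<phi> s - k *\<^sub>R D) \<le> (\<integral>x. norm (iexp ((s + k) * Y x) - iexp (s * Y x)
       - k *\<^sub>R (\<i> * (of_real (Y x) * iexp (s * Y x)))) \<partial>gauss n)"
      unfolding eq by (rule integral_norm_bound)
    also have "\<dots> \<le> (\<integral>x. k\<^sup>2 / 2 * (Y x)\<^sup>2 \<partial>gauss n)"
    proof (rule integral_mono[OF integrable_norm[OF int]])
      show "integrable (gauss n) (\<lambda>x. k\<^sup>2 / 2 * (Y x)\<^sup>2)" using L2_square_integrable[OF L2_Y] by simp
      fix x
      have "iexp ((s + k) * Y x) = iexp (s * Y x) * iexp (k * Y x)"
        by (simp add: exp_add[symmetric] algebra_simps)
      then have "iexp ((s + k) * Y x) - iexp (s * Y x) - k *\<^sub>R (\<i> * (of_real (Y x) * iexp (s * Y x)))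
        = iexp (s * Y x) * (iexp (k * Y x) - (\<Sum>j\<le>1. (\<i> * of_real (k * Y x)) ^ j / fact j))"
        by (simp add: scaleR_conv_of_real algebra_simps)
      then have "norm (iexp ((s + k) * Y x) - iexp (s * Y x) - k *\<^sub>R (\<i> * (of_real (Y x) * iexp (s * Y x))))
        = norm (iexp (k * Y x) - (\<Sum>j\<le>1. (\<i> * of_real (k * Y x)) ^ j / fact j))"
        by (simp add: norm_mult)
      also have "\<dots> \<le> \<bar>k * Y x\<bar> ^ Suc 1 / fact (Suc 1)" by (rule iexp_approx1)
      also have "\<dots> = k\<^sup>2 / 2 * (Y x)\<^sup>2" by (simp add: power2_eq_square[symmetric] power_mult_distrib)
      finally show "norm (iexp ((s + k) * Y x) - iexp (s * Y x) - k *\<^sub>R (\<i> * (of_real (Y x) * iexp (s * Y x)))) \<le> k\<^sup>2 / 2 * (Y x)\<^sup>2" .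
    qed
    also have "\<dots> = var / 2 * k\<^sup>2" by (simp add: Y_square)
    finally show ?thesis .
  qed
  have "(\<lambda>k. norm (\<phi> (s + k) - \<phi> s - k *\<^sub>R D) / norm k) \<midarrow>0\<rightarrow> 0"
  proof (rule tendsto_sandwich[OF always_eventually always_eventually tendsto_const])
    show "\<forall>k. norm (\<phi> (s + k) - \<phi> s - k *\<^sub>R D) / norm k \<le> var / 2 * \<bar>k\<bar>"
    proof
      fix k
      show "norm (\<phi> (s + k) - \<phi> s - k *\<^sub>R D) / norm k \<le> var / 2 * \<bar>k\<bar>"
      proof (cases "k = 0")
        case False
        have "k\<^sup>2 = \<bar>k\<bar> * \<bar>k\<bar>" by (simp add: power2_eq_square)
        then show ?thesis using bd[of k] False by (simp add: pos_divide_le_eq mult.assoc)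
      qed simp
    qed
    show "((\<lambda>k. var / 2 * \<bar>k\<bar>) \<longlongrightarrow> 0) (at 0)" by (auto intro!: tendsto_eq_intros)
  qed auto
  then show ?thesis
    unfolding has_vector_derivative_def has_derivative_at D_def
    by (auto intro: bounded_linear_scaleR_left)
qed

lemma var_nonneg: "var \<ge> 0" by (simp add: var_def)

text \<open>Multiplying by the integrating factor exp (var s^2 / 2) cancels the main term of the
  differential equation. The derivative of \<psi> then contains only the contribution of
  \<open>R\<close>, which Cauchy-Schwarz bounds by \<rho>.\<close>

lemma \<phi>_gaussian_approx: "norm (\<phi> s - exp (- var * s\<^sup>2 / 2)) \<le> s\<^sup>2 * (3 * opnorm n A * sqrt var)"
proof -
  define \<rho> where "\<rho> = 3 * opnorm n A * sqrt var"
  define \<psi> where "\<psi> = (\<lambda>s. exp (var * s\<^sup>2 / 2) *\<^sub>R \<phi> s)"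
  define d where "d = (\<lambda>s. - (s * exp (var * s\<^sup>2 / 2)) *\<^sub>R (\<integral>x. of_real (R x) * iexp (s * Y x) \<partial>gauss n))"
  have R1: "norm (\<integral>x. of_real (R x) * iexp (s * Y x) \<partial>gauss n) \<le> \<rho>" for s
  proof -
    have "norm (\<integral>x. of_real (R x) * iexp (s * Y x) \<partial>gauss n) \<le> (\<integral>x. norm (of_real (R x) * iexp (s * Y x)) \<partial>gauss n)"
      by (rule integral_norm_bound)
    also have "\<dots> = (\<integral>x. \<bar>R x\<bar> \<partial>gauss n)" by (simp only: norm_mult norm_exp_i_times norm_of_real mult_1_right)
    also have "\<dots> \<le> sqrt (\<integral>x. (R x)\<^sup>2 \<partial>gauss n)" by (rule gauss.L2_abs_integral_le[OF L2_R])
    also have "\<dots> \<le> sqrt ((3 * opnorm n A)\<^sup>2 * var)" by (rule real_sqrt_le_mono[OF R_square_le])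
    also have "\<dots> = \<rho>" using opnorm_nonneg[of n A] by (simp add: \<rho>_def real_sqrt_mult)
    finally show ?thesis .
  qed
  have \<rho>0: "\<rho> \<ge> 0" using order_trans[OF norm_ge_zero R1] .
  have d: "(\<psi> has_vector_derivative d s) (at s)" for s
  proof -
    have e: "((\<lambda>s. exp (var * s\<^sup>2 / 2)) has_real_derivative var * s * exp (var * s\<^sup>2 / 2)) (at s)"
      by (auto intro!: derivative_eq_intros)
    have "(\<psi> has_vector_derivative exp (var * s\<^sup>2 / 2) *\<^sub>R (\<i> * (\<integral>x. of_real (Y x) * iexp (s * Y x) \<partial>gauss n))
       + (var * s * exp (var * s\<^sup>2 / 2)) *\<^sub>R \<phi> s) (at s)"
      unfolding \<psi>_def by (rule has_vector_derivative_scaleR[OF e \<phi>_derivative])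
    also have "exp (var * s\<^sup>2 / 2) *\<^sub>R (\<i> * (\<integral>x. of_real (Y x) * iexp (s * Y x) \<partial>gauss n))
       + (var * s * exp (var * s\<^sup>2 / 2)) *\<^sub>R \<phi> s = d s"
      unfolding Y_iexp d_def by (simp add: scaleR_conv_of_real algebra_simps)
    finally show ?thesis .
  qed
  have bound: "norm (d x - d 0) \<le> \<bar>s\<bar> * exp (var * s\<^sup>2 / 2) * \<rho>" if x: "x \<in> closed_segment 0 s" for x
  proof -
    have xs: "\<bar>x\<bar> \<le> \<bar>s\<bar>" using x by (auto simp: closed_segment_eq_real_ivl split: if_splits)
    then have "x\<^sup>2 \<le> s\<^sup>2" by (simp add: abs_le_square_iff)
    then have "var * x\<^sup>2 / 2 \<le> var * s\<^sup>2 / 2" using var_nonneg by (simp add: mult_left_mono)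
    have "norm (d x - d 0) = \<bar>x\<bar> * exp (var * x\<^sup>2 / 2) * norm (\<integral>y. of_real (R y) * iexp (x * Y y) \<partial>gauss n)"
      by (simp add: d_def abs_mult)
    also have "\<dots> \<le> \<bar>s\<bar> * exp (var * s\<^sup>2 / 2) * \<rho>"
      using xs \<open>var * x\<^sup>2 / 2 \<le> var * s\<^sup>2 / 2\<close> R1 \<rho>0 by (intro mult_mono) auto
    finally show ?thesis .
  qed
  \<comment> \<open>Mean value inequality linearized at 0, where \<open>d\<close> vanishes. Its
    bound on the segment carries another factor |s|, which is why the final estimate has
    s^2.\<close>
  have "norm (\<psi> s - \<psi> 0 - (s - 0) *\<^sub>R d 0) \<le> norm (s - 0) * (\<bar>s\<bar> * exp (var * s\<^sup>2 / 2) * \<rho>)"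
    by (rule vector_differentiable_bound_linearization[where S = "closed_segment 0 s"])
       (use d bound in \<open>auto intro: has_vector_derivative_at_within\<close>)
  moreover have "\<psi> 0 = 1" "d 0 = 0" using gauss.prob_space by (simp_all add: \<psi>_def \<phi>_def d_def)
  ultimately have le: "norm (\<psi> s - 1) \<le> s\<^sup>2 * exp (var * s\<^sup>2 / 2) * \<rho>"
    by (simp add: power2_eq_square mult.assoc)
  have "\<phi> s - exp (- var * s\<^sup>2 / 2) = exp (- (var * s\<^sup>2 / 2)) *\<^sub>R (\<psi> s - 1)"
    by (simp add: \<psi>_def scaleR_conv_of_real right_diff_distrib mult.assoc[symmetric] exp_minus_inverse
        exp_of_real[symmetric] flip: of_real_mult exp_add)
  then have "norm (\<phi> s - exp (- var * s\<^sup>2 / 2)) = exp (- (var * s\<^sup>2 / 2)) * norm (\<psi> s - 1)" by simp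
  also have "\<dots> \<le> exp (- (var * s\<^sup>2 / 2)) * (s\<^sup>2 * exp (var * s\<^sup>2 / 2) * \<rho>)" by (intro mult_left_mono le) simp
  also have "\<dots> = (exp (- (var * s\<^sup>2 / 2)) * exp (var * s\<^sup>2 / 2)) * (s\<^sup>2 * \<rho>)" by (simp only: mult_ac)
  also have "\<dots> = s\<^sup>2 * \<rho>" by (simp flip: exp_add)
  finally show ?thesis by (simp add: \<rho>_def)
qed

end

section \<open>A lower bound for the tails of quadratic forms\<close>


text \<open>One-dimensional Cameron-Martin: exp (b x - b^2 / 2) is the quotient of the normal
  densities with means b and 0.\<close>

lemma std_normal_shift:
  "distr std_normal_distribution std_normal_distribution (\<lambda>x. x + b)
    = density std_normal_distribution (\<lambda>x. ennreal (exp (b * x - b\<^sup>2 / 2)))"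
proof -
  have "distributed std_normal_distribution lborel (\<lambda>x. x) (normal_density 0 1)"
    by (simp add: distributed_def distr_id2)
  from std_normal.normal_density_affine[OF this, of 1 b]
  have "distr std_normal_distribution lborel (\<lambda>x. b + x) = density lborel (normal_density b 1)"
    by (simp add: distributed_def)
  moreover have "distr std_normal_distribution std_normal_distribution (\<lambda>x. x + b) = distr std_normal_distribution lborel (\<lambda>x. b + x)"
    by (rule distr_cong) auto
  moreover have "density std_normal_distribution (\<lambda>x. ennreal (exp (b * x - b\<^sup>2 / 2))) = density lborel (normal_density b 1)"
  proof (subst density_density_eq)
    have "std_normal_density x * exp (b * x - b\<^sup>2 / 2) = normal_density b 1 x" for x
      by (simp add: normal_density_def mult_exp_exp power2_eq_square field_simps)
    then show "density lborel (\<lambda>x. ennreal (std_normal_density x) * ennreal (exp (b * x - b\<^sup>2 / 2)))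
      = density lborel (\<lambda>x. ennreal (normal_density b 1 x))"
      by (simp add: ennreal_mult[symmetric] normal_density_nonneg)
  qed auto
  ultimately show ?thesis by simp
qed

lemma std_normal_shift_prob: "prob_space (density std_normal_distribution (\<lambda>x. ennreal (exp (b * x - b\<^sup>2 / 2))))"
  unfolding std_normal_shift[symmetric] by (rule std_normal.prob_space_distr) simp

text \<open>The value needs no integration, because the density of the shifted law has total mass
  1.\<close>

lemma std_normal_exp_integral:
  "integrable std_normal_distribution (\<lambda>x. exp (c * x))"
  "(\<integral>x. exp (c * x) \<partial>std_normal_distribution) = exp (c\<^sup>2 / 2)"
proof -
  show i: "integrable std_normal_distribution (\<lambda>x. exp (c * x))"
  proof (rule integrable_std_normal_exp_bounded)
    have "c * x \<le> \<bar>c\<bar> * \<bar>x\<bar>" for x by (metis abs_ge_self abs_mult)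
    then show "norm (exp (c * x)) \<le> 1 * exp (\<bar>c\<bar> * \<bar>x\<bar>)" for x by simp
  qed simp
  interpret D: prob_space "density std_normal_distribution (\<lambda>x. ennreal (exp (c * x - c\<^sup>2 / 2)))"
    by (rule std_normal_shift_prob)
  have "(\<integral>x. (1::real) \<partial>density std_normal_distribution (\<lambda>x. ennreal (exp (c * x - c\<^sup>2 / 2)))) = 1"
    using D.prob_space by simp
  then have "(\<integral>x. exp (c * x - c\<^sup>2 / 2) \<partial>std_normal_distribution) = 1"
    by (subst (asm) integral_density) auto
  then show "(\<integral>x. exp (c * x) \<partial>std_normal_distribution) = exp (c\<^sup>2 / 2)"
    by (simp add: exp_diff)
qed

text \<open>Chernoff's bound with parameter \<open>y\<close> itself: on the event exp (y^2) is at
  most exp (y x) + exp (-y x), whose mean is 2 exp (y^2 / 2).\<close>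

lemma std_normal_tail:
  assumes "0 \<le> y"
  shows "measure std_normal_distribution {x. y \<le> \<bar>x\<bar>} \<le> 2 * exp (- y\<^sup>2 / 2)"
proof -
  let ?u = "\<lambda>x. exp (y * x) + exp (- y * x)"
  have i: "integrable std_normal_distribution ?u"
    using std_normal_exp_integral(1)[of y] std_normal_exp_integral(1)[of "-y"] by simp
  have "exp (y\<^sup>2) * measure std_normal_distribution {x. y \<le> \<bar>x\<bar>}
    = (\<integral>x. exp (y\<^sup>2) * indicat_real {x. y \<le> \<bar>x\<bar>} x \<partial>std_normal_distribution)" by simp
  also have "\<dots> \<le> (\<integral>x. ?u x \<partial>std_normal_distribution)"
  proof (rule integral_mono[OF _ i])
    show "integrable std_normal_distribution (\<lambda>x. exp (y\<^sup>2) * indicat_real {x. y \<le> \<bar>x\<bar>} x)"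
      by (intro integrable_mult_right) (auto simp: integrable_indicator_iff std_poly.emeasure_eq_measure)
    show "exp (y\<^sup>2) * indicat_real {x. y \<le> \<bar>x\<bar>} x \<le> ?u x" for x
    proof (cases "y \<le> \<bar>x\<bar>")
      case True
      have "y\<^sup>2 \<le> y * \<bar>x\<bar>" using True assms by (simp add: power2_eq_square mult_left_mono)
      then have "exp (y\<^sup>2) \<le> exp (y * \<bar>x\<bar>)" by simp
      also have "\<dots> \<le> ?u x" by (cases "x \<ge> 0") auto
      finally show ?thesis using True by simp
    qed (simp add: add_nonneg_nonneg)
  qed
  also have "\<dots> = 2 * exp (y\<^sup>2 / 2)"
    using std_normal_exp_integral[of y] std_normal_exp_integral[of "-y"] by simp
  finally have "measure std_normal_distribution {x. y \<le> \<bar>x\<bar>} \<le> 2 * exp (y\<^sup>2 / 2) / exp (y\<^sup>2)"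
    by (simp add: field_simps)
  also have "\<dots> = 2 * exp (- y\<^sup>2 / 2)"
  proof -
    have "exp (y\<^sup>2) = exp (y\<^sup>2 / 2) * exp (y\<^sup>2 / 2)" by (simp flip: exp_add)
    then show ?thesis by (simp add: exp_minus field_simps)
  qed
  finally show ?thesis .
qed

definition gauss_shift :: "nat \<Rightarrow> rvec \<Rightarrow> rvec \<Rightarrow> rvec" where
  "gauss_shift n b x = (\<lambda>i\<in>{..<n}. x i + b i)"

definition shift_density :: "nat \<Rightarrow> rvec \<Rightarrow> rvec \<Rightarrow> real" where
  "shift_density n b x = (\<Prod>i<n. exp (b i * x i - (b i)\<^sup>2 / 2))"

lemma measurable_gauss_shift [measurable]: "gauss_shift n b \<in> gauss n \<rightarrow>\<^sub>M gauss n"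
  unfolding gauss_shift_def[abs_def] by (rule measurable_restrict) measurable

text \<open>Both measures are the product of the shifted one-dimensional laws, for the left side by
  evaluation on boxes, which generate.\<close>

theorem Cameron_Martin: "distr (gauss n) (gauss n) (gauss_shift n b) = density (gauss n) (\<lambda>x. ennreal (shift_density n b x))"
proof -
  define D where "D = (\<lambda>i. density std_normal_distribution (\<lambda>x. ennreal (exp (b i * x - (b i)\<^sup>2 / 2))))"
  have prob: "prob_space (D i)" for i unfolding D_def by (rule std_normal_shift_prob)
  interpret D: product_sigma_finite D
    by (simp add: product_sigma_finite_def prob_space_imp_sigma_finite prob)
  have "density (gauss n) (\<lambda>x. ennreal (shift_density n b x)) = Pi\<^sub>M {..<n} D"
    unfolding D_def shift_density_def
    by (subst std_normals.density_PiM[symmetric])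
       (auto simp: prod_ennreal prob_space_imp_sigma_finite std_normal_shift_prob)
  moreover have "distr (gauss n) (gauss n) (gauss_shift n b) = Pi\<^sub>M {..<n} D"
  proof (rule D.PiM_eqI)
    show "sets (distr (gauss n) (gauss n) (gauss_shift n b)) = sets (Pi\<^sub>M {..<n} D)"
      by (auto simp: D_def intro!: sets_PiM_cong)
    fix A assume "\<And>i. i \<in> {..<n} \<Longrightarrow> A i \<in> sets (D i)"
    then have A: "A i \<in> sets borel" if "i < n" for i using that by (simp add: D_def)
    have pre: "(\<lambda>x. x + b i) -` A i \<in> sets borel" if "i < n" for i
      using measurable_sets_borel[of "\<lambda>x. x + b i" borel "A i"] A[OF that] by simp
    have box: "PiE {..<n} A \<in> sets (gauss n)" using A by (intro sets_PiM_I_finite) auto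
    have "emeasure (distr (gauss n) (gauss n) (gauss_shift n b)) (PiE {..<n} A)
      = emeasure (gauss n) (gauss_shift n b -` PiE {..<n} A \<inter> space (gauss n))"
      by (rule emeasure_distr) (use box in auto)
    also have "gauss_shift n b -` PiE {..<n} A \<inter> space (gauss n) = PiE {..<n} (\<lambda>i. (\<lambda>x. x + b i) -` A i)"
      by (auto simp: gauss_shift_def space_PiM PiE_iff)
    also have "emeasure (gauss n) \<dots> = (\<Prod>i<n. emeasure std_normal_distribution ((\<lambda>x. x + b i) -` A i))"
      by (rule std_normals.emeasure_PiM) (use pre in auto)
    also have "\<dots> = (\<Prod>i<n. emeasure (D i) (A i))"
    proof (rule prod.cong[OF refl])
      fix i assume "i \<in> {..<n}"
      then show "emeasure std_normal_distribution ((\<lambda>x. x + b i) -` A i) = emeasure (D i) (A i)"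
        unfolding D_def std_normal_shift[symmetric] using A by (subst emeasure_distr) auto
    qed
    finally show "emeasure (distr (gauss n) (gauss n) (gauss_shift n b)) (PiE {..<n} A) = (\<Prod>i\<in>{..<n}. emeasure (D i) (A i))" .
  qed auto
  ultimately show ?thesis by simp
qed

text \<open>Per coordinate the squared density is exp (-c^2) exp (2 c t), with mean exp (-c^2 + 2
  c^2) = exp (c^2).\<close>

lemma shift_density_L2:
  "shift_density n b \<in> L2_space (gauss n)"
  "(\<integral>x. (shift_density n b x)\<^sup>2 \<partial>gauss n) = exp ((vnorm n b)\<^sup>2)"
proof -
  have sq: "exp (c * t - c\<^sup>2 / 2) * exp (c * t - c\<^sup>2 / 2) = exp (- c\<^sup>2) * exp ((2 * c) * t)" for c t :: real
    by (simp add: exp_add[symmetric])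
  have L: "(\<lambda>t. exp (c * t - c\<^sup>2 / 2)) \<in> L2_space std_normal_distribution" for c
    using std_normal_exp_integral(1)[of "2 * c"] by (simp add: L2_space_def power2_eq_square[of "exp _"] sq)
  show "shift_density n b \<in> L2_space (gauss n)"
    unfolding shift_density_def[abs_def] by (rule L2_gauss_prod) (rule L)
  have "(\<integral>x. (shift_density n b x)\<^sup>2 \<partial>gauss n)
    = (\<Prod>i<n. \<integral>t. exp (b i * t - (b i)\<^sup>2 / 2) * exp (b i * t - (b i)\<^sup>2 / 2) \<partial>std_normal_distribution)"
    unfolding shift_density_def power2_eq_square[of "prod _ _"] by (rule gauss_integral_prod_mult) (rule L)+
  also have "\<dots> = (\<Prod>i<n. exp ((b i)\<^sup>2))"
  proof (rule prod.cong[OF refl])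
    fix i
    show "(\<integral>t. exp (b i * t - (b i)\<^sup>2 / 2) * exp (b i * t - (b i)\<^sup>2 / 2) \<partial>std_normal_distribution) = exp ((b i)\<^sup>2)"
      unfolding sq Bochner_Integration.integral_mult_right_zero std_normal_exp_integral(2)
      by (simp add: exp_add[symmetric] power_mult_distrib)
  qed
  also have "\<dots> = exp ((vnorm n b)\<^sup>2)" unfolding vnorm_square by (simp add: exp_sum)
  finally show "(\<integral>x. (shift_density n b x)\<^sup>2 \<partial>gauss n) = exp ((vnorm n b)\<^sup>2)" .
qed

text \<open>The shifted probability is the mean of the density times the indicator; Cauchy-Schwarz
  separates them at the price of a square on the left.\<close>

lemma Cameron_Martin_measure_le:
  assumes E: "E \<in> sets (gauss n)"
  shows "(measure (gauss n) (gauss_shift n b -` E \<inter> space (gauss n)))\<^sup>2 \<le> exp ((vnorm n b)\<^sup>2) * measure (gauss n) E"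
proof -
  have I: "indicat_real E \<in> L2_space (gauss n)"
    by (rule L2_dominated[OF gauss.L2_const[of 1]]) (use E in \<open>auto simp: indicator_def\<close>)
  have "measure (gauss n) (gauss_shift n b -` E \<inter> space (gauss n))
    = measure (distr (gauss n) (gauss n) (gauss_shift n b)) E"
    by (rule measure_distr[symmetric]) (use E in auto)
  also have "\<dots> = (\<integral>x. indicat_real E x \<partial>distr (gauss n) (gauss n) (gauss_shift n b))"
    using sets.sets_into_space[OF E] by (simp add: Int_absorb2)
  also have "\<dots> = (\<integral>x. shift_density n b x * indicat_real E x \<partial>gauss n)"
    unfolding Cameron_Martin
    by (subst integral_density)
       (use E L2_measurable[OF shift_density_L2(1)] in \<open>auto simp: shift_density_def prod_nonneg\<close>)
  finally have "(measure (gauss n) (gauss_shift n b -` E \<inter> space (gauss n)))\<^sup>2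
    \<le> (\<integral>x. (shift_density n b x)\<^sup>2 \<partial>gauss n) * (\<integral>x. (indicat_real E x)\<^sup>2 \<partial>gauss n)"
    using L2_Cauchy_Schwarz[OF shift_density_L2(1) I] by simp
  also have "(\<integral>x. (indicat_real E x)\<^sup>2 \<partial>gauss n) = measure (gauss n) E"
  proof -
    have "(indicat_real E x)\<^sup>2 = indicat_real E x" for x by (simp add: indicator_def)
    then show ?thesis using sets.sets_into_space[OF E] by (simp add: Int_absorb2)
  qed
  finally show ?thesis unfolding shift_density_L2(2) .
qed

section \<open>Tails of quadratic polynomials under translation\<close>

context sym_chaos
begin

lemma Y_cong: "(\<And>i. i < n \<Longrightarrow> x i = y i) \<Longrightarrow> Y x = Y y"
  unfolding Y_eq h_def mvec_def by (intro arg_cong2[where f = "(-)"] sum.cong refl) auto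

text \<open>A translation keeps the matrix, changes the linear coefficient by 2 A b and adds a
  constant. That constant contains the quadratic form at b, which dominates for long
  translations.\<close>

lemma Y_shift:
  "Y (gauss_shift n b x) = gxi_lin n (\<lambda>i. \<mu> i + 2 * mvec n A b i) A x + ((\<Sum>i<n. b i * \<mu> i) + qform n A b)"
proof -
  have "Y (gauss_shift n b x) = Y (\<lambda>i. x i + b i)" by (rule Y_cong) (simp add: gauss_shift_def)
  also have "\<dots> = (\<Sum>j<n. (x j + b j) * (\<mu> j + (mvec n A x j + mvec n A b j))) - mtrace n A"
    unfolding Y_eq h_def mvec_add ..
  also have "(\<Sum>j<n. (x j + b j) * (\<mu> j + (mvec n A x j + mvec n A b j)))
    = (\<Sum>j<n. x j * (\<mu> j + mvec n A b j + mvec n A x j)) + (\<Sum>j<n. b j * \<mu> j) + (\<Sum>j<n. b j * mvec n A x j) + (\<Sum>j<n. b j * mvec n A b j)"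
    unfolding sum.distrib[symmetric] by (rule sum.cong) (auto simp: algebra_simps)
  also have "(\<Sum>j<n. b j * mvec n A x j) = (\<Sum>j<n. x j * mvec n A b j)"
    using mvec_adjoint[where A = A and n = n and u = b and v = x, OF sym] by (simp add: mult.commute)
  finally show ?thesis
    by (simp add: xi_lin_def qform_def distrib_left sum.distrib sum_distrib_left mult.left_commute[of _ 2])
qed

lemma opnorm_square_le_var: "2 * (opnorm n A)\<^sup>2 \<le> var"
  using power_mono[OF opnorm_le_fnorm opnorm_nonneg, of n A 2] zero_le_power2[of "vnorm n \<mu>"]
  unfolding var_def by linarith

text \<open>After translation by \<open>b\<close>, \<open>Y\<close> is \<open>C\<close> plus a
  centred variable \<open>Z\<close>. With probability at least 3/4 the latter is below twice its
  standard deviation bound, so |Y| reaches the threshold; the Cameron-Martin bound returns to the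
  original measure.\<close>

lemma tail_lower_bound:
  assumes v: "var > 0" and r: "r \<ge> 0" and op: "opnorm n A > 0"
    and y: "sqrt var * y \<le> r\<^sup>2 * opnorm n A / 2 - 2 * sqrt ((2 + 4 * r\<^sup>2) * var)"
  shows "9 / 16 * exp (- r\<^sup>2) \<le> measure (gauss n) {x \<in> space (gauss n). y \<le> \<bar>Y x / sqrt var\<bar>}"
proof -
  obtain q where q: "vnorm n q = 1" "opnorm n A / 2 \<le> \<bar>qform n A q\<bar>" by (rule opnorm_witness[OF sym op])
  \<comment> \<open>The sign is chosen so that the linear and the quadratic contribution to the
    constant \<open>C\<close> do not cancel.\<close>
  define s where "s = (if (\<Sum>i<n. q i * \<mu> i) * qform n A q \<ge> 0 then r else - r)"
  define b where "b = (\<lambda>i. s * q i)"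
  have s2: "s\<^sup>2 = r\<^sup>2" by (simp add: s_def)
  have vb: "(vnorm n b)\<^sup>2 = r\<^sup>2" by (simp add: b_def vnorm_scale q s2 power_mult_distrib)
  define C where "C = (\<Sum>i<n. b i * \<mu> i) + qform n A b"
  have C_eq: "C = s * (\<Sum>i<n. q i * \<mu> i) + r\<^sup>2 * qform n A q"
    unfolding C_def b_def qform_scale s2 by (simp add: sum_distrib_left mult.assoc)
  have C: "r\<^sup>2 * opnorm n A / 2 \<le> \<bar>C\<bar>"
  proof -
    have pos: "0 \<le> s * (\<Sum>i<n. q i * \<mu> i) * qform n A q"
      using r by (auto simp: s_def mult.assoc mult_nonneg_nonpos mult_nonpos_nonneg)
    have "\<bar>r\<^sup>2 * qform n A q\<bar> \<le> \<bar>C\<bar>"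
    proof -
      have "(s * (\<Sum>i<n. q i * \<mu> i)) * (r\<^sup>2 * qform n A q) \<ge> 0"
        using mult_nonneg_nonneg[OF pos, of "r\<^sup>2"] by (simp add: mult_ac)
      moreover have "0 \<le> u * w \<Longrightarrow> \<bar>w\<bar> \<le> \<bar>u + w\<bar>" for u w :: real
        by (auto simp: zero_le_mult_iff)
      ultimately show ?thesis unfolding C_eq by blast
    qed
    moreover have "r\<^sup>2 * (opnorm n A / 2) \<le> r\<^sup>2 * \<bar>qform n A q\<bar>" using q(2) by (intro mult_left_mono) auto
    ultimately show ?thesis by (simp add: abs_mult)
  qed
  define Z where "Z = gxi_lin n (\<lambda>i. \<mu> i + 2 * mvec n A b i) A"
  \<comment> \<open>The 2 comes from splitting the square of \<mu> + 2 A b, and 4 r^2 var from 8 |A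
    b|^2 together with 2 (opnorm n A)^2 \<le> var.\<close>
  define V where "V = (2 + 4 * r\<^sup>2) * var"
  have V: "V > 0" using v unfolding V_def by (intro mult_pos_pos) (auto intro: add_pos_nonneg)
  have LZ: "Z \<in> L2_space (gauss n)" unfolding Z_def by (rule L2_gxi_lin)
  have Z2: "(\<integral>x. (Z x)\<^sup>2 \<partial>gauss n) \<le> V"
  proof -
    have "(vnorm n (\<lambda>i. \<mu> i + 2 * mvec n A b i))\<^sup>2 \<le> 2 * (vnorm n \<mu>)\<^sup>2 + 8 * (vnorm n (mvec n A b))\<^sup>2"
      unfolding vnorm_square sum_distrib_left sum.distrib[symmetric]
    proof (rule sum_mono)
      fix i
      show "(\<mu> i + 2 * mvec n A b i)\<^sup>2 \<le> 2 * (\<mu> i)\<^sup>2 + 8 * (mvec n A b i)\<^sup>2"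
        using zero_le_power2[of "\<mu> i - 2 * mvec n A b i"] by (simp add: power2_eq_square algebra_simps)
    qed
    also have "\<dots> \<le> 2 * (vnorm n \<mu>)\<^sup>2 + 8 * ((opnorm n A)\<^sup>2 * r\<^sup>2)"
      using vnorm_mvec_square_le[of n A b] vb by simp
    also have "8 * ((opnorm n A)\<^sup>2 * r\<^sup>2) \<le> 4 * r\<^sup>2 * var"
      using mult_left_mono[OF opnorm_square_le_var, of "4 * r\<^sup>2"] by simp
    finally show ?thesis
      unfolding Z_def gxi_lin_square sym_part_A V_def
      by (simp add: var_def algebra_simps add_increasing)
  qed
  have Zm [measurable]: "Z \<in> borel_measurable (gauss n)" using LZ by auto
  \<comment> \<open>Markov at four times the bound on the second moment leaves probability 3/4. Its
    square is the constant 9/16, because the Cameron-Martin bound is for the square.\<close>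
  let ?B = "{x \<in> space (gauss n). 4 * V \<le> (Z x)\<^sup>2}"
  have "measure (gauss n) ?B \<le> (\<integral>x. (Z x)\<^sup>2 \<partial>gauss n) / (4 * V)"
    by (rule integral_Markov_inequality_measure[where A = "{}"]) (use V L2_square_integrable[OF LZ] in auto)
  also have "\<dots> \<le> 1 / 4" using Z2 V by (simp add: divide_simps)
  finally have "measure (gauss n) ?B \<le> 1 / 4" .
  then have "3 / 4 \<le> measure (gauss n) (space (gauss n) - ?B)"
    by (subst gauss.prob_compl) auto
  let ?E = "{x \<in> space (gauss n). y \<le> \<bar>Y x / sqrt var\<bar>}"
  have E: "?E \<in> sets (gauss n)" by measurable
  have sub: "space (gauss n) - ?B \<subseteq> gauss_shift n b -` ?E \<inter> space (gauss n)"
  proof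
    fix x assume "x \<in> space (gauss n) - ?B"
    then have x: "x \<in> space (gauss n)" "(Z x)\<^sup>2 < 4 * V" by auto
    have sp: "gauss_shift n b x \<in> space (gauss n)" by (rule measurable_space[OF measurable_gauss_shift x(1)])
    have "\<bar>Z x\<bar> < sqrt (4 * V)" using x(2) by (metis real_sqrt_abs real_sqrt_less_iff)
    also have "sqrt (4 * V) = 2 * sqrt V" by (simp add: real_sqrt_mult)
    finally have "\<bar>Z x\<bar> < 2 * sqrt V" .
    then have "sqrt var * y \<le> \<bar>Y (gauss_shift n b x)\<bar>"
      using C y unfolding Y_shift C_def[symmetric] Z_def[symmetric] V_def[symmetric] by linarith
    then have "y \<le> \<bar>Y (gauss_shift n b x)\<bar> / sqrt var" using v by (simp add: pos_le_divide_eq mult.commute)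
    then show "x \<in> gauss_shift n b -` ?E \<inter> space (gauss n)" using x sp v by simp
  qed
  have "3 / 4 \<le> measure (gauss n) (gauss_shift n b -` ?E \<inter> space (gauss n))"
    using \<open>3 / 4 \<le> measure (gauss n) (space (gauss n) - ?B)\<close>
      gauss.finite_measure_mono[OF sub measurable_sets[OF measurable_gauss_shift E]] by linarith
  then have "(3 / 4)\<^sup>2 \<le> (measure (gauss n) (gauss_shift n b -` ?E \<inter> space (gauss n)))\<^sup>2"
    by (intro power_mono) auto
  also have "\<dots> \<le> exp (r\<^sup>2) * measure (gauss n) ?E"
    using Cameron_Martin_measure_le[OF E, of b] unfolding vb .
  finally have "9 / 16 \<le> exp (r\<^sup>2) * measure (gauss n) ?E" by (simp add: power2_eq_square)
  then have "9 / 16 * exp (- r\<^sup>2) \<le> exp (r\<^sup>2) * measure (gauss n) ?E * exp (- r\<^sup>2)"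
    by (intro mult_right_mono) auto
  also have "\<dots> = (exp (r\<^sup>2) * exp (- r\<^sup>2)) * measure (gauss n) ?E" by (simp only: mult_ac)
  also have "\<dots> = measure (gauss n) ?E" by (simp add: exp_minus_inverse)
  finally show ?thesis .
qed

end

text \<open>The threshold is of order c r^2 / 2, so the Gaussian tail there decays like an
  exponential of -r^4 and eventually falls below any multiple of exp (-r^2).\<close>

lemma gaussian_tail_smaller:
  fixes c :: real
  assumes c: "c > 0"
  obtains r where "0 \<le> r" "0 \<le> c * r\<^sup>2 / 2 - 2 * sqrt (2 + 4 * r\<^sup>2)"
    "2 * exp (- (c * r\<^sup>2 / 2 - 2 * sqrt (2 + 4 * r\<^sup>2))\<^sup>2 / 2) < 9 / 16 * exp (- r\<^sup>2)"
proof -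
  have "\<forall>\<^sub>F r in at_top. 0 \<le> (r::real)" by real_asymp
  moreover have "\<forall>\<^sub>F r in at_top. 0 \<le> c * r\<^sup>2 / 2 - 2 * sqrt (2 + 4 * r\<^sup>2)" using c by real_asymp
  moreover have "\<forall>\<^sub>F r in at_top. 2 * exp (- (c * r\<^sup>2 / 2 - 2 * sqrt (2 + 4 * r\<^sup>2))\<^sup>2 / 2) < 9 / 16 * exp (- r\<^sup>2)"
    using c by real_asymp
  ultimately have "\<forall>\<^sub>F r in at_top. 0 \<le> r \<and> 0 \<le> c * r\<^sup>2 / 2 - 2 * sqrt (2 + 4 * r\<^sup>2) \<and>
    2 * exp (- (c * r\<^sup>2 / 2 - 2 * sqrt (2 + 4 * r\<^sup>2))\<^sup>2 / 2) < 9 / 16 * exp (- r\<^sup>2)"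
    by eventually_elim auto
  then show ?thesis using that eventually_happens'[OF trivial_limit_at_top_linorder] by blast
qed

section \<open>Normal limits\<close>


text \<open>The frontier is contained in {y, -y}; being null, it lets weak convergence pass to the
  probability of this event.\<close>

lemma std_normal_frontier_abs: "emeasure std_normal_distribution (frontier {x::real. y \<le> \<bar>x\<bar>}) = 0"
proof -
  have cl: "closed {x::real. y \<le> \<bar>x\<bar>}" by (intro closed_Collect_le continuous_intros)
  have "{x::real. y < \<bar>x\<bar>} \<subseteq> interior {x. y \<le> \<bar>x\<bar>}"
    by (rule interior_maximal) (auto intro!: open_Collect_less continuous_intros)
  then have "frontier {x::real. y \<le> \<bar>x\<bar>} \<subseteq> {y, - y}"
    using cl by (force simp: frontier_def)
  then have "finite (frontier {x::real. y \<le> \<bar>x\<bar>})" by (rule finite_subset) simp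
  then have null: "frontier {x::real. y \<le> \<bar>x\<bar>} \<in> null_sets lborel" by (rule finite_imp_null_set_lborel)
  then show ?thesis by (subst emeasure_density) (auto intro: nn_integral_null_set null_setsD2)
qed

lemma norm_iexp_diff_le: "norm (iexp a - iexp b) \<le> \<bar>a - b\<bar>"
proof -
  have "iexp a = iexp b * iexp (a - b)" by (simp add: exp_add[symmetric] algebra_simps)
  then have "iexp a - iexp b = iexp b * (iexp (a - b) - (\<Sum>j\<le>0. (\<i> * of_real (a - b)) ^ j / fact j))"
    by (simp add: algebra_simps)
  then have "norm (iexp a - iexp b) = norm (iexp (a - b) - (\<Sum>j\<le>0. (\<i> * of_real (a - b)) ^ j / fact j))"
    by (simp add: norm_mult del: of_real_diff)
  also have "\<dots> \<le> \<bar>a - b\<bar> ^ Suc 0 / fact (Suc 0)" by (rule iexp_approx1)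
  finally show ?thesis by simp
qed

lemma char_distr_gauss:
  assumes "u \<in> borel_measurable (gauss n)"
  shows "char (distr (gauss n) borel u) t = (\<integral>x. iexp (t * u x) \<partial>gauss n)"
  unfolding char_def by (subst integral_distr) (use assms in auto)

lemma integrable_iexp_gauss: "u \<in> borel_measurable (gauss n) \<Longrightarrow> integrable (gauss n) (\<lambda>x. iexp (t * u x))"
  by (rule gauss.integrable_const_bound[of _ 1]) auto

lemma real_distribution_gauss: "u \<in> borel_measurable (gauss n) \<Longrightarrow> real_distribution (distr (gauss n) borel u)"
  by (rule gauss.real_distribution_distr)

context sym_chaos
begin

definition law :: "real measure" where "law = distr (gauss n) borel (\<lambda>x. Y x / sqrt var)"

lemma law_measurable: "(\<lambda>x. Y x / sqrt var) \<in> borel_measurable (gauss n)"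
  by measurable

lemma real_distribution_law: "real_distribution law"
  unfolding law_def by (rule real_distribution_gauss[OF law_measurable])

lemma char_law: "char law t = \<phi> (t / sqrt var)"
  unfolding law_def char_distr_gauss[OF law_measurable] \<phi>_def by simp

definition ratio :: real where "ratio = (opnorm n A)\<^sup>2 / ((vnorm n \<mu>)\<^sup>2 + (fnorm n A)\<^sup>2)"

lemma ratio_nonneg: "0 \<le> ratio" by (simp add: ratio_def)

lemma var_le: "var \<le> 2 * ((vnorm n \<mu>)\<^sup>2 + (fnorm n A)\<^sup>2)" "(vnorm n \<mu>)\<^sup>2 + (fnorm n A)\<^sup>2 \<le> var"
  by (simp_all add: var_def)

lemma var_pos: "var > 0 \<Longrightarrow> 0 < (vnorm n \<mu>)\<^sup>2 + (fnorm n A)\<^sup>2"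
  using less_le_trans[OF _ var_le(1), of 0] by simp

lemma char_law_approx:
  assumes v: "var > 0"
  shows "norm (char law t - exp (- t\<^sup>2 / 2)) \<le> 3 * t\<^sup>2 * sqrt ratio"
proof -
  have s: "(t / sqrt var)\<^sup>2 = t\<^sup>2 / var" using v by (simp add: power_divide)
  have "norm (char law t - exp (- t\<^sup>2 / 2)) \<le> t\<^sup>2 / var * (3 * opnorm n A * sqrt var)"
    using \<phi>_gaussian_approx[of "t / sqrt var"] v unfolding char_law s by simp
  also have "\<dots> = 3 * t\<^sup>2 * (opnorm n A / sqrt var)"
    using v real_sqrt_mult_self[of var] by (simp add: field_simps)
  also have "opnorm n A / sqrt var \<le> sqrt ratio"
  proof -
    have p: "0 < (vnorm n \<mu>)\<^sup>2 + (fnorm n A)\<^sup>2" by (rule var_pos[OF v])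
    have "sqrt ((opnorm n A)\<^sup>2 / var) \<le> sqrt ratio"
      unfolding ratio_def using var_le(2) p v by (intro real_sqrt_le_mono divide_left_mono) auto
    then show ?thesis using opnorm_nonneg[of n A] by (simp add: real_sqrt_divide)
  qed
  finally show ?thesis by (simp add: mult_left_mono)
qed

text \<open>The denominator of \<open>ratio\<close> and \<open>var\<close> agree up to a factor 2,
  which is the 2 under the root.\<close>

lemma opnorm_ge_of_ratio:
  assumes v: "var > 0" and e: "e > 0" "e \<le> ratio"
  shows "sqrt (e / 2) * sqrt var \<le> opnorm n A"
proof -
  have p: "0 < (vnorm n \<mu>)\<^sup>2 + (fnorm n A)\<^sup>2" by (rule var_pos[OF v])
  have "e / 2 * var \<le> e * ((vnorm n \<mu>)\<^sup>2 + (fnorm n A)\<^sup>2)"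
    using mult_left_mono[OF var_le(1), of "e / 2"] e by simp
  also have "\<dots> \<le> (opnorm n A)\<^sup>2" using e(2) p by (simp add: ratio_def pos_le_divide_eq)
  finally have "sqrt (e / 2 * var) \<le> sqrt ((opnorm n A)\<^sup>2)" by (rule real_sqrt_le_mono)
  then have "sqrt (e / 2) * sqrt var \<le> \<bar>opnorm n A\<bar>" by (simp only: real_sqrt_mult real_sqrt_abs)
  then show ?thesis using opnorm_nonneg[of n A] by simp
qed

text \<open>After normalization the bound depends on \<open>c\<close> and \<open>r\<close> only, so
  it is uniform along a sequence of varying dimension and coefficients.\<close>

lemma law_tail_lower_bound:
  assumes v: "var > 0" and c: "c > 0" "c * sqrt var \<le> opnorm n A" and r: "r \<ge> 0"
  shows "9 / 16 * exp (- r\<^sup>2) \<le> measure law {x. c * r\<^sup>2 / 2 - 2 * sqrt (2 + 4 * r\<^sup>2) \<le> \<bar>x\<bar>}"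
proof -
  have op: "opnorm n A > 0" using c v by (smt (verit) mult_pos_pos real_sqrt_gt_zero)
  have "sqrt var * (c * r\<^sup>2 / 2 - 2 * sqrt (2 + 4 * r\<^sup>2)) = r\<^sup>2 * (c * sqrt var) / 2 - 2 * sqrt ((2 + 4 * r\<^sup>2) * var)"
    unfolding real_sqrt_mult[of "2 + 4 * r\<^sup>2"] by (simp add: algebra_simps)
  also have "\<dots> \<le> r\<^sup>2 * opnorm n A / 2 - 2 * sqrt ((2 + 4 * r\<^sup>2) * var)"
    using c(2) by (simp add: mult_left_mono)
  finally have "9 / 16 * exp (- r\<^sup>2)
     \<le> measure (gauss n) {x \<in> space (gauss n). c * r\<^sup>2 / 2 - 2 * sqrt (2 + 4 * r\<^sup>2) \<le> \<bar>Y x / sqrt var\<bar>}"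
    by (rule tail_lower_bound[OF v r op])
  also have "\<dots> = measure law {x. c * r\<^sup>2 / 2 - 2 * sqrt (2 + 4 * r\<^sup>2) \<le> \<bar>x\<bar>}"
    unfolding law_def by (subst measure_distr) (auto simp: vimage_def Int_def conj_commute)
  finally show ?thesis .
qed

end

text \<open>Positive variance is required eventually only, as that is what a vanishing relative
  error yields. The limit is phrased through characteristic functions, which are easy to transfer
  from \<open>Y\<close> to \<xi>.\<close>

theorem sym_chaos_clt:
  fixes n :: "nat \<Rightarrow> nat"
  assumes sym: "\<And>k. sym_chaos (A k)"
    and pos: "\<forall>\<^sub>F k in sequentially. sym_chaos.var (n k) (\<mu> k) (A k) > 0"
  shows "(\<lambda>k. sym_chaos.ratio (n k) (\<mu> k) (A k)) \<longlonglongrightarrow> 0 \<longleftrightarrow>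
    (\<forall>t. (\<lambda>k. char (sym_chaos.law (n k) (\<mu> k) (A k)) t) \<longlonglongrightarrow> exp (- t\<^sup>2 / 2))"
proof
  interpret S: sym_chaos "n k" "\<mu> k" "A k" for k by (rule sym)
  assume lim: "(\<lambda>k. S.ratio k) \<longlonglongrightarrow> 0"
  show "\<forall>t. (\<lambda>k. char (S.law k) t) \<longlonglongrightarrow> exp (- t\<^sup>2 / 2)"
  proof
    fix t
    show "(\<lambda>k. char (S.law k) t) \<longlonglongrightarrow> exp (- t\<^sup>2 / 2)"
    proof (rule LIM_zero_cancel, rule Lim_null_comparison)
      show "\<forall>\<^sub>F k in sequentially. norm (char (S.law k) t - exp (- t\<^sup>2 / 2)) \<le> 3 * t\<^sup>2 * sqrt (S.ratio k)"
        using pos by eventually_elim (rule S.char_law_approx)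
      show "(\<lambda>k. 3 * t\<^sup>2 * sqrt (S.ratio k)) \<longlonglongrightarrow> 0"
        using tendsto_mult[OF tendsto_const[of "3 * t\<^sup>2"] tendsto_real_sqrt[OF lim]] by simp
    qed
  qed
next
  interpret S: sym_chaos "n k" "\<mu> k" "A k" for k by (rule sym)
  assume char: "\<forall>t. (\<lambda>k. char (S.law k) t) \<longlonglongrightarrow> exp (- t\<^sup>2 / 2)"
  have wc: "weak_conv_m (\<lambda>k. S.law k) std_normal_distribution"
    by (rule levy_continuity[OF S.real_distribution_law real_dist_normal_dist])
       (use char in \<open>simp add: char_std_normal_distribution\<close>)
  show "(\<lambda>k. S.ratio k) \<longlonglongrightarrow> 0"
  proof (rule ccontr)
    assume "\<not> (\<lambda>k. S.ratio k) \<longlonglongrightarrow> 0"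
    then obtain e where e: "e > 0" "\<not> (\<forall>\<^sub>F k in sequentially. S.ratio k < e)"
      using S.ratio_nonneg unfolding tendsto_iff by (auto simp: dist_real_def)
    define c where "c = sqrt (e / 2)"
    have c: "c > 0" using e by (simp add: c_def)
    obtain r where r: "0 \<le> r" "0 \<le> c * r\<^sup>2 / 2 - 2 * sqrt (2 + 4 * r\<^sup>2)"
      "2 * exp (- (c * r\<^sup>2 / 2 - 2 * sqrt (2 + 4 * r\<^sup>2))\<^sup>2 / 2) < 9 / 16 * exp (- r\<^sup>2)"
      by (rule gaussian_tail_smaller[OF c])
    define y where "y = c * r\<^sup>2 / 2 - 2 * sqrt (2 + 4 * r\<^sup>2)"
    \<comment> \<open>\<open>c\<close> and hence \<open>r\<close>, \<open>y\<close> depend on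
      \<open>e\<close> alone, so this is convergence on one fixed event; its limit is strictly below
      the uniform lower bound that holds whenever the ratio is at least \<open>e\<close>.\<close>
    have "(\<lambda>k. measure (S.law k) {x. y \<le> \<bar>x\<bar>}) \<longlonglongrightarrow> measure std_normal_distribution {x. y \<le> \<bar>x\<bar>}"
      by (rule weak_conv_imp_continuity_set_conv[OF S.real_distribution_law real_dist_normal_dist wc])
         (auto simp: std_normal_frontier_abs)
    moreover have "measure std_normal_distribution {x. y \<le> \<bar>x\<bar>} < 9 / 16 * exp (- r\<^sup>2)"
      using std_normal_tail[of y] r(2,3) unfolding y_def[symmetric] by linarith
    ultimately have "\<forall>\<^sub>F k in sequentially. measure (S.law k) {x. y \<le> \<bar>x\<bar>} < 9 / 16 * exp (- r\<^sup>2)"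
      by (rule order_tendstoD(2))
    then have "\<forall>\<^sub>F k in sequentially. S.ratio k < e"
      using pos
    proof eventually_elim
      case (elim k)
      show "S.ratio k < e"
      proof (rule ccontr)
        assume "\<not> S.ratio k < e"
        then have "c * sqrt (S.var k) \<le> opnorm (n k) (A k)"
          unfolding c_def by (intro S.opnorm_ge_of_ratio elim e) simp
        from S.law_tail_lower_bound[OF elim(2) c this r(1)] elim(1) show False
          unfolding y_def by linarith
      qed
    qed
    then show False using e by blast
  qed
qed

section \<open>Transfer of the limit from the projection to \<xi>\<close>

context stein_data
begin

definition tau :: real where "tau = sqrt (\<integral>x. (gxi n f G x)\<^sup>2 \<partial>gauss n)"

lemma gxi_measurable: "gxi n f G \<in> borel_measurable (gauss n)" "gxi n f G \<in> borel_measurable (borel_n n)"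
  using L2_measurable[OF stein_system_L2(3)[OF system]] L2_gauss_measurable[OF stein_system_L2(3)[OF system]] by auto

lemma standardized_law_xi: "standardized_law M (xi n z f G) = distr (gauss n) borel (\<lambda>x. gxi n f G x / tau)"
proof -
  interpret M: prob_space M by (rule M_prob_space)
  have "M.expectation (xi n z f G) = 0"
    unfolding xi_z(1) using integral_z[OF gxi_measurable(2)] gxi_mean[OF system] by simp
  then have "M.variance (xi n z f G) = (\<integral>x. (gxi n f G x)\<^sup>2 \<partial>gauss n)"
    using square_integrals(1) by simp
  then have "standardized_law M (xi n z f G) = distr M borel (\<lambda>\<omega>. gxi n f G (z \<omega>) / tau)"
    unfolding standardized_law_def by (simp add: xi_z(1) tau_def)
  also have "\<dots> = distr (distr M (borel_n n) z) borel (\<lambda>x. gxi n f G x / tau)"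
    by (subst distr_distr[OF _ z_measurable]) (use gxi_measurable in \<open>auto simp: o_def\<close>)
  finally show ?thesis unfolding distr_z .
qed

sublocale chaos: sym_chaos n m "sym_part a"
  by standard (simp add: sym_part_def add.commute)

lemma chaos_Y: "chaos.Y = gxi_lin n m a"
  unfolding chaos.Y_def using gxi_lin_sym_part[of n m a] by auto

lemma chaos_var: "chaos.var = (vnorm n m)\<^sup>2 + 2 * (fnorm n (sym_part a))\<^sup>2"
  by (rule chaos.var_def)

text \<open>Both normalized variables are unit vectors. As \<open>Y\<close> is a projection of
  \<xi>, their inner product is var / (tau sqrt var) = sqrt var / tau, which gives the L2 distance,
  and s \<mapsto> exp (i s a) is Lipschitz in a with constant |s|.\<close>

lemma char_difference:
  assumes v: "chaos.var > 0" and t: "tau > 0"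
  shows "norm (char (standardized_law M (xi n z f G)) s - char chaos.law s) \<le> \<bar>s\<bar> * sqrt (2 - 2 * (sqrt chaos.var / tau))"
proof -
  let ?X = "\<lambda>x. gxi n f G x / tau" and ?Y = "\<lambda>x. chaos.Y x / sqrt chaos.var"
  have LX: "?X \<in> L2_space (gauss n)"
    using L2_scale[OF stein_system_L2(3)[OF system], of "inverse tau"] by (simp add: divide_inverse mult.commute)
  have LY: "?Y \<in> L2_space (gauss n)"
    using L2_scale[OF chaos.L2_Y, of "inverse (sqrt chaos.var)"] by (simp add: divide_inverse mult.commute)
  have mX: "?X \<in> borel_measurable (gauss n)" and mY: "?Y \<in> borel_measurable (gauss n)"
    using LX LY by auto
  have iX: "integrable (gauss n) (\<lambda>x. iexp (s * ?X x))" and iY: "integrable (gauss n) (\<lambda>x. iexp (s * ?Y x))"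
    by (rule integrable_iexp_gauss[OF mX], rule integrable_iexp_gauss[OF mY])
  have tau2: "tau\<^sup>2 = (\<integral>x. (gxi n f G x)\<^sup>2 \<partial>gauss n)" by (simp add: tau_def)
  have XY: "(\<integral>x. gxi n f G x * chaos.Y x \<partial>gauss n) = chaos.var"
    unfolding chaos_Y inner_lin lin_inner_self chaos_var ..
  have "(\<integral>x. (?X x - ?Y x)\<^sup>2 \<partial>gauss n) = 2 - 2 * (sqrt chaos.var / tau)"
  proof -
    have "(\<integral>x. (?X x)\<^sup>2 \<partial>gauss n) = 1"
      using t by (simp add: power_divide tau2[symmetric])
    moreover have "(\<integral>x. (?Y x)\<^sup>2 \<partial>gauss n) = 1"
      using v chaos.Y_square by (simp add: power_divide)
    moreover have "(\<integral>x. ?X x * ?Y x \<partial>gauss n) = sqrt chaos.var / tau"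
    proof -
      have "(\<integral>x. ?X x * ?Y x \<partial>gauss n) = (\<integral>x. gxi n f G x * chaos.Y x / (tau * sqrt chaos.var) \<partial>gauss n)" by simp
      also have "\<dots> = chaos.var / (tau * sqrt chaos.var)" by (simp only: integral_divide_zero XY)
      also have "\<dots> = sqrt chaos.var / tau"
        using v t real_sqrt_mult_self[of chaos.var] by (simp add: field_simps)
      finally show ?thesis .
    qed
    ultimately show ?thesis unfolding L2_diff_square[OF LX LY] by simp
  qed
  then have L1: "(\<integral>x. \<bar>?X x - ?Y x\<bar> \<partial>gauss n) \<le> sqrt (2 - 2 * (sqrt chaos.var / tau))"
    using gauss.L2_abs_integral_le[OF L2_diff[OF LX LY]] by simp
  have eq: "char (standardized_law M (xi n z f G)) s - char chaos.law s = (\<integral>x. iexp (s * ?X x) - iexp (s * ?Y x) \<partial>gauss n)"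
    unfolding standardized_law_xi chaos.law_def char_distr_gauss[OF mX] char_distr_gauss[OF mY]
    by (rule Bochner_Integration.integral_diff[OF iX iY, symmetric])
  have "norm (char (standardized_law M (xi n z f G)) s - char chaos.law s)
    \<le> (\<integral>x. norm (iexp (s * ?X x) - iexp (s * ?Y x)) \<partial>gauss n)"
    unfolding eq by (rule integral_norm_bound)
  also have "\<dots> \<le> (\<integral>x. \<bar>s\<bar> * \<bar>?X x - ?Y x\<bar> \<partial>gauss n)"
  proof (rule integral_mono)
    show "integrable (gauss n) (\<lambda>x. norm (iexp (s * ?X x) - iexp (s * ?Y x)))"
      by (rule integrable_norm[OF Bochner_Integration.integrable_diff[OF iX iY]])
    show "integrable (gauss n) (\<lambda>x. \<bar>s\<bar> * \<bar>?X x - ?Y x\<bar>)"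
      by (intro integrable_mult_right integrable_abs gauss.L2_integrable L2_diff LX LY)
    show "norm (iexp (s * ?X x) - iexp (s * ?Y x)) \<le> \<bar>s\<bar> * \<bar>?X x - ?Y x\<bar>" for x
      using norm_iexp_diff_le[of "s * ?X x" "s * ?Y x"] by (simp only: right_diff_distrib[symmetric] abs_mult)
  qed
  also have "\<dots> \<le> \<bar>s\<bar> * sqrt (2 - 2 * (sqrt chaos.var / tau))"
    using L1 by (simp add: mult_left_mono)
  finally show ?thesis .
qed

lemma real_distribution_xi: "real_distribution (standardized_law M (xi n z f G))"
  unfolding standardized_law_xi by (rule real_distribution_gauss) (use gxi_measurable in auto)

lemma tau_square: "tau\<^sup>2 = (\<integral>\<omega>. (xi n z f G \<omega>)\<^sup>2 \<partial>M)" "tau \<ge> 0"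
  by (simp_all add: tau_def square_integrals)

lemma eps12_eq: "eps12_sq n M z f G = 1 - chaos.var / tau\<^sup>2"
  and eps2_eq: "eps2_sq n M z f G = 1 - 2 * (fnorm n (sym_part a))\<^sup>2 / tau\<^sup>2"
  unfolding eps12_sq_def eps2_sq_def square_integrals(2) tau_square(1) chaos_var by (simp_all add: norms_zero)

lemma var_le_tau: "chaos.var \<le> tau\<^sup>2"
proof -
  have "0 \<le> (\<integral>x. (gxi n f G x - gxi_lin n m a x)\<^sup>2 \<partial>gauss n)" by simp
  then show ?thesis unfolding xi_minus_lin_square chaos_var by (simp add: tau_def)
qed

end

text \<open>A vanishing relative error means var / tau^2 tends to 1. The two normalized laws then
  have asymptotically equal characteristic functions, and Levy's continuity theorem does the
  rest.\<close>

theorem stein_clt: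
  fixes M :: "nat \<Rightarrow> 'a measure"
  assumes model: "\<And>k. stein_model (n k) (M k) (z k) (f k) (G k)"
    and pos: "\<And>k. (\<integral>\<omega>. (xi (n k) (z k) (f k) (G k) \<omega>)\<^sup>2 \<partial>M k) > 0"
    and eps: "(\<lambda>k. eps12_sq (n k) (M k) (z k) (f k) (G k)) \<longlonglongrightarrow> 0"
  shows "(\<lambda>k. (opnorm (n k) (sym_part (mean_G (M k) (z k) (G k))))\<^sup>2 / ((vnorm (n k) (mean_f (M k) (z k) (f k)))\<^sup>2
      + (fnorm (n k) (sym_part (mean_G (M k) (z k) (G k))))\<^sup>2)) \<longlonglongrightarrow> 0 \<longleftrightarrow>
    weak_conv_m (\<lambda>k. standardized_law (M k) (xi (n k) (z k) (f k) (G k))) std_normal_distribution"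
proof -
  interpret S: stein_data "n k" "M k" "z k" "f k" "G k" for k
    by standard (rule model)
  have tau: "S.tau k > 0" for k
    using pos[of k] S.tau_square[of k] by (metis less_le power_zero_numeral)
  have lim2: "(\<lambda>k. S.chaos.var k / (S.tau k)\<^sup>2) \<longlonglongrightarrow> 1"
    using tendsto_diff[OF tendsto_const[of 1] eps] by (simp add: S.eps12_eq)
  have vp: "\<forall>\<^sub>F k in sequentially. S.chaos.var k > 0"
    using order_tendstoD(1)[OF lim2, of 0]
    by (auto elim!: eventually_mono simp: zero_less_divide_iff)
  have lim1: "(\<lambda>k. sqrt (S.chaos.var k) / S.tau k) \<longlonglongrightarrow> 1"
    using tendsto_real_sqrt[OF lim2] tau by (simp add: real_sqrt_divide less_imp_le)
  have diff: "(\<lambda>k. char (standardized_law (M k) (xi (n k) (z k) (f k) (G k))) t - char (S.chaos.law k) t) \<longlonglongrightarrow> 0" for t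
  proof (rule Lim_null_comparison)
    show "\<forall>\<^sub>F k in sequentially. norm (char (standardized_law (M k) (xi (n k) (z k) (f k) (G k))) t - char (S.chaos.law k) t)
      \<le> \<bar>t\<bar> * sqrt (2 - 2 * (sqrt (S.chaos.var k) / S.tau k))"
      using vp by eventually_elim (rule S.char_difference[OF _ tau])
    show "(\<lambda>k. \<bar>t\<bar> * sqrt (2 - 2 * (sqrt (S.chaos.var k) / S.tau k))) \<longlonglongrightarrow> 0"
      using tendsto_mult[OF tendsto_const[of "\<bar>t\<bar>"] tendsto_real_sqrt[OF tendsto_diff[OF tendsto_const[of 2]
          tendsto_mult[OF tendsto_const[of 2] lim1]]]] by simp
  qed
  have "(\<lambda>k. S.chaos.ratio k) \<longlonglongrightarrow> 0 \<longleftrightarrow> (\<forall>t. (\<lambda>k. char (S.chaos.law k) t) \<longlonglongrightarrow> exp (- t\<^sup>2 / 2))"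
    by (rule sym_chaos_clt[OF S.chaos.sym_chaos_axioms vp])
  also have "\<dots> \<longleftrightarrow> (\<forall>t. (\<lambda>k. char (standardized_law (M k) (xi (n k) (z k) (f k) (G k))) t) \<longlonglongrightarrow> exp (- t\<^sup>2 / 2))"
    using Lim_transform_eq[OF diff] by simp
  also have "\<dots> \<longleftrightarrow> weak_conv_m (\<lambda>k. standardized_law (M k) (xi (n k) (z k) (f k) (G k))) std_normal_distribution"
  proof
    assume "\<forall>t. (\<lambda>k. char (standardized_law (M k) (xi (n k) (z k) (f k) (G k))) t) \<longlonglongrightarrow> exp (- t\<^sup>2 / 2)"
    then show "weak_conv_m (\<lambda>k. standardized_law (M k) (xi (n k) (z k) (f k) (G k))) std_normal_distribution"
      by (intro levy_continuity[OF S.real_distribution_xi real_dist_normal_dist]) (simp add: char_std_normal_distribution)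
  next
    assume "weak_conv_m (\<lambda>k. standardized_law (M k) (xi (n k) (z k) (f k) (G k))) std_normal_distribution"
    from levy_continuity1[OF S.real_distribution_xi real_dist_normal_dist this]
    show "\<forall>t. (\<lambda>k. char (standardized_law (M k) (xi (n k) (z k) (f k) (G k))) t) \<longlonglongrightarrow> exp (- t\<^sup>2 / 2)"
      by (simp add: char_std_normal_distribution)
  qed
  finally show ?thesis unfolding S.chaos.ratio_def .
qed

text \<open>The error of the full projection lies between 0 and that of the second chaos, so the
  previous criterion applies. Both errors vanishing forces v / T to 0 and F / T to 1/2, hence the
  two denominators are asymptotically equal.\<close>

theorem stein_clt_second_chaos:
  fixes M :: "nat \<Rightarrow> 'a measure"
  assumes model: "\<And>k. stein_model (n k) (M k) (z k) (f k) (G k)"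
    and pos: "\<And>k. (\<integral>\<omega>. (xi (n k) (z k) (f k) (G k) \<omega>)\<^sup>2 \<partial>M k) > 0"
    and eps: "(\<lambda>k. eps2_sq (n k) (M k) (z k) (f k) (G k)) \<longlonglongrightarrow> 0"
  shows "(\<lambda>k. (opnorm (n k) (sym_part (mean_G (M k) (z k) (G k))))\<^sup>2
      / (fnorm (n k) (sym_part (mean_G (M k) (z k) (G k))))\<^sup>2) \<longlonglongrightarrow> 0 \<longleftrightarrow>
    weak_conv_m (\<lambda>k. standardized_law (M k) (xi (n k) (z k) (f k) (G k))) std_normal_distribution"
proof -
  interpret S: stein_data "n k" "M k" "z k" "f k" "G k" for k
    by standard (rule model)
  define v where "v = (\<lambda>k. (vnorm (n k) (mean_f (M k) (z k) (f k)))\<^sup>2)"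
  define F where "F = (\<lambda>k. (fnorm (n k) (sym_part (mean_G (M k) (z k) (G k))))\<^sup>2)"
  define p where "p = (\<lambda>k. (opnorm (n k) (sym_part (mean_G (M k) (z k) (G k))))\<^sup>2)"
  define T where "T = (\<lambda>k. (S.tau k)\<^sup>2)"
  have T: "T k > 0" for k using pos[of k] S.tau_square(1)[of k] by (simp add: T_def)
  have nn: "v k \<ge> 0" "F k \<ge> 0" "p k \<ge> 0" for k by (simp_all add: v_def F_def p_def)
  have le: "v k + 2 * F k \<le> T k" for k
    using S.var_le_tau[of k] unfolding S.chaos_var v_def F_def T_def .
  have e2: "(\<lambda>k. 1 - 2 * F k / T k) \<longlonglongrightarrow> 0" using eps unfolding S.eps2_eq F_def T_def .
  have e12: "eps12_sq (n k) (M k) (z k) (f k) (G k) = 1 - (v k + 2 * F k) / T k" for k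
    unfolding S.eps12_eq S.chaos_var v_def F_def T_def ..
  have eps12: "(\<lambda>k. eps12_sq (n k) (M k) (z k) (f k) (G k)) \<longlonglongrightarrow> 0"
    unfolding e12
  proof (rule tendsto_sandwich[OF always_eventually always_eventually tendsto_const e2]; intro allI)
    show "0 \<le> 1 - (v k + 2 * F k) / T k" for k using le[of k] T[of k] by simp
    show "1 - (v k + 2 * F k) / T k \<le> 1 - 2 * F k / T k" for k
      using nn[of k] T[of k] by (simp add: divide_right_mono)
  qed
  have F1: "(\<lambda>k. F k / T k) \<longlonglongrightarrow> 1 / 2"
  proof -
    have "(\<lambda>k. (1 - (1 - 2 * F k / T k)) / 2) \<longlonglongrightarrow> (1 - 0) / 2" by (intro tendsto_intros e2) simp
    then show ?thesis by simp
  qed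
  have "(\<lambda>k. (1 - 2 * F k / T k) - eps12_sq (n k) (M k) (z k) (f k) (G k)) \<longlonglongrightarrow> 0 - 0"
    by (intro tendsto_diff e2 eps12)
  then have v1: "(\<lambda>k. v k / T k) \<longlonglongrightarrow> 0" unfolding e12 by (simp add: add_divide_distrib)
  have Fpos: "\<forall>\<^sub>F k in sequentially. F k > 0"
  proof -
    have "\<forall>\<^sub>F k in sequentially. 0 < F k / T k" using order_tendstoD(1)[OF F1, of 0] by simp
    then show ?thesis
    proof eventually_elim
      case (elim k)
      then show ?case using T[of k] by (simp add: zero_less_divide_iff)
    qed
  qed
  \<comment> \<open>Dividing by T gives both parts limits of their own; the quotient is (v + F) / F,
    the factor between the two ratios.\<close>
  have "(\<lambda>k. (v k / T k + F k / T k) / (F k / T k)) \<longlonglongrightarrow> (0 + 1 / 2) / (1 / 2)"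
    by (intro tendsto_intros v1 F1) simp
  then have quot: "(\<lambda>k. (v k / T k + F k / T k) / (F k / T k)) \<longlonglongrightarrow> 1" by simp
  have "(\<lambda>k. p k / F k) \<longlonglongrightarrow> 0 \<longleftrightarrow> (\<lambda>k. p k / (v k + F k)) \<longlonglongrightarrow> 0"
  proof
    assume lim: "(\<lambda>k. p k / F k) \<longlonglongrightarrow> 0"
    show "(\<lambda>k. p k / (v k + F k)) \<longlonglongrightarrow> 0"
    proof (rule tendsto_sandwich[OF always_eventually _ tendsto_const lim])
      show "\<forall>k. 0 \<le> p k / (v k + F k)" using nn by simp
      show "\<forall>\<^sub>F k in sequentially. p k / (v k + F k) \<le> p k / F k"
        using Fpos by eventually_elim (use nn in \<open>auto intro!: divide_left_mono mult_pos_pos add_nonneg_pos\<close>)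
    qed
  next
    assume lim: "(\<lambda>k. p k / (v k + F k)) \<longlonglongrightarrow> 0"
    have "(\<lambda>k. p k / (v k + F k) * ((v k / T k + F k / T k) / (F k / T k))) \<longlonglongrightarrow> 0 * 1"
      by (intro tendsto_mult lim quot)
    moreover have "\<forall>\<^sub>F k in sequentially. p k / (v k + F k) * ((v k / T k + F k / T k) / (F k / T k)) = p k / F k"
      using Fpos
    proof eventually_elim
      case (elim k)
      have "v k + F k > 0" using elim nn(1)[of k] by linarith
      then show ?case using elim T[of k] by (simp add: add_divide_distrib[symmetric])
    qed
    ultimately show "(\<lambda>k. p k / F k) \<longlonglongrightarrow> 0" by (simp add: Lim_transform_eventually)
  qed
  also have "\<dots> \<longleftrightarrow> weak_conv_m (\<lambda>k. standardized_law (M k) (xi (n k) (z k) (f k) (G k))) std_normal_distribution"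
    unfolding p_def v_def F_def by (rule stein_clt[OF model pos eps12])
  finally show ?thesis unfolding p_def F_def .
qed

theorem theorem2p4:
  shows
   "(\<forall>n (M :: 'a measure) z f G. stein_model n M z f G \<longrightarrow>
      (let \<mu> = mean_f M z f; A = mean_G M z G;
           X = xi n z f G; Y = xi_lin n z \<mu> A;
           Y1 = xi_lin n z \<mu> (\<lambda>i j. 0); Y2 = xi_lin n z (\<lambda>i. 0) A;
           D = (\<lambda>\<omega> i j. G (z \<omega>) i j - A i j)
       in is_L2_projection M (H12 n z) X Y
        \<and> (\<integral>\<omega>. (X \<omega> - Y \<omega>)\<^sup>2 \<partial>M)
            = (\<integral>\<omega>. (vnorm n (\<lambda>i. f (z \<omega>) i - \<mu> i))\<^sup>2 \<partial>M) - (fnorm n A)\<^sup>2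
              + (\<integral>\<omega>. mtrace n (mmul n (D \<omega>) (D \<omega>)) \<partial>M)
        \<and> (\<integral>\<omega>. (vnorm n (\<lambda>i. f (z \<omega>) i - \<mu> i))\<^sup>2 \<partial>M) - (fnorm n A)\<^sup>2
              + (\<integral>\<omega>. mtrace n (mmul n (D \<omega>) (D \<omega>)) \<partial>M)
            \<le> 2 * (\<integral>\<omega>. (fnorm n (sym_part (D \<omega>)))\<^sup>2 \<partial>M)
        \<and> is_L2_projection M (H1 n z) X Y1
        \<and> is_L2_projection M (H1 n z) Y Y1
        \<and> (\<integral>\<omega>. (Y \<omega> - Y1 \<omega>)\<^sup>2 \<partial>M) = 2 * (fnorm n (sym_part A))\<^sup>2
        \<and> is_L2_projection M (H2 n z) X Y2
        \<and> is_L2_projection M (H2 n z) Y Y2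
        \<and> (\<integral>\<omega>. (Y \<omega> - Y2 \<omega>)\<^sup>2 \<partial>M) = (vnorm n \<mu>)\<^sup>2))
  \<and> (\<forall>n (M :: 'a measure) z f G. stein_model n M z f G \<and> (\<integral>\<omega>. (xi n z f G \<omega>)\<^sup>2 \<partial>M) > 0 \<longrightarrow>
      (let \<mu> = mean_f M z f; A = mean_G M z G;
           S = 2 * (\<integral>\<omega>. (fnorm n (sym_part (\<lambda>i j. G (z \<omega>) i j - A i j)))\<^sup>2 \<partial>M);
           T = (vnorm n \<mu>)\<^sup>2 + 2 * (\<integral>\<omega>. (fnorm n (sym_part (G (z \<omega>))))\<^sup>2 \<partial>M)
       in eps12_sq n M z f G \<le> S / T
        \<and> eps2_sq n M z f G \<le> ((vnorm n \<mu>)\<^sup>2 + S) / T))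
  \<and> (\<forall>n (M :: nat \<Rightarrow> 'a measure) z f G.
      (\<forall>k. stein_model (n k) (M k) (z k) (f k) (G k)
         \<and> (\<integral>\<omega>. (xi (n k) (z k) (f k) (G k) \<omega>)\<^sup>2 \<partial>M k) > 0) \<longrightarrow>
      (let \<mu> = (\<lambda>k. mean_f (M k) (z k) (f k)); As = (\<lambda>k. sym_part (mean_G (M k) (z k) (G k)));
           CLT = weak_conv_m (\<lambda>k. standardized_law (M k) (xi (n k) (z k) (f k) (G k)))
                   std_normal_distribution
       in ((\<lambda>k. eps12_sq (n k) (M k) (z k) (f k) (G k)) \<longlonglongrightarrow> 0 \<longrightarrow>
             ((\<lambda>k. (opnorm (n k) (As k))\<^sup>2 / ((vnorm (n k) (\<mu> k))\<^sup>2 + (fnorm (n k) (As k))\<^sup>2)) \<longlonglongrightarrow> 0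
                \<longleftrightarrow> CLT))
        \<and> ((\<lambda>k. eps2_sq (n k) (M k) (z k) (f k) (G k)) \<longlonglongrightarrow> 0 \<longrightarrow>
             ((\<lambda>k. (opnorm (n k) (As k))\<^sup>2 / (fnorm (n k) (As k))\<^sup>2) \<longlonglongrightarrow> 0 \<longleftrightarrow> CLT))))"
proof (intro conjI allI impI)
  fix n and M :: "'a measure" and z f G
  assume "stein_model n M z f G"
  then interpret S: stein_data n M z f G by unfold_locales
  show "let \<mu> = mean_f M z f; A = mean_G M z G;
           X = xi n z f G; Y = xi_lin n z \<mu> A;
           Y1 = xi_lin n z \<mu> (\<lambda>i j. 0); Y2 = xi_lin n z (\<lambda>i. 0) A;
           D = (\<lambda>\<omega> i j. G (z \<omega>) i j - A i j)
       in is_L2_projection M (H12 n z) X Y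
        \<and> (\<integral>\<omega>. (X \<omega> - Y \<omega>)\<^sup>2 \<partial>M)
            = (\<integral>\<omega>. (vnorm n (\<lambda>i. f (z \<omega>) i - \<mu> i))\<^sup>2 \<partial>M) - (fnorm n A)\<^sup>2
              + (\<integral>\<omega>. mtrace n (mmul n (D \<omega>) (D \<omega>)) \<partial>M)
        \<and> (\<integral>\<omega>. (vnorm n (\<lambda>i. f (z \<omega>) i - \<mu> i))\<^sup>2 \<partial>M) - (fnorm n A)\<^sup>2
              + (\<integral>\<omega>. mtrace n (mmul n (D \<omega>) (D \<omega>)) \<partial>M)
            \<le> 2 * (\<integral>\<omega>. (fnorm n (sym_part (D \<omega>)))\<^sup>2 \<partial>M)
        \<and> is_L2_projection M (H1 n z) X Y1
        \<and> is_L2_projection M (H1 n z) Y Y1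
        \<and> (\<integral>\<omega>. (Y \<omega> - Y1 \<omega>)\<^sup>2 \<partial>M) = 2 * (fnorm n (sym_part A))\<^sup>2
        \<and> is_L2_projection M (H2 n z) X Y2
        \<and> is_L2_projection M (H2 n z) Y Y2
        \<and> (\<integral>\<omega>. (Y \<omega> - Y2 \<omega>)\<^sup>2 \<partial>M) = (vnorm n \<mu>)\<^sup>2"
    \<comment> \<open>The formula is folded back into the squared error, so the claimed equality
      becomes trivial and the inequality is \<open>xi_minus_lin_square_le\<close>.\<close>
    unfolding Let_def S.integrals_z S.square_integrals(3) S.xi_minus_lin_square_formula[symmetric]
    by (intro conjI refl S.part1 S.lin_differences S.xi_minus_lin_square_le)
next
  fix n and M :: "'a measure" and z f G
  assume a: "stein_model n M z f G \<and> (\<integral>\<omega>. (xi n z f G \<omega>)\<^sup>2 \<partial>M) > 0"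
  then interpret S: stein_data n M z f G by unfold_locales simp
  show "let \<mu> = mean_f M z f; A = mean_G M z G;
           S = 2 * (\<integral>\<omega>. (fnorm n (sym_part (\<lambda>i j. G (z \<omega>) i j - A i j)))\<^sup>2 \<partial>M);
           T = (vnorm n \<mu>)\<^sup>2 + 2 * (\<integral>\<omega>. (fnorm n (sym_part (G (z \<omega>))))\<^sup>2 \<partial>M)
       in eps12_sq n M z f G \<le> S / T
        \<and> eps2_sq n M z f G \<le> ((vnorm n \<mu>)\<^sup>2 + S) / T"
    unfolding Let_def by (intro conjI S.part2_bounds conjunct2[OF a])
next
  fix n :: "nat \<Rightarrow> nat" and M :: "nat \<Rightarrow> 'a measure" and z f G
  assume a: "\<forall>k. stein_model (n k) (M k) (z k) (f k) (G k)
         \<and> (\<integral>\<omega>. (xi (n k) (z k) (f k) (G k) \<omega>)\<^sup>2 \<partial>M k) > 0"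
  then have model: "stein_model (n k) (M k) (z k) (f k) (G k)"
    and pos: "(\<integral>\<omega>. (xi (n k) (z k) (f k) (G k) \<omega>)\<^sup>2 \<partial>M k) > 0" for k by simp_all
  show "let \<mu> = (\<lambda>k. mean_f (M k) (z k) (f k)); As = (\<lambda>k. sym_part (mean_G (M k) (z k) (G k)));
           CLT = weak_conv_m (\<lambda>k. standardized_law (M k) (xi (n k) (z k) (f k) (G k)))
                   std_normal_distribution
       in ((\<lambda>k. eps12_sq (n k) (M k) (z k) (f k) (G k)) \<longlonglongrightarrow> 0 \<longrightarrow>
             ((\<lambda>k. (opnorm (n k) (As k))\<^sup>2 / ((vnorm (n k) (\<mu> k))\<^sup>2 + (fnorm (n k) (As k))\<^sup>2)) \<longlonglongrightarrow> 0
                \<longleftrightarrow> CLT))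
        \<and> ((\<lambda>k. eps2_sq (n k) (M k) (z k) (f k) (G k)) \<longlonglongrightarrow> 0 \<longrightarrow>
             ((\<lambda>k. (opnorm (n k) (As k))\<^sup>2 / (fnorm (n k) (As k))\<^sup>2) \<longlonglongrightarrow> 0 \<longleftrightarrow> CLT))"
    unfolding Let_def
    by (intro conjI impI stein_clt[OF model pos] stein_clt_second_chaos[OF model pos])
qed

end
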